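(* Let $X$ be a smooth manifold, $\mathcal{A} \to X$ a Lie algebroid with anchor $\rho_{\mathcal{A}}$, and let $\pi$ be a Poisson structure on $X$ of $\mathcal{A}$-type. Then $$\mathcal{F}_\pi \subseteq \mathcal{F}_{\pi,\mathrm{mod}} \subseteq \rho_{\mathcal{A}}(\Gamma(\mathcal{A})) \subseteq \Gamma(TX),$$ and the orbits of $\mathcal{A}$ are $\pi$-Poisson submanifolds.
   Context: An $\mathcal{A}$-Poisson structure is a section $\pi_{\mathcal{A}} \in \Gamma(\wedge^2 \mathcal{A})$ with $[\pi_{\mathcal{A}},\pi_{\mathcal{A}}]_{\mathcal{A}} = 0$ (Schouten bracket). A Poisson structure $\pi$ on $X$ is of $\mathcal{A}$-type if there exists an $\mathcal{A}$-Poisson structure $\pi_{\mathcal{A}}$ with $\rho_{\mathcal{A}}(\pi_{\mathcal{A}}) = \pi$, i.e. $\pi^\sharp = \rho_{\mathcal{A}} \circ \pi_{\mathcal{A}}^\sharp \circ \rho_{\mathcal{A}}^*$. $\mathcal{F}_\pi := \pi^\sharp(\Gamma(T^*X))$ is the module of vector fields generated by Hamiltonian vector fields $V_f = \pi^\sharp(df)$. For a local volume form $\mu$, the modular vector field $V_{\pi,\mu}$ is defined by $\mathcal{L}_{V_f}\mu = (\mathcal{L}_{V_{\pi,\mu}} f)\,\mu$ for all functions $f$; changing $\mu$ changes it by a Hamiltonian vector field. The modular foliation $\mathcal{F}_{\pi,\mathrm{mod}}$ is the sheaf of submodules of the sheaf of vector fields spanned by the Hamiltonian vector fields and the local modular vector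 fields; the inclusions are understood as inclusions of sheaves of submodules of vector fields. The orbits of $\mathcal{A}$ are the maximal connected immersed submanifolds $\mathcal{O}$ with $T_x\mathcal{O} = \mathrm{im}\,\rho_{\mathcal{A},x}$ for all $x \in \mathcal{O}$. A submanifold $N$ is $\pi$-Poisson if $\pi^\sharp(T_x^*X) \subseteq T_xN$ for all $x \in N$. *)

theory Defs
  imports "HOL-Analysis.Analysis" "HOL-Library.Function_Algebras"
begin

instantiation "fun" :: (type, real_vector) real_vector
begin

definition scaleR_fun :: "real \<Rightarrow> ('a \<Rightarrow> 'b) \<Rightarrow> 'a \<Rightarrow> 'b"
  where "scaleR_fun a f = (\<lambda>x. a *\<^sub>R f x)"

instance
  by standard (simp_all add: scaleR_fun_def fun_eq_iff scaleR_add_right scaleR_add_left)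

end


section \<open>Smooth functions and manifolds\<close>

text \<open>
  \<open>\<real>\<^sup>n\<close> is \<^const>\<open>Euclidean_space\<close> \<open>n\<close>: the functions \<open>nat \<Rightarrow> real\<close> that vanish at all \<open>i \<ge> n\<close>.
  This allows manifolds of any dimension, including \<open>0\<close>, and submanifolds whose dimension
  depends on a point.
\<close>

definition partial :: "nat \<Rightarrow> ((nat \<Rightarrow> real) \<Rightarrow> real) \<Rightarrow> (nat \<Rightarrow> real) \<Rightarrow> real"
  where "partial i f z = deriv (\<lambda>t. f (z(i := t))) (z i)"

text \<open>Used for \<open>S\<close> open in \<open>\<real>\<^sup>n\<close>.\<close>

fun Ck_on :: "nat \<Rightarrow> nat \<Rightarrow> (nat \<Rightarrow> real) set \<Rightarrow> ((nat \<Rightarrow> real) \<Rightarrow> real) \<Rightarrow> bool"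
  where
    "Ck_on n 0 S f \<longleftrightarrow> continuous_on S f"
  | "Ck_on n (Suc k) S f \<longleftrightarrow> continuous_on S f \<and>
       (\<forall>i<n. (\<forall>z\<in>S. (\<lambda>t. f (z(i := t))) differentiable at (z i)) \<and> Ck_on n k S (partial i f))"

definition smooth_on :: "nat \<Rightarrow> (nat \<Rightarrow> real) set \<Rightarrow> ((nat \<Rightarrow> real) \<Rightarrow> real) \<Rightarrow> bool"
  where "smooth_on n S f \<longleftrightarrow> (\<forall>k. Ck_on n k S f)"

type_synonym 'x chart = "'x set \<times> ('x \<Rightarrow> nat \<Rightarrow> real)"

record 'x manifold =
  man_top :: "'x topology"
  man_dim :: nat
  atlas :: "'x chart set"

abbreviation points :: "'x manifold \<Rightarrow> 'x set"
  where "points M \<equiv> topspace (man_top M)"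

definition is_chart :: "'x topology \<Rightarrow> nat \<Rightarrow> 'x chart \<Rightarrow> bool"
  where "is_chart T n = (\<lambda>(U, \<phi>).
    openin T U \<and> openin (Euclidean_space n) (\<phi> ` U) \<and>
    homeomorphic_map (subtopology T U) (subtopology (Euclidean_space n) (\<phi> ` U)) \<phi>)"

definition smooth_manifold :: "'x manifold \<Rightarrow> bool"
  where "smooth_manifold M \<longleftrightarrow>
    Hausdorff_space (man_top M) \<and> second_countable (man_top M) \<and>
    (\<forall>c\<in>atlas M. is_chart (man_top M) (man_dim M) c) \<and>
    (\<Union>c\<in>atlas M. fst c) = points M \<and>
    (\<forall>(U, \<phi>)\<in>atlas M. \<forall>(W, \<psi>)\<in>atlas M. \<forall>i<man_dim M.
       smooth_on (man_dim M) (\<phi> ` (U \<inter> W)) (\<lambda>z. \<psi> (inv_into U \<phi> z) i))"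

text \<open>
  Functions, sections and forms over an open set \<open>W\<close> are total functions whose values
  outside \<open>W\<close> are irrelevant.
\<close>

definition smooth_fun :: "'x manifold \<Rightarrow> 'x set \<Rightarrow> ('x \<Rightarrow> real) \<Rightarrow> bool"
  where "smooth_fun M W f \<longleftrightarrow> openin (man_top M) W \<and>
    (\<forall>(U, \<phi>)\<in>atlas M. smooth_on (man_dim M) (\<phi> ` (U \<inter> W)) (\<lambda>z. f (inv_into U \<phi> z)))"

definition smooth_near :: "'x manifold \<Rightarrow> 'x \<Rightarrow> ('x \<Rightarrow> real) \<Rightarrow> bool"
  where "smooth_near M x f \<longleftrightarrow> (\<exists>W. x \<in> W \<and> smooth_fun M W f)"


section \<open>Tangent vectors and vector bundles\<close>

text \<open>
  A tangent vector at \<open>x\<close> is an operator \<open>f \<mapsto> \<Sum> a\<^sub>i (\<partial>f/\<partial>x\<^sub>i)(x)\<close> on the functions that are smooth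
  near \<open>x\<close>, extended by \<open>0\<close> to all other functions.
\<close>

type_synonym 'x tvec = "('x \<Rightarrow> real) \<Rightarrow> real"

definition coord_vector :: "'x manifold \<Rightarrow> 'x chart \<Rightarrow> nat \<Rightarrow> 'x \<Rightarrow> 'x tvec"
  where "coord_vector M c i x = (\<lambda>f.
    if smooth_near M x f then partial i (\<lambda>z. f (inv_into (fst c) (snd c) z)) (snd c x) else 0)"

definition tangent_space :: "'x manifold \<Rightarrow> 'x \<Rightarrow> 'x tvec set"
  where "tangent_space M x =
    {v. \<exists>c\<in>atlas M. x \<in> fst c \<and> (\<exists>a. v = (\<Sum>i<man_dim M. a i *\<^sub>R coord_vector M c i x))}"

text \<open>
  The fibres of a vector bundle are subspaces of one real vector space type; up to isomorphism
  this is no restriction, since every bundle has its fibres inside their direct sum.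
  The smooth structure is given by local frames, which are indexed by \<open>{..<bundle_rank}\<close>.
\<close>

record ('x, 'v) vbundle =
  fibre :: "'x \<Rightarrow> 'v set"
  bundle_rank :: nat
  frames :: "('x set \<times> (nat \<Rightarrow> 'x \<Rightarrow> 'v)) set"

definition sections ::
    "'x manifold \<Rightarrow> ('x, 'v::real_vector, 'm) vbundle_scheme \<Rightarrow> 'x set \<Rightarrow> ('x \<Rightarrow> 'v) set"
  where "sections M B W = {s. openin (man_top M) W \<and> (\<forall>x\<in>W. s x \<in> fibre B x) \<and>
    (\<forall>(U, e)\<in>frames B. \<exists>g. (\<forall>i<bundle_rank B. smooth_fun M (U \<inter> W) (g i)) \<and>
       (\<forall>x\<in>U \<inter> W. s x = (\<Sum>i<bundle_rank B. g i x *\<^sub>R e i x)))}"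

definition vector_bundle :: "'x manifold \<Rightarrow> ('x, 'v::real_vector, 'm) vbundle_scheme \<Rightarrow> bool"
  where "vector_bundle M B \<longleftrightarrow>
    (\<Union>c\<in>frames B. fst c) = points M \<and>
    (\<forall>(U, e)\<in>frames B. openin (man_top M) U \<and>
       (\<forall>x\<in>U. inj_on (\<lambda>i. e i x) {..<bundle_rank B} \<and> independent ((\<lambda>i. e i x) ` {..<bundle_rank B}) \<and>
          span ((\<lambda>i. e i x) ` {..<bundle_rank B}) = fibre B x) \<and>
       (\<forall>i<bundle_rank B. e i \<in> sections M B U))"

definition linear_between ::
    "'v::real_vector set \<Rightarrow> 'w::real_vector set \<Rightarrow> ('v \<Rightarrow> 'w) \<Rightarrow> bool"
  where "linear_between V W f \<longleftrightarrow> f ` V \<subseteq> W \<and>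
    (\<forall>u\<in>V. \<forall>v\<in>V. \<forall>a b. f (a *\<^sub>R u + b *\<^sub>R v) = a *\<^sub>R f u + b *\<^sub>R f v)"

text \<open>Covectors are extended by \<open>0\<close> outside the fibre, so that they are determined on it.\<close>

definition dual :: "'v::real_vector set \<Rightarrow> ('v \<Rightarrow> real) set"
  where "dual V = {\<alpha>. linear_between V UNIV \<alpha> \<and> (\<forall>v. v \<notin> V \<longrightarrow> \<alpha> v = 0)}"

definition dual_sections ::
    "'x manifold \<Rightarrow> ('x, 'v::real_vector, 'm) vbundle_scheme \<Rightarrow> 'x set \<Rightarrow> ('x \<Rightarrow> 'v \<Rightarrow> real) set"
  where "dual_sections M B W = {\<alpha>. openin (man_top M) W \<and> (\<forall>x\<in>W. \<alpha> x \<in> dual (fibre B x)) \<and>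
    (\<forall>W' s. W' \<subseteq> W \<and> s \<in> sections M B W' \<longrightarrow> smooth_fun M W' (\<lambda>x. \<alpha> x (s x)))}"


section \<open>Lie algebroids\<close>

record ('x, 'v) algebroid = "('x, 'v) vbundle" +
  anchor :: "'x \<Rightarrow> 'v \<Rightarrow> 'x tvec"
  bracket :: "('x \<Rightarrow> 'v) \<Rightarrow> ('x \<Rightarrow> 'v) \<Rightarrow> 'x \<Rightarrow> 'v"

definition vf_bracket :: "'x manifold \<Rightarrow> ('x \<Rightarrow> 'x tvec) \<Rightarrow> ('x \<Rightarrow> 'x tvec) \<Rightarrow> 'x \<Rightarrow> 'x tvec"
  where "vf_bracket M V W x = (\<lambda>f.
    if smooth_near M x f then V x (\<lambda>y. W y f) - W x (\<lambda>y. V y f) else 0)"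

definition tangent_algebroid :: "'x manifold \<Rightarrow> ('x, 'x tvec) algebroid"
  where "tangent_algebroid M =
    \<lparr>fibre = tangent_space M, bundle_rank = man_dim M,
     frames = (\<lambda>c. (fst c, coord_vector M c)) ` atlas M,
     anchor = (\<lambda>x v. v), bracket = vf_bracket M\<rparr>"

abbreviation vector_fields :: "'x manifold \<Rightarrow> 'x set \<Rightarrow> ('x \<Rightarrow> 'x tvec) set"
  where "vector_fields M \<equiv> sections M (tangent_algebroid M)"

abbreviation one_forms :: "'x manifold \<Rightarrow> 'x set \<Rightarrow> ('x \<Rightarrow> 'x tvec \<Rightarrow> real) set"
  where "one_forms M \<equiv> dual_sections M (tangent_algebroid M)"

text \<open>
  The bracket is defined on global sections. Since these are total functions, one has to say
  that it only depends on the values on \<open>M\<close>.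
\<close>

definition lie_algebroid :: "'x manifold \<Rightarrow> ('x, 'v::real_vector) algebroid \<Rightarrow> bool"
  where "lie_algebroid M A \<longleftrightarrow>
    vector_bundle M A \<and>
    (\<forall>x\<in>points M. linear_between (fibre A x) (tangent_space M x) (anchor A x)) \<and>
    (\<forall>W. \<forall>s\<in>sections M A W. (\<lambda>x. anchor A x (s x)) \<in> vector_fields M W) \<and>
    (\<forall>s\<in>sections M A (points M). \<forall>t\<in>sections M A (points M).
       bracket A s t \<in> sections M A (points M) \<and>
       (\<forall>s'\<in>sections M A (points M). \<forall>t'\<in>sections M A (points M).
          (\<forall>x\<in>points M. s x = s' x \<and> t x = t' x) \<longrightarrow>
          (\<forall>x\<in>points M. bracket A s t x = bracket A s' t' x)) \<and>
       (\<forall>x\<in>points M. bracket A s t x = - bracket A t s x) \<and>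
       (\<forall>u\<in>sections M A (points M). \<forall>x\<in>points M.
          (\<forall>a b. bracket A (\<lambda>y. a *\<^sub>R s y + b *\<^sub>R t y) u x =
             a *\<^sub>R bracket A s u x + b *\<^sub>R bracket A t u x) \<and>
          bracket A s (bracket A t u) x + bracket A t (bracket A u s) x +
            bracket A u (bracket A s t) x = 0) \<and>
       (\<forall>f. smooth_fun M (points M) f \<longrightarrow> (\<forall>x\<in>points M.
          bracket A s (\<lambda>y. f y *\<^sub>R t y) x =
            f x *\<^sub>R bracket A s t x + anchor A x (s x) f *\<^sub>R t x)) \<and>
       \<comment> \<open>the anchor is a morphism (this also follows from the other axioms)\<close>
       (\<forall>x\<in>points M. anchor A x (bracket A s t x) =
          vf_bracket M (\<lambda>y. anchor A y (s y)) (\<lambda>y. anchor A y (t y)) x))"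

definition anchor_image :: "'x manifold \<Rightarrow> ('x, 'v::real_vector) algebroid \<Rightarrow>
    'x set \<Rightarrow> ('x \<Rightarrow> 'x tvec) set"
  where "anchor_image M A U = {V. \<exists>s\<in>sections M A U. \<forall>x\<in>U. V x = anchor A x (s x)}"


section \<open>Poisson structures\<close>

text \<open>
  Elements of \<open>\<Lambda>\<^sup>2 V\<close> and \<open>\<Lambda>\<^sup>3 V\<close> are identified with the alternating forms on \<^term>\<open>dual V\<close>.
\<close>

type_synonym 'v bivec = "('v \<Rightarrow> real) \<Rightarrow> ('v \<Rightarrow> real) \<Rightarrow> real"
type_synonym 'v trivec = "('v \<Rightarrow> real) \<Rightarrow> ('v \<Rightarrow> real) \<Rightarrow> ('v \<Rightarrow> real) \<Rightarrow> real"

definition wedge2 :: "'v \<Rightarrow> 'v \<Rightarrow> 'v bivec"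
  where "wedge2 u v \<alpha> \<beta> = \<alpha> u * \<beta> v - \<alpha> v * \<beta> u"

definition wedge3 :: "'v \<Rightarrow> 'v \<Rightarrow> 'v \<Rightarrow> 'v trivec"
  where "wedge3 u v w \<alpha> \<beta> \<gamma> = \<alpha> u * wedge2 v w \<beta> \<gamma> - \<alpha> v * wedge2 u w \<beta> \<gamma> + \<alpha> w * wedge2 u v \<beta> \<gamma>"

definition bivector_field ::
    "'x manifold \<Rightarrow> ('x, 'v::real_vector, 'm) vbundle_scheme \<Rightarrow> ('x \<Rightarrow> 'v bivec) \<Rightarrow> bool"
  where "bivector_field M B P \<longleftrightarrow>
    (\<forall>x\<in>points M. \<forall>\<alpha>\<in>dual (fibre B x).
       linear_between (dual (fibre B x)) UNIV (\<lambda>\<beta>. P x \<alpha> \<beta>) \<and>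
       linear_between (dual (fibre B x)) UNIV (\<lambda>\<beta>. P x \<beta> \<alpha>) \<and>
       P x \<alpha> \<alpha> = 0) \<and>
    (\<forall>W. \<forall>\<alpha>\<in>dual_sections M B W. \<forall>\<beta>\<in>dual_sections M B W.
       smooth_fun M W (\<lambda>x. P x (\<alpha> x) (\<beta> x)))"

text \<open>
  \<open>R = [P, Q]\<close>, where the Schouten bracket is the biderivation extension of the Lie bracket, so that
  \<open>[X \<and> Y, Z \<and> W] = [X,Z] \<and> Y \<and> W - [X,W] \<and> Y \<and> Z - [Y,Z] \<and> X \<and> W + [Y,W] \<and> X \<and> Z\<close>.
  Locally, every bivector field is a finite sum of such wedge products of global sections.
\<close>

definition has_schouten_bracket :: "'x manifold \<Rightarrow> ('x, 'v::real_vector) algebroid \<Rightarrow>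
    ('x \<Rightarrow> 'v bivec) \<Rightarrow> ('x \<Rightarrow> 'v bivec) \<Rightarrow> ('x \<Rightarrow> 'v trivec) \<Rightarrow> bool"
  where "has_schouten_bracket M A P Q R \<longleftrightarrow>
    (\<forall>U (N::nat) (K::nat) X Y Z W.
       openin (man_top M) U \<and>
       (\<forall>k<N. X k \<in> sections M A (points M) \<and> Y k \<in> sections M A (points M)) \<and>
       (\<forall>l<K. Z l \<in> sections M A (points M) \<and> W l \<in> sections M A (points M)) \<and>
       (\<forall>x\<in>U. \<forall>\<alpha>\<in>dual (fibre A x). \<forall>\<beta>\<in>dual (fibre A x).
          P x \<alpha> \<beta> = (\<Sum>k<N. wedge2 (X k x) (Y k x) \<alpha> \<beta>) \<and>
          Q x \<alpha> \<beta> = (\<Sum>l<K. wedge2 (Z l x) (W l x) \<alpha> \<beta>)) \<longrightarrow>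
       (\<forall>x\<in>U. \<forall>\<alpha>\<in>dual (fibre A x). \<forall>\<beta>\<in>dual (fibre A x). \<forall>\<gamma>\<in>dual (fibre A x).
          R x \<alpha> \<beta> \<gamma> = (\<Sum>k<N. \<Sum>l<K.
              wedge3 (bracket A (X k) (Z l) x) (Y k x) (W l x) \<alpha> \<beta> \<gamma>
            - wedge3 (bracket A (X k) (W l) x) (Y k x) (Z l x) \<alpha> \<beta> \<gamma>
            - wedge3 (bracket A (Y k) (Z l) x) (X k x) (W l x) \<alpha> \<beta> \<gamma>
            + wedge3 (bracket A (Y k) (W l) x) (X k x) (Z l x) \<alpha> \<beta> \<gamma>)))"

definition algebroid_poisson ::
    "'x manifold \<Rightarrow> ('x, 'v::real_vector) algebroid \<Rightarrow> ('x \<Rightarrow> 'v bivec) \<Rightarrow> bool"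
  where "algebroid_poisson M A P \<longleftrightarrow>
    bivector_field M A P \<and> has_schouten_bracket M A P P (\<lambda>x \<alpha> \<beta> \<gamma>. 0)"

definition poisson_structure :: "'x manifold \<Rightarrow> ('x \<Rightarrow> 'x tvec bivec) \<Rightarrow> bool"
  where "poisson_structure M \<pi> \<longleftrightarrow> algebroid_poisson M (tangent_algebroid M) \<pi>"

text \<open>Convention: \<open>\<beta> (P\<^sup>\<sharp> \<alpha>) = P(\<alpha>, \<beta>)\<close>.\<close>

definition sharp :: "('x, 'v::real_vector, 'm) vbundle_scheme \<Rightarrow> ('x \<Rightarrow> 'v bivec) \<Rightarrow>
    'x \<Rightarrow> ('v \<Rightarrow> real) \<Rightarrow> 'v"
  where "sharp B P x \<alpha> = (THE v. v \<in> fibre B x \<and> (\<forall>\<beta>\<in>dual (fibre B x). \<beta> v = P x \<alpha> \<beta>))"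

definition anchor_dual ::
    "('x, 'v::real_vector) algebroid \<Rightarrow> 'x \<Rightarrow> ('x tvec \<Rightarrow> real) \<Rightarrow> 'v \<Rightarrow> real"
  where "anchor_dual A x \<alpha> = (\<lambda>a. if a \<in> fibre A x then \<alpha> (anchor A x a) else 0)"

definition of_algebroid_type ::
    "'x manifold \<Rightarrow> ('x, 'v::real_vector) algebroid \<Rightarrow> ('x \<Rightarrow> 'x tvec bivec) \<Rightarrow> bool"
  where "of_algebroid_type M A \<pi> \<longleftrightarrow>
    (\<exists>P. algebroid_poisson M A P \<and>
      (\<forall>x\<in>points M. \<forall>\<alpha>\<in>dual (tangent_space M x).
         sharp (tangent_algebroid M) \<pi> x \<alpha> = anchor A x (sharp A P x (anchor_dual A x \<alpha>))))"


section \<open>Hamiltonian and modular vector fields\<close>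

definition differential :: "'x manifold \<Rightarrow> ('x \<Rightarrow> real) \<Rightarrow> 'x \<Rightarrow> 'x tvec \<Rightarrow> real"
  where "differential M f x = (\<lambda>v. if v \<in> tangent_space M x then v f else 0)"

definition hamiltonian :: "'x manifold \<Rightarrow> ('x \<Rightarrow> 'x tvec bivec) \<Rightarrow> ('x \<Rightarrow> real) \<Rightarrow> 'x \<Rightarrow> 'x tvec"
  where "hamiltonian M \<pi> f x = sharp (tangent_algebroid M) \<pi> x (differential M f x)"

text \<open>The arguments of a form of top degree are given as a list of length \<^term>\<open>man_dim M\<close>.\<close>

definition volume_form :: "'x manifold \<Rightarrow> 'x set \<Rightarrow> ('x \<Rightarrow> 'x tvec list \<Rightarrow> real) \<Rightarrow> bool"
  where "volume_form M U \<mu> \<longleftrightarrow> openin (man_top M) U \<and>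
    (\<forall>x\<in>U. \<forall>vs. length vs = man_dim M \<and> set vs \<subseteq> tangent_space M x \<longrightarrow>
       (\<forall>i<man_dim M. linear_between (tangent_space M x) UNIV (\<lambda>v. \<mu> x (vs[i := v]))) \<and>
       (\<forall>i<man_dim M. \<forall>j<man_dim M. i \<noteq> j \<and> vs ! i = vs ! j \<longrightarrow> \<mu> x vs = 0)) \<and>
    (\<forall>x\<in>U. \<exists>vs. length vs = man_dim M \<and> set vs \<subseteq> tangent_space M x \<and> \<mu> x vs \<noteq> 0) \<and>
    (\<forall>W Ys. W \<subseteq> U \<and> openin (man_top M) W \<and> length Ys = man_dim M \<and>
       set Ys \<subseteq> vector_fields M W \<longrightarrow>
       smooth_fun M W (\<lambda>x. \<mu> x (map (\<lambda>Y. Y x) Ys)))"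

text \<open>
  \<open>(L\<^sub>V \<mu>)(Y\<^sub>1, \<dots>, Y\<^sub>n) = V (\<mu>(Y\<^sub>1, \<dots>, Y\<^sub>n)) - \<Sum> \<mu>(Y\<^sub>1, \<dots>, [V, Y\<^sub>i], \<dots>, Y\<^sub>n)\<close> at the point \<open>x\<close>
\<close>

definition lie_derivative_form :: "'x manifold \<Rightarrow> ('x \<Rightarrow> 'x tvec) \<Rightarrow>
    ('x \<Rightarrow> 'x tvec list \<Rightarrow> real) \<Rightarrow> ('x \<Rightarrow> 'x tvec) list \<Rightarrow> 'x \<Rightarrow> real"
  where "lie_derivative_form M V \<mu> Ys x =
    V x (\<lambda>y. \<mu> y (map (\<lambda>Y. Y y) Ys)) -
    (\<Sum>i<length Ys. \<mu> x ((map (\<lambda>Y. Y x) Ys)[i := vf_bracket M V (Ys ! i) x]))"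

definition modular_field :: "'x manifold \<Rightarrow> ('x \<Rightarrow> 'x tvec bivec) \<Rightarrow> 'x set \<Rightarrow>
    ('x \<Rightarrow> 'x tvec list \<Rightarrow> real) \<Rightarrow> ('x \<Rightarrow> 'x tvec) \<Rightarrow> bool"
  where "modular_field M \<pi> U \<mu> V \<longleftrightarrow> V \<in> vector_fields M U \<and>
    (\<forall>f. smooth_fun M U f \<longrightarrow>
       (\<forall>W Ys. W \<subseteq> U \<and> openin (man_top M) W \<and> length Ys = man_dim M \<and>
          set Ys \<subseteq> vector_fields M W \<longrightarrow>
          (\<forall>x\<in>W. lie_derivative_form M (hamiltonian M \<pi> f) \<mu> Ys x =
             V x f * \<mu> x (map (\<lambda>Y. Y x) Ys))))"

text \<open>
  Submodules of the sheaf of vector fields are given by their sections over each open set.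
  The modular foliation is the sheaf spanned by the Hamiltonian and the local modular
  vector fields: its sections are locally finite linear combinations of these with smooth
  coefficients. (Presheaf images of bundle maps are already sheaves, by partitions of unity.)
\<close>

definition hamiltonian_sheaf :: "'x manifold \<Rightarrow> ('x \<Rightarrow> 'x tvec bivec) \<Rightarrow>
    'x set \<Rightarrow> ('x \<Rightarrow> 'x tvec) set"
  where "hamiltonian_sheaf M \<pi> U =
    {V. \<exists>\<alpha>\<in>one_forms M U. \<forall>x\<in>U. V x = sharp (tangent_algebroid M) \<pi> x (\<alpha> x)}"

definition spanned_sheaf :: "'x manifold \<Rightarrow> ('x set \<Rightarrow> ('x \<Rightarrow> 'x tvec) set) \<Rightarrow>
    'x set \<Rightarrow> ('x \<Rightarrow> 'x tvec) set"
  where "spanned_sheaf M G U = {V. \<forall>x\<in>U. \<exists>W. x \<in> W \<and> W \<subseteq> U \<and> openin (man_top M) W \<and>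
    (\<exists>(N::nat) g Z. (\<forall>k<N. smooth_fun M W (g k) \<and> Z k \<in> G W) \<and>
       (\<forall>y\<in>W. V y = (\<Sum>k<N. g k y *\<^sub>R Z k y)))}"

definition modular_foliation :: "'x manifold \<Rightarrow> ('x \<Rightarrow> 'x tvec bivec) \<Rightarrow>
    'x set \<Rightarrow> ('x \<Rightarrow> 'x tvec) set"
  where "modular_foliation M \<pi> = spanned_sheaf M (\<lambda>W.
    {hamiltonian M \<pi> f | f. smooth_fun M W f} \<union>
    {V. \<exists>\<mu>. volume_form M W \<mu> \<and> modular_field M \<pi> W \<mu> V})"


section \<open>Orbits and Poisson submanifolds\<close>

definition smooth_map :: "'y manifold \<Rightarrow> 'x manifold \<Rightarrow> ('y \<Rightarrow> 'x) \<Rightarrow> bool"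
  where "smooth_map N M F \<longleftrightarrow> continuous_map (man_top N) (man_top M) F \<and>
    (\<forall>(U, \<phi>)\<in>atlas M. \<forall>i<man_dim M. smooth_fun N {y \<in> points N. F y \<in> U} (\<lambda>y. \<phi> (F y) i))"

definition push_forward ::
    "'x manifold \<Rightarrow> ('y \<Rightarrow> 'x) \<Rightarrow> 'y \<Rightarrow> 'y tvec \<Rightarrow> 'x tvec"
  where "push_forward M F y v = (\<lambda>f. if smooth_near M (F y) f then v (f \<circ> F) else 0)"

text \<open>
  \<open>N\<close> carries a manifold structure of its own on a subset of \<open>M\<close>; its topology may be finer than
  the subspace topology.
\<close>

definition immersed_submanifold :: "'x manifold \<Rightarrow> 'x manifold \<Rightarrow> bool"
  where "immersed_submanifold M N \<longleftrightarrow> smooth_manifold N \<and> smooth_map N M (\<lambda>y. y) \<and>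
    (\<forall>y\<in>points N. inj_on (push_forward M (\<lambda>y. y) y) (tangent_space N y))"

definition sub_tangent_space :: "'x manifold \<Rightarrow> 'x manifold \<Rightarrow> 'x \<Rightarrow> 'x tvec set"
  where "sub_tangent_space M N y = push_forward M (\<lambda>y. y) y ` tangent_space N y"

definition integral_manifold ::
    "'x manifold \<Rightarrow> ('x, 'v::real_vector) algebroid \<Rightarrow> 'x manifold \<Rightarrow> bool"
  where "integral_manifold M A N \<longleftrightarrow>
    immersed_submanifold M N \<and> points N \<noteq> {} \<and> connected_space (man_top N) \<and>
    (\<forall>x\<in>points N. sub_tangent_space M N x = anchor A x ` fibre A x)"

definition orbit :: "'x manifold \<Rightarrow> ('x, 'v::real_vector) algebroid \<Rightarrow> 'x manifold \<Rightarrow> bool"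
  where "orbit M A N \<longleftrightarrow> integral_manifold M A N \<and>
    (\<forall>N'. integral_manifold M A N' \<and> points N \<subseteq> points N' \<longrightarrow> points N' = points N)"

definition poisson_submanifold ::
    "'x manifold \<Rightarrow> ('x \<Rightarrow> 'x tvec bivec) \<Rightarrow> 'x manifold \<Rightarrow> bool"
  where "poisson_submanifold M \<pi> N \<longleftrightarrow> immersed_submanifold M N \<and>
    (\<forall>x\<in>points N. sharp (tangent_algebroid M) \<pi> x ` dual (tangent_space M x)
       \<subseteq> sub_tangent_space M N x)"

end

theory Submission
  imports Defs
begin

text \<open>
  Only the middle inclusion has content. Near a point write \<open>\<pi>\<^sub>A\<^sup>\<sharp> \<alpha> = \<Sum>\<^sub>j (\<alpha>(s\<^sub>j) t\<^sub>j - \<alpha>(t\<^sub>j) s\<^sub>j)\<close> with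
  global sections \<open>s\<^sub>j, t\<^sub>j\<close> of \<open>A\<close>, and let \<open>X\<^sub>j = \<rho>(s\<^sub>j)\<close>, \<open>Y\<^sub>j = \<rho>(t\<^sub>j)\<close>, so that
  \<open>V\<^sub>f = \<Sum>\<^sub>j ((X\<^sub>j f) Y\<^sub>j - (Y\<^sub>j f) X\<^sub>j)\<close>. Since \<open>div(gZ) = g div Z + Z g\<close>, the function \<open>div V\<^sub>f\<close> is obtained
  by applying \<open>\<Sum>\<^sub>j ((div Y\<^sub>j) X\<^sub>j - (div X\<^sub>j) Y\<^sub>j - [X\<^sub>j, Y\<^sub>j])\<close> to \<open>f\<close>; this is therefore the modular
  vector field, and it is the image of \<open>\<Sum>\<^sub>j ((div Y\<^sub>j) s\<^sub>j - (div X\<^sub>j) t\<^sub>j - [s\<^sub>j, t\<^sub>j]\<^sub>A)\<close>. Local preimages under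
  the anchor are glued with smooth cutoff functions. The divergence is computed on a local frame on which
  the volume form does not vanish.
\<close>

section \<open>Differential calculus on coordinate domains\<close>

text \<open>The lift of the modular field exists because the only second-order terms of div V_f are
  the commutators of X_j and Y_j, and the anchor, being a morphism of brackets, puts these into its
  image. The bracket of \<open>A\<close> acts on global sections only, while the decomposition of
  the bivector field is local; the local frames are therefore multiplied by bump functions, built
  from exp(-1/t), before any bracket is taken. Smoothness is defined by iterated partial derivatives
  of functions on \<open>nat \<Rightarrow> real\<close>, and the calculus is derived from the
  one-variable mean value theorem. Two facts carry the geometry: the chain rule makes tangent
  vectors independent of the chart, and the symmetry of mixed partial derivatives removes the
  second-order terms from the bracket of vector fields. The product rule for the divergence comes
  from Cramer's rule: a volume form that does not vanish on a frame reads off the coefficients of a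
  vector in that frame.\<close>

lemma sum_fun_apply: "(\<Sum>i\<in>I. f i) x = (\<Sum>i\<in>I. f i x)"
  by (induction I rule: infinite_finite_induct) auto

lemma tendsto_componentwiseI:
  fixes f :: "'a \<Rightarrow> 'i \<Rightarrow> 'b::topological_space"
  assumes "\<And>i. ((\<lambda>t. f t i) \<longlongrightarrow> z i) F"
  shows "(f \<longlongrightarrow> z) F"
proof -
  have "limitin (product_topology (\<lambda>i. euclidean) UNIV) f z F"
    using assms by (simp add: limitin_componentwise)
  then show ?thesis
    by (simp add: euclidean_product_topology)
qed

section \<open>Open subsets of \<open>Euclidean_space n\<close> in coordinates\<close>

lemma openin_Euclidean_space_iff:
  "openin (Euclidean_space n) S \<longleftrightarrow> (\<exists>T. open T \<and> S = T \<inter> {z. \<forall>i\<ge>n. z i = 0})"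
  by (auto simp: Euclidean_space_def openin_subtopology euclidean_product_topology)

lemma openin_Euclidean_space_zero:
  "openin (Euclidean_space n) S \<Longrightarrow> z \<in> S \<Longrightarrow> n \<le> i \<Longrightarrow> z i = 0"
  by (auto simp: openin_Euclidean_space_iff)

text \<open>A basic open set of the product topology restricts only finitely many coordinates, so a
  single radius serves them all; the coordinates from \<open>n\<close> on are pinned to 0.\<close>

lemma openin_Euclidean_space_box:
  assumes "openin (Euclidean_space n) S" "z \<in> S"
  obtains e where "e > 0"
    "\<And>w. (\<And>i. i < n \<Longrightarrow> \<bar>w i - z i\<bar> < e) \<Longrightarrow> (\<And>i. i \<ge> n \<Longrightarrow> w i = 0) \<Longrightarrow> w \<in> S"
proof -
  obtain T where T: "open T" "S = T \<inter> {z. \<forall>i\<ge>n. z i = 0}"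
    using assms(1) by (auto simp: openin_Euclidean_space_iff)
  have "openin (product_topology (\<lambda>i. euclidean) UNIV) T"
    using T(1) by (simp add: euclidean_product_topology)
  then obtain X where X: "z \<in> (\<Pi>\<^sub>E i\<in>UNIV. X i)" "\<And>i. open (X i)"
      "finite {i. X i \<noteq> UNIV}" "(\<Pi>\<^sub>E i\<in>UNIV. X i) \<subseteq> T"
    using product_topology_open_contains_basis[of "\<lambda>i. euclidean" UNIV T z] assms(2) T(2)
    by auto
  have "\<exists>e>0. \<forall>y. dist y (z i) < e \<longrightarrow> y \<in> X i" for i
    using X(1,2) by (auto simp: open_dist PiE_iff)
  then obtain d where d: "\<And>i. d i > 0" "\<And>i y. dist y (z i) < d i \<Longrightarrow> y \<in> X i"
    by metis
  \<comment> \<open>\<open>insert 1\<close> keeps the minimum defined when no coordinate is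
    restricted.\<close>
  define e where "e = Min (insert 1 (d ` {i. X i \<noteq> UNIV}))"
  have "e > 0" using X(3) d(1) by (auto simp: e_def)
  moreover have "w \<in> S" if w: "\<And>i. i < n \<Longrightarrow> \<bar>w i - z i\<bar> < e" "\<And>i. i \<ge> n \<Longrightarrow> w i = 0" for w
  proof -
    have "w i \<in> X i" for i
    proof (cases "X i = UNIV")
      case False
      then have "e \<le> d i" unfolding e_def using X(3) by (intro Min_le) auto
      moreover have "\<bar>w i - z i\<bar> < e"
        using w openin_Euclidean_space_zero[OF assms, of i] \<open>e > 0\<close> by (cases "i < n") auto
      ultimately show ?thesis using d(2) by (auto simp: dist_real_def)
    qed auto
    then show ?thesis using X(4) w(2) T(2) by (auto simp: PiE_iff)
  qed
  ultimately show ?thesis using that by blast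
qed

lemma eventually_in_openin_Euclidean:
  assumes "openin (Euclidean_space n) S" "z \<in> S"
    and "\<And>i. i < n \<Longrightarrow> ((\<lambda>t. f t i) \<longlongrightarrow> z i) F"
    and "eventually (\<lambda>t. \<forall>i\<ge>n. f t i = 0) F"
  shows "eventually (\<lambda>t. f t \<in> S) F"
proof -
  obtain e where e: "e > 0"
    "\<And>w. (\<And>i. i < n \<Longrightarrow> \<bar>w i - z i\<bar> < e) \<Longrightarrow> (\<And>i. i \<ge> n \<Longrightarrow> w i = 0) \<Longrightarrow> w \<in> S"
    using openin_Euclidean_space_box[OF assms(1,2)] by metis
  have "eventually (\<lambda>t. \<forall>i\<in>{..<n}. \<bar>f t i - z i\<bar> < e) F"
    using assms(3) e(1) by (intro eventually_ball_finite) (auto simp: tendsto_iff dist_real_def)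
  with assms(4) show ?thesis
    by eventually_elim (auto intro: e(2))
qed

lemma eventually_fun_upd_in_openin:
  assumes "openin (Euclidean_space n) S" "z \<in> S" "i < n"
  shows "eventually (\<lambda>t. z(i := t) \<in> S) (nhds (z i))"
proof -
  have "((\<lambda>t. (z(i := t)) j) \<longlongrightarrow> z j) (nhds (z i))" for j
    by (cases "j = i") (auto simp: filterlim_ident)
  then show ?thesis
    using openin_Euclidean_space_zero[OF assms(1,2)] assms(3)
    by (intro eventually_in_openin_Euclidean[OF assms(1,2)]) (auto intro!: always_eventually)
qed

section \<open>Partial derivatives and functions of class C^k\<close>

lemma partial_cong:
  assumes "openin (Euclidean_space n) S" "z \<in> S" "i < n" "\<And>w. w \<in> S \<Longrightarrow> f w = g w"
  shows "partial i f z = partial i g z"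
    and "(\<lambda>t. f (z(i := t))) differentiable at (z i) \<longleftrightarrow> (\<lambda>t. g (z(i := t))) differentiable at (z i)"
proof -
  have ev: "eventually (\<lambda>t. f (z(i := t)) = g (z(i := t))) (nhds (z i))"
    using eventually_fun_upd_in_openin[OF assms(1-3)] by eventually_elim (rule assms(4))
  then show "partial i f z = partial i g z"
    unfolding partial_def by (intro deriv_cong_ev) auto
  have "((\<lambda>t. f (z(i := t))) has_real_derivative D) (at (z i)) \<longleftrightarrow>
        ((\<lambda>t. g (z(i := t))) has_real_derivative D) (at (z i))" for D
    using ev by (intro DERIV_cong_ev) auto
  then show "(\<lambda>t. f (z(i := t))) differentiable at (z i) \<longleftrightarrow> (\<lambda>t. g (z(i := t))) differentiable at (z i)"
    by (simp add: real_differentiable_def)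
qed

lemma partialI:
  "((\<lambda>t. f (z(i := t))) has_real_derivative D) (at (z i)) \<Longrightarrow> partial i f z = D"
  unfolding partial_def by (rule DERIV_imp_deriv)

lemma has_partial:
  "(\<lambda>t. f (z(i := t))) differentiable at (z i) \<Longrightarrow>
   ((\<lambda>t. f (z(i := t))) has_real_derivative partial i f z) (at (z i))"
  unfolding partial_def by (simp add: DERIV_deriv_iff_real_differentiable)

lemma Ck_on_continuous: "Ck_on n k S f \<Longrightarrow> continuous_on S f"
  by (cases k) auto

lemma Ck_on_subset: "Ck_on n k S f \<Longrightarrow> T \<subseteq> S \<Longrightarrow> Ck_on n k T f"
proof (induction k arbitrary: f)
  case (Suc k)
  then show ?case by (auto intro: continuous_on_subset)
qed (auto intro: continuous_on_subset)

lemma Ck_on_cong: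
  assumes "openin (Euclidean_space n) S" "\<And>w. w \<in> S \<Longrightarrow> f w = g w"
  shows "Ck_on n k S f \<longleftrightarrow> Ck_on n k S g"
  using assms(2)
proof (induction k arbitrary: f g)
  case 0
  then show ?case by (auto cong: continuous_on_cong)
next
  case (Suc k)
  have "Ck_on n k S (partial i f) = Ck_on n k S (partial i g)" if "i < n" for i
    using partial_cong(1)[OF assms(1) _ that, where f = f and g = g] Suc.prems
    by (intro Suc.IH) auto
  moreover have "continuous_on S f = continuous_on S g"
    using Suc.prems by (auto cong: continuous_on_cong)
  ultimately show ?case
    using partial_cong(2)[OF assms(1), where f = f and g = g] Suc.prems by auto
qed

text \<open>Since \<open>S\<close> is open, \<open>partial i f\<close> may be replaced by any
  formula \<open>f'\<close> that agrees with it on \<open>S\<close>. This lets inductions on the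
  order work with explicit derivatives.\<close>

lemma Ck_on_SucI:
  assumes "openin (Euclidean_space n) S" "continuous_on S f"
    and "\<And>i z. i < n \<Longrightarrow> z \<in> S \<Longrightarrow> ((\<lambda>t. f (z(i := t))) has_real_derivative f' i z) (at (z i))"
    and "\<And>i. i < n \<Longrightarrow> Ck_on n k S (f' i)"
  shows "Ck_on n (Suc k) S f"
proof -
  have "Ck_on n k S (partial i f)" if "i < n" for i
    using Ck_on_cong[OF assms(1), of "partial i f" "f' i" k, OF partialI[OF assms(3)[OF that]]]
      assms(4)[OF that] by simp
  then show ?thesis
    using assms(2,3) by (auto simp: real_differentiable_def)
qed

lemma Ck_on_SucD:
  "Ck_on n (Suc k) S f \<Longrightarrow> i < n \<Longrightarrow> z \<in> S \<Longrightarrow>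
    ((\<lambda>t. f (z(i := t))) has_real_derivative partial i f z) (at (z i))"
  by (auto intro: has_partial)

lemma Ck_on_Suc_imp: "Ck_on n (Suc k) S f \<Longrightarrow> Ck_on n k S f"
  by (induction k arbitrary: f) auto

text \<open>A set open in \<open>Euclidean_space n\<close> is in general not open in the type
  \<open>nat \<Rightarrow> real\<close>, on whose topology \<open>continuous_on\<close> is based;
  the ambient open set \<open>G\<close> mediates between the two.\<close>

lemma continuous_on_openin_local:
  assumes "\<And>z. z \<in> S \<Longrightarrow> \<exists>T. openin (Euclidean_space n) T \<and> z \<in> T \<and> continuous_on T f"
    and "openin (Euclidean_space n) S"
  shows "continuous_on S f"
proof -
  have "continuous (at z within S) f" if z: "z \<in> S" for z
  proof -
    obtain T where T: "openin (Euclidean_space n) T" "z \<in> T" "continuous_on T f"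
      using assms(1)[OF z] by auto
    obtain G where G: "open G" "T = G \<inter> {z. \<forall>i\<ge>n. z i = 0}"
      using T(1) by (auto simp: openin_Euclidean_space_iff)
    have "S \<inter> G \<subseteq> T" using G(2) openin_Euclidean_space_zero[OF assms(2)] by auto
    then have "continuous (at z within S \<inter> G) f"
      using T(2,3) continuous_on_eq_continuous_within continuous_within_subset by blast
    moreover have "at z within S \<inter> G = at z within S"
      using G T(2) by (intro at_within_nhd[of _ G]) auto
    ultimately show ?thesis by simp
  qed
  then show ?thesis by (auto simp: continuous_on_eq_continuous_within)
qed

lemma Ck_on_local:
  assumes "openin (Euclidean_space n) S"
    and "\<And>z. z \<in> S \<Longrightarrow> \<exists>T. openin (Euclidean_space n) T \<and> z \<in> T \<and> Ck_on n k T f"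
  shows "Ck_on n k S f"
  using assms(2)
proof (induction k arbitrary: f)
  case 0
  then have "continuous_on S f"
    by (intro continuous_on_openin_local[OF _ assms(1)]) simp
  then show ?case by simp
next
  case (Suc k)
  have "continuous_on S f"
    using Suc.prems by (intro continuous_on_openin_local[OF _ assms(1)]) (meson Ck_on_continuous)
  moreover have "Ck_on n k S (partial i f)" if "i < n" for i
    using Suc.prems that by (intro Suc.IH) fastforce
  moreover have "(\<lambda>t. f (z(i := t))) differentiable at (z i)" if "i < n" "z \<in> S" for i z
    using Suc.prems[OF that(2)] that(1) by auto
  ultimately show ?case by auto
qed

lemma Ck_on_const: "openin (Euclidean_space n) S \<Longrightarrow> Ck_on n k S (\<lambda>z. c)"
proof (induction k arbitrary: c)
  case (Suc k)
  then show ?case by (intro Ck_on_SucI[where f' = "\<lambda>i z. 0"]) auto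
qed auto

lemma Ck_on_add:
  "openin (Euclidean_space n) S \<Longrightarrow> Ck_on n k S f \<Longrightarrow> Ck_on n k S g \<Longrightarrow> Ck_on n k S (\<lambda>z. f z + g z)"
proof (induction k arbitrary: f g)
  case (Suc k)
  show ?case
  proof (rule Ck_on_SucI[where f' = "\<lambda>i z. partial i f z + partial i g z"])
    show "((\<lambda>t. f (z(i := t)) + g (z(i := t))) has_real_derivative partial i f z + partial i g z) (at (z i))"
      if "i < n" "z \<in> S" for i z
      using Ck_on_SucD[OF Suc.prems(2) that] Ck_on_SucD[OF Suc.prems(3) that] by (rule DERIV_add)
  qed (use Suc in \<open>auto intro!: continuous_intros\<close>)
qed (auto intro: continuous_intros)

lemma Ck_on_mult:
  "openin (Euclidean_space n) S \<Longrightarrow> Ck_on n k S f \<Longrightarrow> Ck_on n k S g \<Longrightarrow> Ck_on n k S (\<lambda>z. f z * g z)"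
proof (induction k arbitrary: f g)
  case (Suc k)
  have "Ck_on n k S f" "Ck_on n k S g"
    using Suc.prems(2,3) by (blast intro: Ck_on_Suc_imp)+
  note Ck = this
  show ?case
  proof (rule Ck_on_SucI[where f' = "\<lambda>i z. partial i f z * g z + partial i g z * f z"])
    show "((\<lambda>t. f (z(i := t)) * g (z(i := t))) has_real_derivative
        partial i f z * g z + partial i g z * f z) (at (z i))"
      if "i < n" "z \<in> S" for i z
      using DERIV_mult[OF Ck_on_SucD[OF Suc.prems(2) that] Ck_on_SucD[OF Suc.prems(3) that]]
      by (simp only: fun_upd_triv)
  qed (use Suc Ck in \<open>auto intro!: continuous_intros Ck_on_add\<close>)
qed (auto intro: continuous_intros)

lemma Ck_on_sum:
  "openin (Euclidean_space n) S \<Longrightarrow> (\<And>j. j \<in> J \<Longrightarrow> Ck_on n k S (f j)) \<Longrightarrow>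
    Ck_on n k S (\<lambda>z. \<Sum>j\<in>J. f j z)"
  by (induction J rule: infinite_finite_induct) (auto intro!: Ck_on_const Ck_on_add)

lemma Ck_on_inverse:
  "openin (Euclidean_space n) S \<Longrightarrow> Ck_on n k S f \<Longrightarrow> (\<And>z. z \<in> S \<Longrightarrow> f z \<noteq> 0) \<Longrightarrow>
    Ck_on n k S (\<lambda>z. inverse (f z))"
proof (induction k arbitrary: f)
  case (Suc k)
  \<comment> \<open>The derivative of \<open>inverse (f z)\<close> contains
    \<open>inverse (f z)\<close> again, so the induction hypothesis is applied to the same
    \<open>f\<close>, one order lower.\<close>
  have Ck: "Ck_on n k S (\<lambda>z. inverse (f z))"
    using Suc.prems by (intro Suc.IH) (blast intro: Ck_on_Suc_imp)+
  show ?case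
  proof (rule Ck_on_SucI[where f' = "\<lambda>i z. (- 1) * (inverse (f z) * partial i f z * inverse (f z))"])
    show "((\<lambda>t. inverse (f (z(i := t)))) has_real_derivative
        (- 1) * (inverse (f z) * partial i f z * inverse (f z))) (at (z i))"
      if "i < n" "z \<in> S" for i z
      using DERIV_inverse'[OF Ck_on_SucD[OF Suc.prems(2) that], unfolded fun_upd_triv]
        Suc.prems(3)[OF that(2)] by (simp add: fun_upd_def)
    show "Ck_on n k S (\<lambda>z. (- 1) * (inverse (f z) * partial i f z * inverse (f z)))" if "i < n" for i
      using Suc.prems that by (intro Ck_on_mult Ck_on_const Ck) auto
  qed (use Suc in \<open>auto intro!: continuous_intros\<close>)
qed (auto intro!: continuous_intros)

section \<open>Mean value theorem and chain rule\<close>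

lemma MVT_closed_segment:
  fixes h :: "real \<Rightarrow> real"
  assumes "\<And>x. x \<in> closed_segment a b \<Longrightarrow> (h has_real_derivative h' x) (at x)"
  obtains x where "x \<in> closed_segment a b" "h b - h a = h' x * (b - a)"
proof -
  \<comment> \<open>Both orders of the endpoints occur later, since a coordinate of a curve may move
    in either direction or stay put.\<close>
  consider "a < b" | "a = b" | "b < a" by linarith
  then show ?thesis
  proof cases
    case 1
    then obtain x where "a < x" "x < b" "h b - h a = (b - a) * h' x"
      using MVT2[of a b h h'] assms by (auto simp: closed_segment_eq_real_ivl)
    then show ?thesis using that[of x] 1 by (auto simp: closed_segment_eq_real_ivl mult.commute)
  next
    case 2
    then show ?thesis using that[of a] by auto
  next
    case 3
    then obtain x where "b < x" "x < a" "h a - h b = (a - b) * h' x"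
      using MVT2[of b a h h'] assms by (auto simp: closed_segment_eq_real_ivl)
    then show ?thesis using that[of x] 3 by (auto simp: closed_segment_eq_real_ivl algebra_simps)
  qed
qed

text \<open>From \<open>n\<close> on all coordinates are eventually 0, as they are in
  \<open>z\<close>, so convergence of the first \<open>n\<close> coordinates is already convergence
  in the product topology.\<close>

lemma openin_Euclidean_space_continuous_within:
  assumes "openin (Euclidean_space n) S" "continuous_on S f" "z \<in> S"
    and "\<And>i. i < n \<Longrightarrow> ((\<lambda>t. w t i) \<longlongrightarrow> z i) F" "eventually (\<lambda>t. \<forall>i\<ge>n. w t i = 0) F"
  shows "((\<lambda>t. f (w t)) \<longlongrightarrow> f z) F"
proof -
  have ev: "eventually (\<lambda>t. w t \<in> S) F"
    using assms by (intro eventually_in_openin_Euclidean) auto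
  have "((\<lambda>t. w t i) \<longlongrightarrow> z i) F" for i
  proof (cases "i < n")
    case False
    have "eventually (\<lambda>t. w t i = z i) F"
      using assms(5) by eventually_elim (use openin_Euclidean_space_zero[OF assms(1,3), of i] False in auto)
    then show ?thesis by (rule tendsto_eventually)
  qed (use assms in auto)
  then have "(w \<longlongrightarrow> z) F" by (rule tendsto_componentwiseI)
  with assms(2,3) ev show ?thesis
    by (intro continuous_on_tendsto_compose[OF assms(2)]) auto
qed

text \<open>The way from \<open>\<gamma> t0\<close> to \<open>\<gamma> t\<close> is split into
  \<open>n\<close> steps that change one coordinate each. The mean value theorem turns each step
  into a partial derivative at an intermediate point times the increment of that coordinate, and
  continuity of the partial derivative gives the limit of the quotient. The curve only has to be
  differentiable at \<open>t0\<close>.\<close>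

lemma DERIV_compose_partials:
  fixes \<gamma> :: "real \<Rightarrow> nat \<Rightarrow> real"
  assumes S: "openin (Euclidean_space n) S" and g: "Ck_on n 1 S g"
    and \<gamma>0: "\<gamma> t0 \<in> S" and \<gamma>E: "eventually (\<lambda>t. \<forall>i\<ge>n. \<gamma> t i = 0) (at t0)"
    and \<gamma>': "\<And>j. j < n \<Longrightarrow> ((\<lambda>t. \<gamma> t j) has_real_derivative \<gamma>' j) (at t0)"
  shows "((\<lambda>t. g (\<gamma> t)) has_real_derivative (\<Sum>j<n. partial j g (\<gamma> t0) * \<gamma>' j)) (at t0)"
proof -
  define z0 where "z0 = \<gamma> t0"
  \<comment> \<open>A hybrid point: the first \<open>m\<close> coordinates have already moved to
    \<open>\<gamma> t\<close>, the others are still at \<open>z0\<close>.\<close>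
  define z where "z m t = (\<lambda>i. if i < m then \<gamma> t i else z0 i)" for m t
  have z0: "z0 \<in> S" "\<And>i. i \<ge> n \<Longrightarrow> z0 i = 0"
    using \<gamma>0 openin_Euclidean_space_zero[OF S] by (auto simp: z0_def)
  have lim\<gamma>: "((\<lambda>t. \<gamma> t j) \<longlongrightarrow> z0 j) (at t0)" if "j < n" for j
    using \<gamma>'[OF that] by (auto simp: z0_def dest!: DERIV_isCont simp: isCont_def)
  obtain e where e: "e > 0"
    "\<And>w. (\<And>i. i < n \<Longrightarrow> \<bar>w i - z0 i\<bar> < e) \<Longrightarrow> (\<And>i. i \<ge> n \<Longrightarrow> w i = 0) \<Longrightarrow> w \<in> S"
    using openin_Euclidean_space_box[OF S z0(1)] by metis
  have "eventually (\<lambda>t. \<forall>j\<in>{..<n}. \<bar>\<gamma> t j - z0 j\<bar> < e) (at t0)"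
    using lim\<gamma> e(1) by (intro eventually_ball_finite) (auto simp: tendsto_iff dist_real_def)
  then have near: "eventually (\<lambda>t. \<forall>j<n. \<bar>\<gamma> t j - z0 j\<bar> < e) (at t0)"
    by (simp add: Ball_def)
  have main: "m \<le> n \<Longrightarrow> ((\<lambda>t. g (z m t)) has_real_derivative (\<Sum>j<m. partial j g z0 * \<gamma>' j)) (at t0)" for m
  proof (induction m)
    case 0
    then show ?case by (simp add: z_def)
  next
    case (Suc m)
    define r where "r t = g (z (Suc m) t) - g (z m t)" for t
    have z_t0: "z k t0 = z0" for k by (auto simp: z_def z0_def)
    have upd: "z (Suc m) t = (z m t)(m := \<gamma> t m)" "z m t = (z m t)(m := z0 m)" for t
      by (auto simp: z_def fun_eq_iff)
    \<comment> \<open>\<open>\<xi>\<close> is the intermediate value for the step that moves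
      coordinate \<open>m\<close>. The bound on its distance from \<open>z0 m\<close> later forces
      \<open>\<xi> t\<close> to converge.\<close>
    define good where "good t \<xi> \<longleftrightarrow> \<bar>\<xi> - z0 m\<bar> \<le> \<bar>\<gamma> t m - z0 m\<bar> \<and>
      r t = partial m g ((z m t)(m := \<xi>)) * (\<gamma> t m - z0 m)" for t \<xi>
    have ex: "\<exists>\<xi>. good t \<xi>" if t: "\<forall>j<n. \<bar>\<gamma> t j - z0 j\<bar> < e" for t
    proof -
      have inS: "(z m t)(m := \<xi>) \<in> S" if "\<xi> \<in> closed_segment (z0 m) (\<gamma> t m)" for \<xi>
      proof (rule e(2))
        have "\<bar>\<xi> - z0 m\<bar> < e"
          using that t[rule_format, of m] Suc.prems by (auto simp: closed_segment_eq_real_ivl split: if_splits)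
        then show "\<bar>((z m t)(m := \<xi>)) i - z0 i\<bar> < e" if "i < n" for i
          using t that e(1) by (auto simp: z_def)
      qed (use z0(2) Suc.prems in \<open>auto simp: z_def\<close>)
      have "((\<lambda>s. g ((z m t)(m := s))) has_real_derivative partial m g ((z m t)(m := \<xi>))) (at \<xi>)"
        if "\<xi> \<in> closed_segment (z0 m) (\<gamma> t m)" for \<xi>
        using Ck_on_SucD[OF g[unfolded One_nat_def] _ inS[OF that], of m] Suc.prems by simp
      then obtain \<xi> where \<xi>: "\<xi> \<in> closed_segment (z0 m) (\<gamma> t m)"
        "g ((z m t)(m := \<gamma> t m)) - g ((z m t)(m := z0 m)) = partial m g ((z m t)(m := \<xi>)) * (\<gamma> t m - z0 m)"
        by (rule MVT_closed_segment)
      have "r t = partial m g ((z m t)(m := \<xi>)) * (\<gamma> t m - z0 m)"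
        using \<xi>(2) unfolding r_def upd(1)[of t] upd(2)[of t, symmetric] .
      moreover have "\<bar>\<xi> - z0 m\<bar> \<le> \<bar>\<gamma> t m - z0 m\<bar>"
        using \<xi>(1) by (auto simp: closed_segment_eq_real_ivl split: if_splits)
      ultimately show ?thesis by (auto simp: good_def)
    qed
    \<comment> \<open>Off the neighbourhood given by \<open>near\<close> the choice may be
      arbitrary, which limits at \<open>t0\<close> do not see.\<close>
    define \<xi> where "\<xi> t = (SOME x. good t x)" for t
    have good: "eventually (\<lambda>t. good t (\<xi> t)) (at t0)"
      using near by eventually_elim (auto simp: \<xi>_def intro: someI_ex[OF ex])
    have lim\<xi>: "(\<xi> \<longlongrightarrow> z0 m) (at t0)"
    proof -
      have "((\<lambda>t. \<gamma> t m - z0 m) \<longlongrightarrow> 0) (at t0)"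
        using lim\<gamma>[of m] Suc.prems by (simp add: LIM_zero)
      then have "((\<lambda>t. \<xi> t - z0 m) \<longlongrightarrow> 0) (at t0)"
        by (rule Lim_null_comparison[rotated, OF tendsto_norm_zero])
          (use good in eventually_elim, simp add: good_def)
      then show ?thesis by (simp add: LIM_zero_iff)
    qed
    have "((\<lambda>t. partial m g ((z m t)(m := \<xi> t))) \<longlongrightarrow> partial m g z0) (at t0)"
    proof (rule openin_Euclidean_space_continuous_within[OF S _ z0(1)])
      show "continuous_on S (partial m g)"
        using g Suc.prems by (auto simp: Ck_on_continuous)
      show "((\<lambda>t. ((z m t)(m := \<xi> t)) i) \<longlongrightarrow> z0 i) (at t0)" if "i < n" for i
        using lim\<xi> lim\<gamma>[OF that] by (cases "i = m"; cases "i < m") (auto simp: z_def)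
      show "\<forall>\<^sub>F t in at t0. \<forall>i\<ge>n. ((z m t)(m := \<xi> t)) i = 0"
        using z0(2) Suc.prems by (auto simp: z_def)
    qed
    moreover have "((\<lambda>t. (\<gamma> t m - z0 m) / (t - t0)) \<longlongrightarrow> \<gamma>' m) (at t0)"
      using \<gamma>'[of m] Suc.prems by (auto simp: has_field_derivative_iff z0_def)
    ultimately have "((\<lambda>t. partial m g ((z m t)(m := \<xi> t)) * ((\<gamma> t m - z0 m) / (t - t0)))
        \<longlongrightarrow> partial m g z0 * \<gamma>' m) (at t0)"
      by (rule tendsto_mult)
    then have "((\<lambda>t. (r t - r t0) / (t - t0)) \<longlongrightarrow> partial m g z0 * \<gamma>' m) (at t0)"
    proof (rule Lim_transform_eventually)
      show "\<forall>\<^sub>F t in at t0. partial m g ((z m t)(m := \<xi> t)) * ((\<gamma> t m - z0 m) / (t - t0)) =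
          (r t - r t0) / (t - t0)"
        using good by eventually_elim (auto simp: good_def r_def z_t0)
    qed
    then have "(r has_real_derivative partial m g z0 * \<gamma>' m) (at t0)"
      by (simp add: has_field_derivative_iff)
    from DERIV_add[OF Suc.IH this] Suc.prems show ?case
      by (simp add: r_def)
  qed
  have "\<forall>\<^sub>F t in at t0. g (\<gamma> t) = g (z n t)"
    using \<gamma>E
  proof eventually_elim
    case (elim t)
    then have "\<gamma> t = z n t" using z0(2) by (auto simp: z_def fun_eq_iff)
    then show ?case by simp
  qed
  moreover have "\<gamma> t0 = z n t0" by (auto simp: z_def z0_def)
  ultimately have ev: "\<forall>\<^sub>F t in nhds t0. g (\<gamma> t) = g (z n t)"
    by (simp add: eventually_nhds_conv_at)
  show ?thesis
    using main[of n] DERIV_cong_ev[OF refl ev refl] by (simp add: z0_def)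
qed

text \<open>The chain rule produces \<open>partial j g\<close> after \<open>\<Phi>\<close>,
  multiplied by partial derivatives of \<open>\<Phi>\<close>. The induction therefore generalizes
  \<open>g\<close>, while \<open>\<Phi>\<close> stays fixed and is smooth of every order: the
  \<open>k\<close> in its assumption is a bound variable of its own.\<close>

lemma Ck_on_compose:
  assumes S: "openin (Euclidean_space n) S" and S': "openin (Euclidean_space m) S'"
    and \<Phi>: "\<And>j k. j < m \<Longrightarrow> Ck_on n k S (\<lambda>z. \<Phi> z j)" "\<Phi> ` S \<subseteq> S'"
    and g: "Ck_on m k S' g"
  shows "Ck_on n k S (\<lambda>z. g (\<Phi> z))"
  using g
proof (induction k arbitrary: g)
  have zero: "\<Phi> z j = 0" if "z \<in> S" "j \<ge> m" for z j
    using openin_Euclidean_space_zero[OF S', of "\<Phi> z"] that \<Phi>(2) by auto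
  have cont\<Phi>: "continuous_on S \<Phi>"
  proof (rule continuous_on_coordinatewise_then_product)
    fix j
    show "continuous_on S (\<lambda>z. \<Phi> z j)"
    proof (cases "j < m")
      case False
      then show ?thesis using zero by (auto cong: continuous_on_cong)
    qed (use \<Phi>(1)[of j 0] in auto)
  qed
  have cont: "continuous_on S (\<lambda>z. g (\<Phi> z))" if "continuous_on S' g" for g
    by (rule continuous_on_compose2[OF that cont\<Phi> \<Phi>(2)])
  {
    case 0
    then show ?case using cont by simp
  next
    case (Suc k)
    have g1: "Ck_on m 1 S' g"
      using Suc.prems by (auto intro: Ck_on_continuous)
    show ?case
    proof (rule Ck_on_SucI[where f' = "\<lambda>i z. \<Sum>j<m. partial j g (\<Phi> z) * partial i (\<lambda>z. \<Phi> z j) z"])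
      fix i z assume iz: "i < n" "z \<in> S"
      have "\<forall>\<^sub>F t in at (z i). z(i := t) \<in> S"
        using eventually_fun_upd_in_openin[OF S iz(2,1)] by (simp add: eventually_at_filter eventually_mono)
      then have ev: "\<forall>\<^sub>F t in at (z i). \<forall>j\<ge>m. \<Phi> (z(i := t)) j = 0"
        by eventually_elim (use zero in auto)
      have "((\<lambda>t. \<Phi> (z(i := t)) j) has_real_derivative partial i (\<lambda>z. \<Phi> z j) z) (at (z i))" if "j < m" for j
        using Ck_on_SucD[OF \<Phi>(1)[OF that, of "Suc 0"] iz] .
      from DERIV_compose_partials[OF S' g1 _ ev this] iz \<Phi>(2)
      show "((\<lambda>t. g (\<Phi> (z(i := t)))) has_real_derivative
          (\<Sum>j<m. partial j g (\<Phi> z) * partial i (\<lambda>z. \<Phi> z j) z)) (at (z i))"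
        by auto
    next
      fix i assume "i < n"
      then show "Ck_on n k S (\<lambda>z. \<Sum>j<m. partial j g (\<Phi> z) * partial i (\<lambda>z. \<Phi> z j) z)"
        using Suc.prems \<Phi>(1)[of _ "Suc k"]
        by (intro Ck_on_sum[OF S] Ck_on_mult[OF S] Suc.IH) auto
    qed (use S cont Suc.prems in auto)
  }
qed

lemma partial_compose:
  assumes S: "openin (Euclidean_space n) S" and S': "openin (Euclidean_space m) S'"
    and \<Phi>: "\<And>j. j < m \<Longrightarrow> Ck_on n 1 S (\<lambda>z. \<Phi> z j)" "\<Phi> ` S \<subseteq> S'"
    and g: "Ck_on m 1 S' g" and iz: "i < n" "z \<in> S"
  shows "partial i (\<lambda>z. g (\<Phi> z)) z = (\<Sum>j<m. partial j g (\<Phi> z) * partial i (\<lambda>z. \<Phi> z j) z)"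
proof (rule partialI)
  have "\<forall>\<^sub>F t in at (z i). z(i := t) \<in> S"
    using eventually_fun_upd_in_openin[OF S iz(2,1)] by (simp add: eventually_at_filter eventually_mono)
  then have ev: "\<forall>\<^sub>F t in at (z i). \<forall>j\<ge>m. \<Phi> (z(i := t)) j = 0"
    by eventually_elim (use openin_Euclidean_space_zero[OF S'] \<Phi>(2) in blast)
  have "((\<lambda>t. \<Phi> (z(i := t)) j) has_real_derivative partial i (\<lambda>z. \<Phi> z j) z) (at (z i))" if "j < m" for j
    using Ck_on_SucD[OF \<Phi>(1)[OF that, unfolded One_nat_def] iz] .
  from DERIV_compose_partials[OF S' g _ ev this] iz \<Phi>(2)
  show "((\<lambda>t. g (\<Phi> (z(i := t)))) has_real_derivative
      (\<Sum>j<m. partial j g (\<Phi> z) * partial i (\<lambda>z. \<Phi> z j) z)) (at (z i))"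
    by auto
qed

text \<open>The mean value theorem is applied twice, first in direction \<open>i\<close>, then in
  direction \<open>j\<close>. The left side of the equation is symmetric in \<open>i\<close> and
  \<open>j\<close>, so exchanging them equates the two mixed partial derivatives at nearby
  points.\<close>

lemma second_difference:
  assumes g: "Ck_on n 2 S g" and ij: "i < n" "j < n" "i \<noteq> j" and h: "h > 0"
    and box: "\<And>s t. \<bar>s\<bar> \<le> h \<Longrightarrow> \<bar>t\<bar> \<le> h \<Longrightarrow> z(i := z i + s, j := z j + t) \<in> S"
  obtains s t where "\<bar>s\<bar> \<le> h" "\<bar>t\<bar> \<le> h"
    "g (z(i := z i + h, j := z j + h)) - g (z(i := z i + h)) - g (z(j := z j + h)) + g z =
      h * h * partial j (partial i g) (z(i := z i + s, j := z j + t))"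
proof -
  define w where "w s t = z(i := z i + s, j := z j + t)" for s t
  have g1: "Ck_on n (Suc 0) S (partial i g)" and g2: "Ck_on n (Suc 1) S g"
    using g ij by (auto simp: numeral_2_eq_2)
  have Di: "((\<lambda>s. g (w s t)) has_real_derivative partial i g (w s t)) (at s)"
    if "\<bar>s\<bar> \<le> h" "\<bar>t\<bar> \<le> h" for s t
  proof -
    have "((\<lambda>u. g ((w s t)(i := u))) has_real_derivative partial i g (w s t)) (at (z i + s))"
      using Ck_on_SucD[OF g2 ij(1) box[OF that]] ij(3) by (simp add: w_def)
    then have "((\<lambda>u. g ((w s t)(i := z i + u))) has_real_derivative partial i g (w s t)) (at s)"
      by (simp add: DERIV_shift add.commute)
    moreover have "(w s t)(i := z i + u) = w u t" for u
      using ij(3) by (auto simp: w_def)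
    ultimately show ?thesis by simp
  qed
  have Dj: "((\<lambda>t. partial i g (w s t)) has_real_derivative partial j (partial i g) (w s t)) (at t)"
    if "\<bar>s\<bar> \<le> h" "\<bar>t\<bar> \<le> h" for s t
  proof -
    have "((\<lambda>u. partial i g ((w s t)(j := u))) has_real_derivative partial j (partial i g) (w s t)) (at (z j + t))"
      using Ck_on_SucD[OF g1 ij(2) box[OF that]] ij(3) by (simp add: w_def)
    then have "((\<lambda>u. partial i g ((w s t)(j := z j + u))) has_real_derivative partial j (partial i g) (w s t)) (at t)"
      by (simp add: DERIV_shift add.commute)
    moreover have "(w s t)(j := z j + u) = w s u" for u
      using ij(3) by (auto simp: w_def)
    ultimately show ?thesis by simp
  qed
  have "((\<lambda>s. g (w s h) - g (w s 0)) has_real_derivative partial i g (w s h) - partial i g (w s 0)) (at s)"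
    if "0 \<le> s" "s \<le> h" for s
    using that h by (intro DERIV_diff Di) auto
  from MVT2[OF h this] obtain s where s: "0 < s" "s < h"
    "(g (w h h) - g (w h 0)) - (g (w 0 h) - g (w 0 0)) = h * (partial i g (w s h) - partial i g (w s 0))"
    by auto
  have "((\<lambda>t. partial i g (w s t)) has_real_derivative partial j (partial i g) (w s t)) (at t)"
    if "0 \<le> t" "t \<le> h" for t
    using that s by (intro Dj) auto
  from MVT2[OF h this] obtain t where t: "0 < t" "t < h"
    "partial i g (w s h) - partial i g (w s 0) = h * partial j (partial i g) (w s t)"
    by auto
  have "g (z(i := z i + h, j := z j + h)) - g (z(i := z i + h)) - g (z(j := z j + h)) + g z =
      (g (w h h) - g (w h 0)) - (g (w 0 h) - g (w 0 0))"
    using ij(3) by (auto simp: w_def fun_upd_twist fun_upd_idem)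
  also have "\<dots> = h * h * partial j (partial i g) (w s t)"
    using s(3) t(3) by simp
  finally show ?thesis
    using that[of s t] s t by (auto simp: w_def)
qed

text \<open>Schwarz's theorem: both orders of differentiation are limits of the same second
  differences divided by \<open>h k * h k\<close>.\<close>

lemma partial_commute:
  assumes S: "openin (Euclidean_space n) S" and g: "Ck_on n 2 S g"
    and z: "z \<in> S" and ij: "i < n" "j < n"
  shows "partial i (partial j g) z = partial j (partial i g) z"
proof (cases "i = j")
  case False
  obtain e where e: "e > 0"
    "\<And>w. (\<And>i. i < n \<Longrightarrow> \<bar>w i - z i\<bar> < e) \<Longrightarrow> (\<And>i. i \<ge> n \<Longrightarrow> w i = 0) \<Longrightarrow> w \<in> S"
    using openin_Euclidean_space_box[OF S z] by metis
  \<comment> \<open>The offset 2 keeps even \<open>h 0\<close> strictly below \<open>e\<close>, so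
    that the closed squares of half-width \<open>h k\<close> stay in the open box of radius
    \<open>e\<close>.\<close>
  define h where "h k = e / (real k + 2)" for k
  have h: "0 < h k" "h k < e" for k
    using e(1) by (auto simp: h_def field_simps intro!: add_pos_nonneg)
  have h0: "h \<longlonglongrightarrow> 0"
    proof -
    have "(\<lambda>k. e * inverse (real (Suc (Suc k)))) \<longlonglongrightarrow> e * 0"
      by (intro tendsto_mult tendsto_const LIMSEQ_Suc[OF LIMSEQ_inverse_real_of_nat])
    then show ?thesis by (simp add: h_def[abs_def] field_simps)
  qed
  have box: "z(i := z i + s, j := z j + t) \<in> S" if "\<bar>s\<bar> \<le> h k" "\<bar>t\<bar> \<le> h k" for s t k
    using that h[of k] e(1) ij openin_Euclidean_space_zero[OF S z] False by (intro e(2)) auto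
  have lim: "\<exists>s t. (\<forall>k. \<bar>s k\<bar> \<le> h k \<and> \<bar>t k\<bar> \<le> h k \<and>
      g (z(a := z a + h k, b := z b + h k)) - g (z(a := z a + h k)) - g (z(b := z b + h k)) + g z =
      h k * h k * partial b (partial a g) (z(a := z a + s k, b := z b + t k)))"
    if "a \<noteq> b" "a < n" "b < n" "\<forall>s t k. \<bar>s\<bar> \<le> h k \<longrightarrow> \<bar>t\<bar> \<le> h k \<longrightarrow> z(a := z a + s, b := z b + t) \<in> S"
    for a b
  proof -
    have "\<exists>s t. \<bar>s\<bar> \<le> h k \<and> \<bar>t\<bar> \<le> h k \<and>
      g (z(a := z a + h k, b := z b + h k)) - g (z(a := z a + h k)) - g (z(b := z b + h k)) + g z =
      h k * h k * partial b (partial a g) (z(a := z a + s, b := z b + t))" for k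
      using second_difference[OF g that(2,3,1) h(1)[of k] that(4)[rule_format, of _ k]] by metis
    then show ?thesis by metis
  qed
  have conv: "(\<lambda>k. partial b (partial a g) (z(a := z a + s k, b := z b + t k))) \<longlonglongrightarrow> partial b (partial a g) z"
    if "a \<noteq> b" "a < n" "b < n" "\<And>k. \<bar>s k\<bar> \<le> h k \<and> \<bar>t k\<bar> \<le> h k" for a b s t
  proof (rule openin_Euclidean_space_continuous_within[OF S _ z])
    show "continuous_on S (partial b (partial a g))"
      using g that by (auto simp: numeral_2_eq_2)
    have "s \<longlonglongrightarrow> 0" "t \<longlonglongrightarrow> 0"
      using that(4) by (auto intro!: Lim_null_comparison[OF _ h0] always_eventually)
    from tendsto_add[OF tendsto_const[of "z a"] this(1)] tendsto_add[OF tendsto_const[of "z b"] this(2)]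
    show "(\<lambda>k. (z(a := z a + s k, b := z b + t k)) i) \<longlonglongrightarrow> z i" for i
      using that(1) by (cases "i = a"; cases "i = b") auto
  qed (use that openin_Euclidean_space_zero[OF S z] in auto)
  obtain s t where st: "\<And>k. \<bar>s k\<bar> \<le> h k \<and> \<bar>t k\<bar> \<le> h k" "\<And>k.
      g (z(i := z i + h k, j := z j + h k)) - g (z(i := z i + h k)) - g (z(j := z j + h k)) + g z =
      h k * h k * partial j (partial i g) (z(i := z i + s k, j := z j + t k))"
    using lim[OF False ij] box by blast
  obtain s' t' where st': "\<And>k. \<bar>s' k\<bar> \<le> h k \<and> \<bar>t' k\<bar> \<le> h k" "\<And>k.
      g (z(j := z j + h k, i := z i + h k)) - g (z(j := z j + h k)) - g (z(i := z i + h k)) + g z =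
      h k * h k * partial i (partial j g) (z(j := z j + s' k, i := z i + t' k))"
    using lim[OF False[symmetric] ij(2,1)] box unfolding fun_upd_twist[OF False[symmetric]] by blast
  have "partial j (partial i g) (z(i := z i + s k, j := z j + t k)) =
      partial i (partial j g) (z(j := z j + s' k, i := z i + t' k))" for k
  proof -
    have "h k * h k * partial j (partial i g) (z(i := z i + s k, j := z j + t k)) =
        h k * h k * partial i (partial j g) (z(j := z j + s' k, i := z i + t' k))"
      using st(2)[of k] st'(2)[of k] unfolding fun_upd_twist[OF False, of z] by linarith
    then show ?thesis using h(1)[of k] by simp
  qed
  with conv[OF False ij st(1)] have
    "(\<lambda>k. partial i (partial j g) (z(j := z j + s' k, i := z i + t' k))) \<longlonglongrightarrow> partial j (partial i g) z"
    by simp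
  with conv[OF False[symmetric] ij(2,1) st'(1)] show ?thesis
    by (rule LIMSEQ_unique)
qed simp

section \<open>The flat function exp(-1/t)\<close>

definition flat :: "nat \<Rightarrow> real \<Rightarrow> real"
  where "flat m t = (if t \<le> 0 then 0 else exp (- inverse t) * inverse t ^ m)"

lemma flat_nonneg: "flat m t \<ge> 0"
  by (simp add: flat_def)

lemma flat_pos_iff: "flat m t > 0 \<longleftrightarrow> t > 0"
  by (simp add: flat_def)

lemma flat_tendsto_0: "(flat m \<longlongrightarrow> 0) (at 0)"
proof (rule filterlim_split_at)
  show "(flat m \<longlongrightarrow> 0) (at_left 0)"
    by (rule tendsto_eventually) (auto simp: flat_def eventually_at_filter)
  have "((\<lambda>t. inverse t ^ m / exp (inverse t)) \<longlongrightarrow> 0) (at_right (0::real))"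
    by (rule filterlim_compose[OF tendsto_power_div_exp_0 filterlim_inverse_at_top_right])
  then show "(flat m \<longlongrightarrow> 0) (at_right 0)"
  proof (rule Lim_transform_eventually)
    show "\<forall>\<^sub>F t in at_right 0. inverse t ^ m / exp (inverse t) = flat m t"
      by (auto simp: flat_def eventually_at_filter exp_minus field_simps)
  qed
qed

text \<open>The powers of \<open>inverse t\<close> are built into \<open>flat\<close> to make the
  family closed under differentiation. Smoothness then follows by induction on the order with
  \<open>m\<close> arbitrary.\<close>

lemma flat_has_derivative: "(flat m has_real_derivative flat (m + 2) t - real m * flat (m + 1) t) (at t)"
proof -
  consider "t < 0" | "t = 0" | "t > 0" by linarith
  then show ?thesis
  proof cases
    case 1
    have ev: "\<forall>\<^sub>F s in nhds t. flat m s = 0"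
      using eventually_nhds_in_open[of "{..<0}" t] 1 by (auto simp: flat_def elim: eventually_mono)
    have "(flat m has_real_derivative 0) (at t)"
      by (subst DERIV_cong_ev[OF refl ev refl]) simp
    then show ?thesis using 1 by (simp add: flat_def)
  next
    case 2
    have "((\<lambda>s. (flat m s - flat m 0) / (s - 0)) \<longlongrightarrow> 0) (at 0)"
    \<comment> \<open>Dividing by \<open>s\<close> raises the exponent of \<open>inverse s\<close>
      by one, so the difference quotient at 0 is again a flat function.\<close>
    proof (rule Lim_transform_eventually[OF flat_tendsto_0[of "Suc m"]])
      show "\<forall>\<^sub>F s in at 0. flat (Suc m) s = (flat m s - flat m 0) / (s - 0)"
        by (auto simp: flat_def eventually_at_filter field_simps intro!: always_eventually)
    qed
    then show ?thesis using 2 by (simp add: has_field_derivative_iff flat_def)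
  next
    case 3
    have ev: "\<forall>\<^sub>F s in nhds t. flat m s = exp (- inverse s) * inverse s ^ m"
      using eventually_nhds_in_open[of "{0<..}" t] 3 by (auto simp: flat_def elim: eventually_mono)
    have "((\<lambda>s. exp (- inverse s) * inverse s ^ m) has_real_derivative
        flat (m + 2) t - real m * flat (m + 1) t) (at t)"
    proof -
      define E where "E = exp (- inverse t)"
      have "((\<lambda>s. exp (- inverse s) * inverse s ^ m) has_real_derivative
          E * - (- (inverse t * 1 * inverse t)) * inverse t ^ m +
          real m * (- (inverse t * 1 * inverse t)) * inverse t ^ (m - 1) * E) (at t)"
        unfolding E_def using 3 by (intro derivative_eq_intros) (auto simp: mult_ac)
      moreover have "E * - (- (inverse t * 1 * inverse t)) * inverse t ^ m +
          real m * (- (inverse t * 1 * inverse t)) * inverse t ^ (m - 1) * E =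
          flat (m + 2) t - real m * flat (m + 1) t"
        using 3 by (cases m) (simp_all add: flat_def E_def algebra_simps)
      ultimately show ?thesis by simp
    qed
    then show ?thesis using DERIV_cong_ev[OF refl ev refl] by simp
  qed
qed

lemma continuous_on_flat: "continuous_on S (flat m)"
  by (rule DERIV_continuous_on[OF has_field_derivative_at_within[OF flat_has_derivative]])

lemma Ck_on_flat:
  "openin (Euclidean_space n) S \<Longrightarrow> Ck_on n k S g \<Longrightarrow> Ck_on n k S (\<lambda>z. flat m (g z))"
proof (induction k arbitrary: g m)
  case 0
  then show ?case using continuous_on_flat[of UNIV m] by (auto intro: continuous_on_compose2)
next
  case (Suc k)
  have Ck: "Ck_on n k S g" by (rule Ck_on_Suc_imp[OF Suc.prems(2)])
  show ?case
  proof (rule Ck_on_SucI[where f' = "\<lambda>i z. (flat (m + 2) (g z) + (- real m) * flat (m + 1) (g z)) * partial i g z"])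
    show "continuous_on S (\<lambda>z. flat m (g z))"
      using Suc.prems continuous_on_flat[of UNIV m] by (auto intro: continuous_on_compose2)
    show "((\<lambda>t. flat m (g (z(i := t)))) has_real_derivative
        (flat (m + 2) (g z) + (- real m) * flat (m + 1) (g z)) * partial i g z) (at (z i))"
      if "i < n" "z \<in> S" for i z
      using DERIV_chain2[OF flat_has_derivative Ck_on_SucD[OF Suc.prems(2) that], unfolded fun_upd_triv, of m]
      by (simp add: fun_upd_def)
    show "Ck_on n k S (\<lambda>z. (flat (m + 2) (g z) + (- real m) * flat (m + 1) (g z)) * partial i g z)"
      if "i < n" for i
      using Suc.prems that by (intro Ck_on_mult Ck_on_add Ck_on_const Suc.IH Ck) auto
  qed (use Suc.prems in auto)
qed

section \<open>Smooth functions and partial derivatives in charts\<close>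

definition chart_rep :: "'x chart \<Rightarrow> ('x \<Rightarrow> real) \<Rightarrow> (nat \<Rightarrow> real) \<Rightarrow> real"
  where "chart_rep c f = (\<lambda>z. f (inv_into (fst c) (snd c) z))"

text \<open>The derivative itself, without the default value 0 that \<open>coord_vector\<close>
  takes on functions that are not smooth near the point. The calculus is done here and transferred
  to tangent vectors by \<open>coord_vector_apply\<close>.\<close>

definition chart_partial :: "'x chart \<Rightarrow> nat \<Rightarrow> ('x \<Rightarrow> real) \<Rightarrow> 'x \<Rightarrow> real"
  where "chart_partial c i f x = partial i (chart_rep c f) (snd c x)"

lemma coord_vector_apply:
  "coord_vector M c i x f = (if smooth_near M x f then chart_partial c i f x else 0)"
  by (simp add: coord_vector_def chart_partial_def chart_rep_def)

text \<open>Charts are pairs; they are kept unsplit, so that lemmas about a chart \<open>c\<close> apply.\<close>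

declare split_paired_All [simp del] split_paired_Ex [simp del] split_paired_all [simp del]

locale manifold_charts =
  fixes M :: "'x manifold"
  assumes smooth_manifold: "smooth_manifold M"
begin

lemma chart_domain_open: "c \<in> atlas M \<Longrightarrow> openin (man_top M) (fst c)"
  using smooth_manifold by (auto simp: smooth_manifold_def is_chart_def)

lemma chart_domain_points: "c \<in> atlas M \<Longrightarrow> x \<in> fst c \<Longrightarrow> x \<in> points M"
  using chart_domain_open openin_subset by blast

lemma chart_at:
  assumes "x \<in> points M"
  obtains c where "c \<in> atlas M" "x \<in> fst c"
proof -
  have "x \<in> (\<Union>c\<in>atlas M. fst c)"
    using assms smooth_manifold by (simp add: smooth_manifold_def)
  then show ?thesis using that by blast
qed

lemma chart_homeomorphic:
  "c \<in> atlas M \<Longrightarrow> openin (Euclidean_space (man_dim M)) (snd c ` fst c) \<and>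
    homeomorphic_map (subtopology (man_top M) (fst c))
      (subtopology (Euclidean_space (man_dim M)) (snd c ` fst c)) (snd c)"
  using smooth_manifold by (auto simp: smooth_manifold_def is_chart_def)

lemma chart_inj:
  assumes "c \<in> atlas M" shows "inj_on (snd c) (fst c)"
proof -
  have "topspace (man_top M) \<inter> fst c = fst c"
    using chart_domain_points[OF assms] by auto
  then show ?thesis
    using chart_homeomorphic[OF assms] by (auto simp: homeomorphic_eq_everything_map)
qed

lemma chart_inv [simp]: "c \<in> atlas M \<Longrightarrow> x \<in> fst c \<Longrightarrow> inv_into (fst c) (snd c) (snd c x) = x"
  by (simp add: chart_inj)

lemma chart_rep_apply [simp]: "c \<in> atlas M \<Longrightarrow> x \<in> fst c \<Longrightarrow> chart_rep c f (snd c x) = f x"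
  by (simp add: chart_rep_def)

lemma chart_image_open:
  assumes "c \<in> atlas M" "openin (man_top M) W"
  shows "openin (Euclidean_space (man_dim M)) (snd c ` (fst c \<inter> W))"
proof -
  have "open_map (subtopology (man_top M) (fst c))
      (subtopology (Euclidean_space (man_dim M)) (snd c ` fst c)) (snd c)"
    using chart_homeomorphic[OF assms(1)] homeomorphic_imp_open_map by blast
  moreover have "openin (subtopology (man_top M) (fst c)) (fst c \<inter> W)"
    using assms(2) by (rule openin_subtopology_Int2)
  ultimately have "openin (subtopology (Euclidean_space (man_dim M)) (snd c ` fst c)) (snd c ` (fst c \<inter> W))"
    by (auto simp: open_map_def)
  then show ?thesis
    using chart_homeomorphic[OF assms(1)] openin_trans_full by blast
qed

lemma openin_chart_inter [intro]: "c \<in> atlas M \<Longrightarrow> openin (man_top M) W \<Longrightarrow> openin (man_top M) (fst c \<inter> W)"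
  by (simp add: chart_domain_open openin_Int)

section \<open>Smooth functions on open subsets of \<open>M\<close>\<close>

lemma smooth_fun_iff:
  "smooth_fun M W f \<longleftrightarrow> openin (man_top M) W \<and>
    (\<forall>c\<in>atlas M. \<forall>k. Ck_on (man_dim M) k (snd c ` (fst c \<inter> W)) (chart_rep c f))"
  by (auto simp: smooth_fun_def smooth_on_def chart_rep_def)

lemma smooth_fun_open: "smooth_fun M W f \<Longrightarrow> openin (man_top M) W"
  by (simp add: smooth_fun_def)

lemma smooth_fun_subset:
  "smooth_fun M W f \<Longrightarrow> W' \<subseteq> W \<Longrightarrow> openin (man_top M) W' \<Longrightarrow> smooth_fun M W' f"
  unfolding smooth_fun_iff by (blast intro: Ck_on_subset)

lemma smooth_fun_cong:
  assumes "\<And>x. x \<in> W \<Longrightarrow> f x = g x"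
  shows "smooth_fun M W f \<longleftrightarrow> smooth_fun M W g"
proof (cases "openin (man_top M) W")
  case True
  have "Ck_on (man_dim M) k (snd c ` (fst c \<inter> W)) (chart_rep c f) =
      Ck_on (man_dim M) k (snd c ` (fst c \<inter> W)) (chart_rep c g)" if "c \<in> atlas M" for c k
    using assms that by (intro Ck_on_cong chart_image_open[OF that True]) auto
  then show ?thesis by (simp add: smooth_fun_iff)
qed (simp add: smooth_fun_def)

lemma smooth_fun_local:
  assumes W: "openin (man_top M) W" and *: "\<And>x. x \<in> W \<Longrightarrow> \<exists>W'. x \<in> W' \<and> smooth_fun M W' f"
  shows "smooth_fun M W f"
  unfolding smooth_fun_iff
proof (intro conjI W ballI allI)
  fix c k assume c: "c \<in> atlas M"
  show "Ck_on (man_dim M) k (snd c ` (fst c \<inter> W)) (chart_rep c f)"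
  proof (rule Ck_on_local[OF chart_image_open[OF c W]])
    fix z assume "z \<in> snd c ` (fst c \<inter> W)"
    then obtain x where x: "x \<in> fst c" "x \<in> W" "z = snd c x" by auto
    obtain W' where W': "x \<in> W'" "smooth_fun M W' f" using *[OF x(2)] by auto
    show "\<exists>T. openin (Euclidean_space (man_dim M)) T \<and> z \<in> T \<and> Ck_on (man_dim M) k T (chart_rep c f)"
      using W' x c chart_image_open[OF c smooth_fun_open[OF W'(2)]]
      by (intro exI[of _ "snd c ` (fst c \<inter> W')"]) (auto simp: smooth_fun_iff)
  qed
qed

lemma smooth_funI:
  assumes "openin (man_top M) W"
    and "\<And>c k. c \<in> atlas M \<Longrightarrow> openin (Euclidean_space (man_dim M)) (snd c ` (fst c \<inter> W)) \<Longrightarrow>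
      Ck_on (man_dim M) k (snd c ` (fst c \<inter> W)) (chart_rep c f)"
  shows "smooth_fun M W f"
  using assms chart_image_open by (simp add: smooth_fun_iff)

lemma smooth_funD:
  "smooth_fun M W f \<Longrightarrow> c \<in> atlas M \<Longrightarrow> Ck_on (man_dim M) k (snd c ` (fst c \<inter> W)) (chart_rep c f)"
  by (simp add: smooth_fun_iff)

lemma smooth_fun_const: "openin (man_top M) W \<Longrightarrow> smooth_fun M W (\<lambda>x. a)"
  by (rule smooth_funI) (simp_all add: chart_rep_def Ck_on_const)

lemma smooth_fun_add:
  assumes "smooth_fun M W f" "smooth_fun M W g"
  shows "smooth_fun M W (\<lambda>x. f x + g x)"
  using Ck_on_add[OF _ assms[THEN smooth_funD]]
  by (intro smooth_funI smooth_fun_open[OF assms(1)]) (simp add: chart_rep_def)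

lemma smooth_fun_mult:
  assumes "smooth_fun M W f" "smooth_fun M W g"
  shows "smooth_fun M W (\<lambda>x. f x * g x)"
  using Ck_on_mult[OF _ assms[THEN smooth_funD]]
  by (intro smooth_funI smooth_fun_open[OF assms(1)]) (simp add: chart_rep_def)

lemma smooth_fun_flat:
  assumes "smooth_fun M W f"
  shows "smooth_fun M W (\<lambda>x. flat m (f x))"
  using Ck_on_flat[OF _ smooth_funD[OF assms]]
  by (intro smooth_funI smooth_fun_open[OF assms(1)]) (simp add: chart_rep_def)

lemma smooth_fun_inverse:
  assumes "smooth_fun M W f" "\<And>x. x \<in> W \<Longrightarrow> f x \<noteq> 0"
  shows "smooth_fun M W (\<lambda>x. inverse (f x))"
proof (rule smooth_funI[OF smooth_fun_open[OF assms(1)]])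
  fix c k assume c: "c \<in> atlas M" "openin (Euclidean_space (man_dim M)) (snd c ` (fst c \<inter> W))"
  have "Ck_on (man_dim M) k (snd c ` (fst c \<inter> W)) (\<lambda>z. inverse (chart_rep c f z))"
    using c assms by (intro Ck_on_inverse smooth_funD) auto
  then show "Ck_on (man_dim M) k (snd c ` (fst c \<inter> W)) (chart_rep c (\<lambda>x. inverse (f x)))"
    by (simp add: chart_rep_def)
qed

lemma smooth_fun_sum:
  "openin (man_top M) W \<Longrightarrow> (\<And>j. j \<in> J \<Longrightarrow> smooth_fun M W (f j)) \<Longrightarrow> smooth_fun M W (\<lambda>x. \<Sum>j\<in>J. f j x)"
  by (induction J rule: infinite_finite_induct) (auto intro!: smooth_fun_const smooth_fun_add)

lemma smooth_fun_prod:
  "openin (man_top M) W \<Longrightarrow> (\<And>j. j \<in> J \<Longrightarrow> smooth_fun M W (f j)) \<Longrightarrow> smooth_fun M W (\<lambda>x. \<Prod>j\<in>J. f j x)"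
  by (induction J rule: infinite_finite_induct) (auto intro!: smooth_fun_const smooth_fun_mult)

lemma smooth_fun_diff: "smooth_fun M W f \<Longrightarrow> smooth_fun M W g \<Longrightarrow> smooth_fun M W (\<lambda>x. f x - g x)"
  using smooth_fun_add[of W f "\<lambda>x. (- 1) * g x"] smooth_fun_mult[of W "\<lambda>x. - 1" g] smooth_fun_const[of W "- 1"]
    smooth_fun_open by auto

lemma smooth_fun_coord: "c \<in> atlas M \<Longrightarrow> i < man_dim M \<Longrightarrow> smooth_fun M (fst c) (\<lambda>x. snd c x i)"
  using smooth_manifold chart_domain_open[of c]
  unfolding smooth_manifold_def smooth_fun_def split_beta by blast

text \<open>Smooth transition maps carry smoothness from the one chart \<open>c\<close> to all
  charts of the atlas.\<close>

lemma smooth_fun_compose_chart: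
  assumes c: "c \<in> atlas M" and W: "W \<subseteq> fst c" "openin (man_top M) W"
    and g: "\<And>k. Ck_on (man_dim M) k (snd c ` W) g"
  shows "smooth_fun M W (\<lambda>x. g (snd c x))"
  unfolding smooth_fun_iff
proof (intro conjI ballI allI W(2))
  fix c' k assume c': "c' \<in> atlas M"
  have "openin (Euclidean_space (man_dim M)) (snd c ` W)"
    using chart_image_open[OF c W(2)] W(1) by (simp add: Int_absorb1)
  moreover have "Ck_on (man_dim M) k (snd c' ` (fst c' \<inter> W)) (chart_rep c' (\<lambda>x. snd c x i))"
    if "i < man_dim M" for i k
    using smooth_fun_subset[OF smooth_fun_coord[OF c that] W] c' by (auto simp: smooth_fun_iff)
  ultimately show "Ck_on (man_dim M) k (snd c' ` (fst c' \<inter> W)) (chart_rep c' (\<lambda>x. g (snd c x)))"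
    unfolding chart_rep_def using c' by (intro Ck_on_compose[OF chart_image_open[OF c' W(2)] _ _ _ g]) auto
qed

lemma smooth_nearI: "smooth_fun M W f \<Longrightarrow> x \<in> W \<Longrightarrow> smooth_near M x f"
  by (auto simp: smooth_near_def)

lemma smooth_near_cong:
  assumes "openin (man_top M) W" "x \<in> W" "\<And>y. y \<in> W \<Longrightarrow> f y = g y"
  shows "smooth_near M x f \<longleftrightarrow> smooth_near M x g"
proof -
  have *: "smooth_near M x g" if fg: "smooth_near M x f" "\<And>y. y \<in> W \<Longrightarrow> f y = g y" for f g
  proof -
    obtain W' where "x \<in> W'" "smooth_fun M W' f" using fg(1) by (auto simp: smooth_near_def)
    then have "smooth_fun M (W \<inter> W') f" "x \<in> W \<inter> W'"
      using assms smooth_fun_open smooth_fun_subset[OF _ Int_lower2] by blast+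
    then show ?thesis using smooth_fun_cong[of "W \<inter> W'" f g] fg(2) by (auto simp: smooth_near_def)
  qed
  show ?thesis using *[of f g] *[of g f] assms(3)[symmetric] assms(3) by blast
qed

lemma smooth_near_common:
  assumes "smooth_near M x f" "smooth_near M x g"
  obtains W where "x \<in> W" "smooth_fun M W f" "smooth_fun M W g"
proof -
  obtain W W' where *: "x \<in> W" "smooth_fun M W f" "x \<in> W'" "smooth_fun M W' g"
    using assms by (auto simp: smooth_near_def)
  then have "openin (man_top M) (W \<inter> W')" using smooth_fun_open by (auto intro: openin_Int)
  then show ?thesis using * that[of "W \<inter> W'"] by (auto intro: smooth_fun_subset)
qed

section \<open>Partial derivatives with respect to a chart\<close>

lemma chart_partial_cong:
  assumes "c \<in> atlas M" "openin (man_top M) W" "x \<in> fst c" "x \<in> W" "i < man_dim M" "\<And>y. y \<in> W \<Longrightarrow> f y = g y"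
  shows "chart_partial c i f x = chart_partial c i g x"
  unfolding chart_partial_def
  using assms by (intro partial_cong(1)[OF chart_image_open[OF assms(1,2)]]) auto

lemma has_chart_partial:
  assumes "c \<in> atlas M" "smooth_fun M W f" "x \<in> fst c" "x \<in> W" "i < man_dim M"
  shows "((\<lambda>t. chart_rep c f ((snd c x)(i := t))) has_real_derivative chart_partial c i f x) (at (snd c x i))"
  unfolding chart_partial_def
  using assms by (intro Ck_on_SucD[where S = "snd c ` (fst c \<inter> W)" and k = 0]) (auto simp: smooth_fun_iff simp del: Ck_on.simps)

lemma chart_partialI:
  "((\<lambda>t. chart_rep c f ((snd c x)(i := t))) has_real_derivative D) (at (snd c x i)) \<Longrightarrow> chart_partial c i f x = D"
  unfolding chart_partial_def by (rule partialI)

lemma chart_partial_const: "chart_partial c i (\<lambda>y. a) x = 0"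
  by (rule chart_partialI) (simp add: chart_rep_def)

lemma chart_partial_add:
  assumes "c \<in> atlas M" "smooth_fun M W f" "smooth_fun M W g" "x \<in> fst c" "x \<in> W" "i < man_dim M"
  shows "chart_partial c i (\<lambda>y. f y + g y) x = chart_partial c i f x + chart_partial c i g x"
  using DERIV_add[OF has_chart_partial[OF assms(1,2,4-6)] has_chart_partial[OF assms(1,3,4-6)]]
  by (intro chart_partialI) (simp add: chart_rep_def)

lemma chart_partial_mult:
  assumes "c \<in> atlas M" "smooth_fun M W f" "smooth_fun M W g" "x \<in> fst c" "x \<in> W" "i < man_dim M"
  shows "chart_partial c i (\<lambda>y. f y * g y) x = chart_partial c i f x * g x + f x * chart_partial c i g x"
  using DERIV_mult[OF has_chart_partial[OF assms(1,2,4-6)] has_chart_partial[OF assms(1,3,4-6)], unfolded fun_upd_triv]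
    assms(1,4)
  by (intro chart_partialI) (simp add: chart_rep_def mult_ac)

lemma chart_partial_coord:
  assumes "c \<in> atlas M" "x \<in> fst c" "i < man_dim M" "j < man_dim M"
  shows "chart_partial c i (\<lambda>y. snd c y j) x = (if i = j then 1 else 0)"
proof -
  have "chart_partial c i (\<lambda>y. snd c y j) x = partial i (\<lambda>z. z j) (snd c x)"
    unfolding chart_partial_def using assms
    by (intro partial_cong(1)[OF chart_image_open[OF assms(1) chart_domain_open[OF assms(1)]]])
      (auto simp: chart_rep_def f_inv_into_f)
  also have "\<dots> = (if i = j then 1 else 0)"
    by (rule partialI) auto
  finally show ?thesis .
qed

text \<open>This is the chain rule for the transition map \<open>?\<Phi>\<close>; its Jacobian
  matrix is expressed by derivatives of the coordinate functions of \<open>c\<close>, so that no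
  inverse chart is left in the result.\<close>

lemma chart_partial_change:
  assumes "c \<in> atlas M" "c' \<in> atlas M" "smooth_fun M W f" "x \<in> fst c" "x \<in> fst c'" "x \<in> W" "i < man_dim M"
  shows "chart_partial c' i f x =
    (\<Sum>j<man_dim M. chart_partial c j f x * chart_partial c' i (\<lambda>y. snd c y j) x)"
proof -
  define V where "V = fst c \<inter> W"
  have V: "openin (man_top M) V" "V \<subseteq> fst c" "x \<in> V"
    using assms smooth_fun_open by (auto simp: V_def)
  let ?S' = "snd c' ` (fst c' \<inter> V)" and ?S = "snd c ` (fst c \<inter> V)"
  let ?\<Phi> = "\<lambda>z. snd c (inv_into (fst c') (snd c') z)"
  have S: "openin (Euclidean_space (man_dim M)) ?S" "openin (Euclidean_space (man_dim M)) ?S'"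
    using V assms by (auto intro!: chart_image_open)
  have f: "smooth_fun M V f" using assms V by (auto intro: smooth_fun_subset simp: V_def)
  have coord: "smooth_fun M V (\<lambda>y. snd c y j)" if "j < man_dim M" for j
    using smooth_fun_subset[OF smooth_fun_coord[OF assms(1) that]] V by auto
  have "chart_partial c' i f x = partial i (\<lambda>z. chart_rep c f (?\<Phi> z)) (snd c' x)"
    unfolding chart_partial_def
    using assms V by (intro partial_cong(1)[OF S(2)]) auto
  also have "\<dots> = (\<Sum>j<man_dim M. partial j (chart_rep c f) (?\<Phi> (snd c' x)) *
      partial i (\<lambda>z. ?\<Phi> z j) (snd c' x))"
  proof (rule partial_compose[OF S(2,1)])
    show "Ck_on (man_dim M) 1 ?S' (\<lambda>z. ?\<Phi> z j)" if "j < man_dim M" for j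
      using coord[OF that] assms(2) by (auto simp: smooth_fun_iff chart_rep_def simp del: Ck_on.simps)
    show "Ck_on (man_dim M) 1 ?S (chart_rep c f)"
      using f assms(1) by (auto simp: smooth_fun_iff simp del: Ck_on.simps)
  qed (use assms V in auto)
  also have "\<dots> = (\<Sum>j<man_dim M. chart_partial c j f x * chart_partial c' i (\<lambda>y. snd c y j) x)"
    using assms by (simp add: chart_partial_def chart_rep_def)
  finally show ?thesis .
qed

lemma smooth_fun_chart_partial:
  assumes "c \<in> atlas M" "smooth_fun M W f" "i < man_dim M"
  shows "smooth_fun M (fst c \<inter> W) (chart_partial c i f)"
  unfolding chart_partial_def
proof (rule smooth_fun_compose_chart[OF assms(1)])
  show "openin (man_top M) (fst c \<inter> W)" using assms smooth_fun_open by auto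
  show "Ck_on (man_dim M) k (snd c ` (fst c \<inter> W)) (partial i (chart_rep c f))" for k
  proof -
    have "Ck_on (man_dim M) (Suc k) (snd c ` (fst c \<inter> W)) (chart_rep c f)"
      using assms smooth_fun_iff by blast
    then show ?thesis using assms(3) by simp
  qed
qed auto

lemma chart_partial_commute:
  assumes "c \<in> atlas M" "smooth_fun M W f" "x \<in> fst c" "x \<in> W" "i < man_dim M" "j < man_dim M"
  shows "chart_partial c i (chart_partial c j f) x = chart_partial c j (chart_partial c i f) x"
proof -
  have S: "openin (Euclidean_space (man_dim M)) (snd c ` (fst c \<inter> W))"
    using assms smooth_fun_open by (auto intro!: chart_image_open)
  have "partial i (chart_rep c (chart_partial c j f)) (snd c x) = partial i (partial j (chart_rep c f)) (snd c x)"
    if "i < man_dim M" for i j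
    using assms that by (intro partial_cong(1)[OF S]) (auto simp: chart_partial_def)
  then show ?thesis
    using partial_commute[OF S, of "chart_rep c f" "snd c x" i j] assms
    by (auto simp: chart_partial_def smooth_fun_iff simp del: Ck_on.simps)
qed

end

section \<open>Tangent vectors and bump functions\<close>

lemma span_indexed:
  fixes e :: "nat \<Rightarrow> 'v::real_vector"
  shows "span (e ` {..<n}) = range (\<lambda>a. \<Sum>i<n. a i *\<^sub>R e i)"
proof
  have "subspace (range (\<lambda>a. \<Sum>i<n. a i *\<^sub>R e i))"
    unfolding subspace_def
  proof (intro conjI ballI allI)
    show "0 \<in> range (\<lambda>a. \<Sum>i<n. a i *\<^sub>R e i)"
      by (rule range_eqI[of _ _ "\<lambda>i. 0"]) simp
    fix x y and c :: real
    assume "x \<in> range (\<lambda>a. \<Sum>i<n. a i *\<^sub>R e i)" "y \<in> range (\<lambda>a. \<Sum>i<n. a i *\<^sub>R e i)"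
    then obtain a b where "x = (\<Sum>i<n. a i *\<^sub>R e i)" "y = (\<Sum>i<n. b i *\<^sub>R e i)" by auto
    then show "x + y \<in> range (\<lambda>a. \<Sum>i<n. a i *\<^sub>R e i)"
      by (intro range_eqI[of _ _ "\<lambda>i. a i + b i"]) (simp add: scaleR_add_left sum.distrib)
  next
    fix x and c :: real
    assume "x \<in> range (\<lambda>a. \<Sum>i<n. a i *\<^sub>R e i)"
    then obtain a where "x = (\<Sum>i<n. a i *\<^sub>R e i)" by auto
    then show "c *\<^sub>R x \<in> range (\<lambda>a. \<Sum>i<n. a i *\<^sub>R e i)"
      by (intro range_eqI[of _ _ "\<lambda>i. c * a i"]) (simp add: scaleR_sum_right)
  qed
  moreover have "e i \<in> range (\<lambda>a. \<Sum>i<n. a i *\<^sub>R e i)" if "i < n" for i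
    by (rule range_eqI[of _ _ "\<lambda>j. if j = i then 1 else 0"]) (simp add: if_distrib[of "\<lambda>c. c *\<^sub>R _"] that cong: if_cong)
  ultimately show "span (e ` {..<n}) \<subseteq> range (\<lambda>a. \<Sum>i<n. a i *\<^sub>R e i)"
    by (intro span_minimal) auto
  show "range (\<lambda>a. \<Sum>i<n. a i *\<^sub>R e i) \<subseteq> span (e ` {..<n})"
  proof clarify
    fix a
    show "(\<Sum>i<n. a i *\<^sub>R e i) \<in> span (e ` {..<n})"
      by (intro span_sum span_scale span_base) auto
  qed
qed

text \<open>\<open>vector_bundle\<close> describes a frame by injectivity and independence of a set
  of vectors, whereas all computations use sums over indices; this translates between the
  two.\<close>

lemma independent_indexed_iff:
  fixes e :: "nat \<Rightarrow> 'v::real_vector"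
  shows "inj_on e {..<n} \<and> independent (e ` {..<n}) \<longleftrightarrow>
    (\<forall>a. (\<Sum>i<n. a i *\<^sub>R e i) = 0 \<longrightarrow> (\<forall>i<n. a i = 0))"
proof (intro iffI conjI allI impI)
  fix a i assume *: "inj_on e {..<n} \<and> independent (e ` {..<n})" "(\<Sum>i<n. a i *\<^sub>R e i) = 0" "i < n"
  have "(\<Sum>v\<in>e ` {..<n}. a (the_inv_into {..<n} e v) *\<^sub>R v) = 0"
    using * by (subst sum.reindex) (auto simp: the_inv_into_f_f)
  then have "a (the_inv_into {..<n} e (e i)) = 0"
    using * by (intro independentD[of "e ` {..<n}" "e ` {..<n}" "\<lambda>v. a (the_inv_into {..<n} e v)"]) auto
  then show "a i = 0" using * by (simp add: the_inv_into_f_f)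
next
  assume *: "\<forall>a. (\<Sum>i<n. a i *\<^sub>R e i) = 0 \<longrightarrow> (\<forall>i<n. a i = 0)"
  show inj: "inj_on e {..<n}"
  proof (rule inj_onI)
    fix i j assume ij: "i \<in> {..<n}" "j \<in> {..<n}" "e i = e j"
    show "i = j"
    proof (rule ccontr)
      assume "i \<noteq> j"
      have "(\<Sum>k<n. ((if k = i then 1 else 0) - (if k = j then 1 else 0)) *\<^sub>R e k) = e i - e j"
        using ij by (simp add: scaleR_diff_left sum_subtractf if_distrib[of "\<lambda>c. c *\<^sub>R _"] cong: if_cong)
      also have "\<dots> = 0" using ij(3) by simp
      finally have "\<forall>k<n. (if k = i then 1 else 0) - (if k = j then 1 else 0) = (0::real)"
        using spec[OF *, of "\<lambda>k. (if k = i then 1 else 0) - (if k = j then 1 else 0)"] by simp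
      with ij \<open>i \<noteq> j\<close> show False by auto
    qed
  qed
  show "independent (e ` {..<n})"
  proof (rule independent_if_scalars_zero)
    fix f v assume f: "(\<Sum>v\<in>e ` {..<n}. f v *\<^sub>R v) = 0" and "v \<in> e ` {..<n}"
    then obtain i where i: "i < n" "v = e i" by auto
    have "(\<Sum>i<n. f (e i) *\<^sub>R e i) = 0" using f inj by (simp add: sum.reindex)
    with * i show "f v = 0" by auto
  qed simp
qed

text \<open>The box is a product of compact intervals, degenerate from \<open>n\<close> on, so
  Tychonoff's theorem applies.\<close>

lemma compact_box_Euclidean_space:
  "compactin (Euclidean_space n) {z. (\<forall>i<n. \<bar>z i - z0 i\<bar> \<le> e) \<and> (\<forall>i\<ge>n. z i = 0)}"
proof -
  let ?J = "\<lambda>i. if i < n then {z0 i - e..z0 i + e} else {0::real}"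
  have "{z. (\<forall>i<n. \<bar>z i - z0 i\<bar> \<le> e) \<and> (\<forall>i\<ge>n. z i = 0)} = (\<Pi>\<^sub>E i\<in>UNIV. ?J i)"
    by (auto simp: PiE_iff abs_le_iff not_less split: if_splits)
       (smt (verit, best) not_le)+
  moreover have "compactin (powertop_real UNIV) (\<Pi>\<^sub>E i\<in>UNIV. ?J i)"
    by (auto simp: compactin_PiE)
  ultimately show ?thesis
    by (auto simp: Euclidean_space_def compactin_subtopology)
qed

context manifold_charts
begin

section \<open>Tangent vectors as derivations\<close>

lemma chart_image_mem_iff:
  "c \<in> atlas M \<Longrightarrow> x \<in> fst c \<Longrightarrow> snd c x \<in> snd c ` (fst c \<inter> V) \<longleftrightarrow> x \<in> V"
  by (subst inj_on_image_mem_iff[OF chart_inj]) auto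

lemma coord_vector_near: "smooth_near M x f \<Longrightarrow> coord_vector M c i x f = chart_partial c i f x"
  by (simp add: coord_vector_apply)

lemma coord_vector_coord:
  assumes "c \<in> atlas M" "x \<in> fst c" "i < man_dim M" "j < man_dim M"
  shows "coord_vector M c i x (\<lambda>y. snd c y j) = (if i = j then 1 else 0)"
  using assms smooth_nearI[OF smooth_fun_coord] by (simp add: coord_vector_near chart_partial_coord)

text \<open>\<open>tangent_space\<close> allows the expansion to use any chart at \<open>x\<close>;
  the coordinate change moves it to the prescribed chart \<open>c\<close>. On functions that are not
  smooth near \<open>x\<close> both sides have the default value 0.\<close>

lemma tangent_vector_expand:
  assumes v: "v \<in> tangent_space M x" and c: "c \<in> atlas M" "x \<in> fst c"
  shows "v = (\<Sum>i<man_dim M. v (\<lambda>y. snd c y i) *\<^sub>R coord_vector M c i x)"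
proof
  fix f
  obtain c' a where c': "c' \<in> atlas M" "x \<in> fst c'" and a: "v = (\<Sum>i<man_dim M. a i *\<^sub>R coord_vector M c' i x)"
    using v by (auto simp: tangent_space_def)
  have near: "smooth_near M x (\<lambda>y. snd c y j)" if "j < man_dim M" for j
    using smooth_nearI[OF smooth_fun_coord] that c by auto
  show "v f = (\<Sum>i<man_dim M. v (\<lambda>y. snd c y i) *\<^sub>R coord_vector M c i x) f"
  proof (cases "smooth_near M x f")
    case True
    then obtain W where W: "smooth_fun M W f" "x \<in> W" by (auto simp: smooth_near_def)
    have "v f = (\<Sum>i<man_dim M. a i * (\<Sum>j<man_dim M. chart_partial c j f x * chart_partial c' i (\<lambda>y. snd c y j) x))"
      unfolding a sum_fun_apply scaleR_fun_def
      using chart_partial_change[OF c(1) c'(1) W(1) c(2) c'(2) W(2)] True by (simp add: coord_vector_near)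
    also have "\<dots> = (\<Sum>j<man_dim M. (\<Sum>i<man_dim M. a i * chart_partial c' i (\<lambda>y. snd c y j) x) * chart_partial c j f x)"
      unfolding sum_distrib_left sum_distrib_right by (subst sum.swap) (simp add: mult_ac)
    also have "\<dots> = (\<Sum>i<man_dim M. v (\<lambda>y. snd c y i) *\<^sub>R coord_vector M c i x) f"
      unfolding a sum_fun_apply scaleR_fun_def using True near by (simp add: coord_vector_near)
    finally show ?thesis .
  next
    case False
    then show ?thesis
      by (simp add: a sum_fun_apply scaleR_fun_def coord_vector_apply)
  qed
qed

lemma tangent_space_span:
  assumes "c \<in> atlas M" "x \<in> fst c"
  shows "tangent_space M x = span ((\<lambda>i. coord_vector M c i x) ` {..<man_dim M})"
  unfolding span_indexed using tangent_vector_expand[OF _ assms] assms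
  by (fastforce simp: tangent_space_def)

lemma subspace_tangent_space:
  assumes "x \<in> points M" shows "subspace (tangent_space M x)"
  using chart_at[OF assms] tangent_space_span subspace_span by metis

lemma coord_vector_tangent:
  "c \<in> atlas M \<Longrightarrow> x \<in> fst c \<Longrightarrow> i < man_dim M \<Longrightarrow> coord_vector M c i x \<in> tangent_space M x"
  by (auto simp: tangent_space_span intro: span_base)

lemma tangent_vector_eqI:
  assumes "u \<in> tangent_space M x" "v \<in> tangent_space M x" "c \<in> atlas M" "x \<in> fst c"
    and "\<And>i. i < man_dim M \<Longrightarrow> u (\<lambda>y. snd c y i) = v (\<lambda>y. snd c y i)"
  shows "u = v"
  using tangent_vector_expand[OF assms(1,3,4)] tangent_vector_expand[OF assms(2-4)] assms(5)
  by (metis (no_types, lifting) lessThan_iff sum.cong)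

lemma tangent_vector_points: "v \<in> tangent_space M x \<Longrightarrow> x \<in> points M"
  by (auto simp: tangent_space_def intro: chart_domain_points)

lemma tangent_vector_chart:
  assumes "v \<in> tangent_space M x"
  obtains c a where "c \<in> atlas M" "x \<in> fst c"
    "\<And>f. smooth_near M x f \<Longrightarrow> v f = (\<Sum>i<man_dim M. a i * chart_partial c i f x)"
    "\<And>f. \<not> smooth_near M x f \<Longrightarrow> v f = 0"
proof -
  obtain c a where "c \<in> atlas M" "x \<in> fst c" "v = (\<Sum>i<man_dim M. a i *\<^sub>R coord_vector M c i x)"
    using assms by (auto simp: tangent_space_def)
  then show ?thesis
    by (intro that[of c a]) (simp_all add: sum_fun_apply scaleR_fun_def coord_vector_apply)
qed

lemma tangent_vector_not_smooth: "v \<in> tangent_space M x \<Longrightarrow> \<not> smooth_near M x f \<Longrightarrow> v f = 0"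
  by (metis tangent_vector_chart)

lemma tangent_vector_cong:
  assumes v: "v \<in> tangent_space M x" and W: "openin (man_top M) W" "x \<in> W" "\<And>y. y \<in> W \<Longrightarrow> f y = g y"
  shows "v f = v g"
proof -
  obtain c a where c: "c \<in> atlas M" "x \<in> fst c"
    "\<And>f. smooth_near M x f \<Longrightarrow> v f = (\<Sum>i<man_dim M. a i * chart_partial c i f x)"
    "\<And>f. \<not> smooth_near M x f \<Longrightarrow> v f = 0"
    using tangent_vector_chart[OF v] by metis
  have "smooth_near M x f \<longleftrightarrow> smooth_near M x g" by (rule smooth_near_cong[OF W])
  moreover have "chart_partial c i f x = chart_partial c i g x" if "i < man_dim M" for i
    by (rule chart_partial_cong[OF c(1) W(1) c(2) W(2) that W(3)])
  ultimately show ?thesis using c(3)[of f] c(3)[of g] c(4)[of f] c(4)[of g]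
    by (cases "smooth_near M x f") auto
qed

lemma smooth_near_ops:
  assumes "smooth_near M x f" "smooth_near M x g"
  shows "smooth_near M x (\<lambda>y. f y + g y)" "smooth_near M x (\<lambda>y. f y * g y)"
  using smooth_near_common[OF assms] by (metis smooth_fun_add smooth_nearI, metis smooth_fun_mult smooth_nearI)

lemma smooth_near_const: "x \<in> points M \<Longrightarrow> smooth_near M x (\<lambda>y. a)"
  by (rule smooth_nearI[OF smooth_fun_const[OF openin_topspace]])

lemma tangent_vector_const:
  assumes "v \<in> tangent_space M x" shows "v (\<lambda>y. a) = 0"
proof -
  obtain c b where "\<And>f. smooth_near M x f \<Longrightarrow> v f = (\<Sum>i<man_dim M. b i * chart_partial c i f x)"
    using tangent_vector_chart[OF assms] by metis
  from this[OF smooth_near_const[OF tangent_vector_points[OF assms]]] show ?thesis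
    by (simp add: chart_partial_const)
qed

lemma tangent_vector_add:
  assumes v: "v \<in> tangent_space M x" and "smooth_near M x f" "smooth_near M x g"
  shows "v (\<lambda>y. f y + g y) = v f + v g"
proof -
  obtain W where W: "x \<in> W" "smooth_fun M W f" "smooth_fun M W g"
    using smooth_near_common assms by metis
  obtain c a where c: "c \<in> atlas M" "x \<in> fst c"
    "\<And>f. smooth_near M x f \<Longrightarrow> v f = (\<Sum>i<man_dim M. a i * chart_partial c i f x)"
    using tangent_vector_chart[OF v] by metis
  show ?thesis
    using W c chart_partial_add[OF c(1) W(2,3) c(2) W(1)] assms smooth_near_ops
    by (simp add: distrib_left sum.distrib)
qed

lemma tangent_vector_mult:
  assumes v: "v \<in> tangent_space M x" and "smooth_near M x f" "smooth_near M x g"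
  shows "v (\<lambda>y. f y * g y) = v f * g x + f x * v g"
proof -
  obtain W where W: "x \<in> W" "smooth_fun M W f" "smooth_fun M W g"
    using smooth_near_common assms by metis
  obtain c a where c: "c \<in> atlas M" "x \<in> fst c"
    "\<And>f. smooth_near M x f \<Longrightarrow> v f = (\<Sum>i<man_dim M. a i * chart_partial c i f x)"
    using tangent_vector_chart[OF v] by metis
  show ?thesis
    using W c chart_partial_mult[OF c(1) W(2,3) c(2) W(1)] assms smooth_near_ops
    by (simp add: distrib_left sum.distrib sum_distrib_left sum_distrib_right mult_ac)
qed

lemma smooth_near_sum: "x \<in> points M \<Longrightarrow> (\<And>j. j \<in> J \<Longrightarrow> smooth_near M x (f j)) \<Longrightarrow> smooth_near M x (\<lambda>y. \<Sum>j\<in>J. f j y)"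
  by (induction J rule: infinite_finite_induct)
     (auto intro!: smooth_near_ops smooth_near_const)

lemma tangent_vector_sum:
  assumes v: "v \<in> tangent_space M x" and "\<And>j. j \<in> J \<Longrightarrow> smooth_near M x (f j)"
  shows "v (\<lambda>y. \<Sum>j\<in>J. f j y) = (\<Sum>j\<in>J. v (f j))"
  using assms(2)
  by (induction J rule: infinite_finite_induct)
     (auto simp: tangent_vector_const[OF v] tangent_vector_add[OF v] smooth_near_sum tangent_vector_points[OF v])

lemma tangent_vector_cmult:
  assumes v: "v \<in> tangent_space M x" and "smooth_near M x f"
  shows "v (\<lambda>y. a * f y) = a * v f"
  using tangent_vector_mult[OF v _ assms(2), of "\<lambda>y. a"] smooth_near_const
    tangent_vector_const[OF v] tangent_vector_points[OF v] by auto

lemma vector_bundle_tangent: "vector_bundle M (tangent_algebroid M)"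
  unfolding vector_bundle_def tangent_algebroid_def
proof (simp, intro conjI ballI allI impI)
  show "(\<Union>c\<in>atlas M. fst c) = points M"
    using smooth_manifold by (simp add: smooth_manifold_def)
  fix c assume c: "c \<in> atlas M"
  then show "openin (man_top M) (fst c)" by (rule chart_domain_open)
  {
    fix x assume x: "x \<in> fst c"
    have "a i = 0" if "(\<Sum>i<man_dim M. a i *\<^sub>R coord_vector M c i x) = 0" "i < man_dim M" for a i
    proof -
      \<comment> \<open>Evaluating a vanishing combination at the \<open>i\<close>-th coordinate
        function isolates its \<open>i\<close>-th coefficient.\<close>
      have "(\<Sum>i<man_dim M. a i *\<^sub>R coord_vector M c i x) (\<lambda>y. snd c y i) = 0"
        by (simp add: that)
      then show ?thesis
        using that c x by (simp add: sum_fun_apply scaleR_fun_def coord_vector_coord if_distrib[of "\<lambda>t. _ * t"] cong: if_cong)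
    qed
    then show "inj_on (\<lambda>i. coord_vector M c i x) {..<man_dim M}"
      "independent ((\<lambda>i. coord_vector M c i x) ` {..<man_dim M})"
      using independent_indexed_iff[of "\<lambda>i. coord_vector M c i x" "man_dim M"] by auto
    show "span ((\<lambda>i. coord_vector M c i x) ` {..<man_dim M}) = tangent_space M x"
      using tangent_space_span[OF c x] by simp
  }
  fix i assume i: "i < man_dim M"
  show "coord_vector M c i \<in> sections M \<lparr>fibre = tangent_space M, bundle_rank = man_dim M,
      frames = (\<lambda>c. (fst c, coord_vector M c)) ` atlas M, anchor = \<lambda>x v. v, bracket = vf_bracket M\<rparr> (fst c)"
    unfolding sections_def
  proof (clarsimp simp: chart_domain_open[OF c] coord_vector_tangent[OF c _ i])
    fix U \<phi> assume "(U, \<phi>) \<in> atlas M"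
    then obtain c' where c': "c' \<in> atlas M" "c' = (U, \<phi>)" by auto
    show "\<exists>g. (\<forall>j<man_dim M. smooth_fun M (U \<inter> fst c) (g j)) \<and>
      (\<forall>x\<in>U \<inter> fst c. coord_vector M c i x = (\<Sum>j<man_dim M. g j x *\<^sub>R coord_vector M (U, \<phi>) j x))"
    \<comment> \<open>The coefficients of one coordinate frame in another are entries of the
      Jacobian matrix of the coordinate change.\<close>
    proof (intro exI[of _ "\<lambda>j. chart_partial c i (\<lambda>y. snd c' y j)"] conjI ballI allI impI)
      fix j assume "j < man_dim M"
      then show "smooth_fun M (U \<inter> fst c) (chart_partial c i (\<lambda>y. snd c' y j))"
        using smooth_fun_chart_partial[OF c smooth_fun_coord[OF c'(1)] i, of j] c'(2) by (simp add: Int_commute)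
    next
      fix x assume x: "x \<in> U \<inter> fst c"
      have "coord_vector M c i x (\<lambda>y. snd c' y j) = chart_partial c i (\<lambda>y. snd c' y j) x" if "j < man_dim M" for j
        using smooth_nearI[OF smooth_fun_coord[OF c'(1) that]] x c'(2) by (simp add: coord_vector_near)
      with tangent_vector_expand[OF coord_vector_tangent[OF c _ i] c'(1), of x] x c'(2)
      show "coord_vector M c i x = (\<Sum>j<man_dim M. chart_partial c i (\<lambda>y. snd c' y j) x *\<^sub>R coord_vector M (U, \<phi>) j x)"
        by simp
    qed
  qed
qed

section \<open>Bump functions\<close>

lemma openin_chart_preimage:
  assumes c: "c \<in> atlas M" and T: "openin (Euclidean_space (man_dim M)) T"
  shows "openin (man_top M) {x \<in> fst c. snd c x \<in> T}"
proof -
  let ?Y = "subtopology (Euclidean_space (man_dim M)) (snd c ` fst c)"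
  have "continuous_map (subtopology (man_top M) (fst c)) ?Y (snd c)"
    using chart_homeomorphic[OF c] homeomorphic_imp_continuous_map by blast
  moreover have "openin ?Y (snd c ` fst c \<inter> T)"
    using T by (rule openin_subtopology_Int2)
  ultimately have "openin (subtopology (man_top M) (fst c))
      {x \<in> topspace (subtopology (man_top M) (fst c)). snd c x \<in> snd c ` fst c \<inter> T}"
    by (rule openin_continuous_map_preimage)
  moreover have "{x \<in> topspace (subtopology (man_top M) (fst c)). snd c x \<in> snd c ` fst c \<inter> T} = {x \<in> fst c. snd c x \<in> T}"
    using chart_domain_points[OF c] by auto
  ultimately show ?thesis
    using openin_trans_full[OF _ chart_domain_open[OF c]] by simp
qed

lemma openin_smooth_fun_preimage:
  assumes f: "smooth_fun M W f" and T: "open T"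
  shows "openin (man_top M) {x \<in> W. f x \<in> T}"
proof (subst openin_subopen, intro ballI)
  fix x assume x: "x \<in> {x \<in> W. f x \<in> T}"
  have W: "openin (man_top M) W" using f smooth_fun_open by blast
  obtain c where c: "c \<in> atlas M" "x \<in> fst c"
    using chart_at x openin_subset[OF W] by blast
  let ?S = "snd c ` (fst c \<inter> W)"
  have S: "openin (Euclidean_space (man_dim M)) ?S" using chart_image_open[OF c(1) W] .
  have "continuous_on ?S (chart_rep c f)"
    using f c by (auto intro: Ck_on_continuous[OF smooth_funD])
  then obtain G where G: "open G" "?S \<inter> chart_rep c f -` T = ?S \<inter> G"
    using continuous_openin_preimage_gen[OF _ T] by (metis openin_open)
  have "openin (Euclidean_space (man_dim M)) (?S \<inter> G)"
    using S G(1) by (auto simp: openin_Euclidean_space_iff)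
  from openin_chart_preimage[OF c(1) this]
  have *: "openin (man_top M) {y \<in> fst c. snd c y \<in> ?S \<inter> G}" .
  have "{y \<in> fst c. snd c y \<in> ?S \<inter> G} = {y \<in> fst c \<inter> W. f y \<in> T}"
    unfolding G(2)[symmetric] by (auto simp: c(1) inj_on_eq_iff[OF chart_inj[OF c(1)]])
  with * x c show "\<exists>V. openin (man_top M) V \<and> x \<in> V \<and> V \<subseteq> {x \<in> W. f x \<in> T}"
    by (intro exI[of _ "{y \<in> fst c \<inter> W. f y \<in> T}"]) auto
qed

text \<open>\<open>K\<close> is a compact box in a chart and closed because \<open>M\<close> is
  Hausdorff. The chart domain and the complement of \<open>K\<close> are then open and cover
  \<open>M\<close>, and \<open>h\<close> is smooth on each of them. The conclusion mentions
  \<open>K\<close> because local sections are later extended by zero across its complement.\<close>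

lemma bump_function:
  assumes W: "openin (man_top M) W" and x0: "x0 \<in> W"
  obtains h V K where "smooth_fun M (points M) h" "openin (man_top M) V" "x0 \<in> V" "\<And>x. x \<in> V \<Longrightarrow> h x = 1"
    "V \<subseteq> W" "closedin (man_top M) K" "K \<subseteq> W" "\<And>x. x \<in> points M - K \<Longrightarrow> h x = 0"
proof -
  obtain c where c: "c \<in> atlas M" "x0 \<in> fst c" using chart_at W x0 openin_subset by blast
  define z0 where "z0 = snd c x0"
  let ?n = "man_dim M"
  let ?S = "snd c ` (fst c \<inter> W)"
  have "openin (Euclidean_space ?n) ?S" "z0 \<in> ?S" using chart_image_open[OF c(1) W] c x0 by (auto simp: z0_def)
  then obtain e where e: "e > 0"
    "\<And>w. (\<And>i. i < ?n \<Longrightarrow> \<bar>w i - z0 i\<bar> < e) \<Longrightarrow> (\<And>i. i \<ge> ?n \<Longrightarrow> w i = 0) \<Longrightarrow> w \<in> ?S"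
    using openin_Euclidean_space_box by metis
  have zero: "snd c x i = 0" if "x \<in> fst c" "i \<ge> ?n" for x i
    using openin_Euclidean_space_zero[OF chart_image_open[OF c(1) chart_domain_open[OF c(1)]]] that by auto
  \<comment> \<open>Half the radius puts the closed box inside the open box given by
    \<open>e\<close>; closed sides are needed for compactness.\<close>
  define B where "B = {z. (\<forall>i<?n. \<bar>z i - z0 i\<bar> \<le> e / 2) \<and> (\<forall>i\<ge>?n. z i = 0)}"
  have B: "B \<subseteq> ?S"
  proof
    fix w assume w: "w \<in> B"
    show "w \<in> ?S"
    proof (rule e(2))
      fix i assume "i < ?n"
      then have "\<bar>w i - z0 i\<bar> \<le> e / 2" using w by (simp add: B_def)
      then show "\<bar>w i - z0 i\<bar> < e" using e(1) by linarith
    qed (use w in \<open>simp add: B_def\<close>)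
  qed
  define K where "K = {x \<in> fst c. snd c x \<in> B}"
  have KW: "K \<subseteq> W"
    using B chart_image_mem_iff[OF c(1)] by (auto simp: K_def)
  have imK: "snd c ` K = B" using B by (auto simp: K_def)
  have "compactin (subtopology (Euclidean_space ?n) (snd c ` fst c)) B"
    using compact_box_Euclidean_space[of ?n z0 "e / 2"] B by (auto simp: compactin_subtopology B_def)
  then have "compactin (subtopology (man_top M) (fst c)) K"
    using homeomorphic_map_compactness_eq[of "subtopology (man_top M) (fst c)" _ "snd c" K]
      chart_homeomorphic[OF c(1)] chart_domain_points[OF c(1)] imK by (auto simp: K_def)
  then have "compactin (man_top M) K" by (simp add: compactin_subtopology)
  then have closedK: "closedin (man_top M) K"
    using smooth_manifold by (intro compactin_imp_closedin) (auto simp: smooth_manifold_def)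
  define r where "r x = (\<Sum>i<?n. (snd c x i - z0 i) * (snd c x i - z0 i))" for x
  \<comment> \<open>Outside \<open>B\<close> some coordinate is off by more than
    \<open>e / 2\<close>, hence the sum of squares \<open>r\<close> is at least \<open>b\<close>
    there.\<close>
  define b where "b = (e / 2) * (e / 2)"
  have b: "b > 0" using e by (simp add: b_def)
  \<comment> \<open>The quotient is 1 where \<open>r\<close> is at most \<open>b / 2\<close> and 0
    where \<open>r\<close> is at least \<open>b\<close>. Its denominator never vanishes, because
    \<open>b - t\<close> and \<open>t - b / 2\<close> have the positive sum \<open>b / 2\<close> and
    so are not both nonpositive.\<close>
  define h where "h x = (if x \<in> fst c then flat 0 (b - r x) * inverse (flat 0 (b - r x) + flat 0 (r x - b / 2)) else 0)" for x
  have r: "smooth_fun M (fst c) r"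
    unfolding r_def using c(1)
    by (intro smooth_fun_sum smooth_fun_mult smooth_fun_diff smooth_fun_coord smooth_fun_const chart_domain_open) auto
  have pos: "flat 0 (b - t) + flat 0 (t - b / 2) \<noteq> 0" for t
  proof -
    have "flat 0 (b - t) > 0 \<or> flat 0 (t - b / 2) > 0" unfolding flat_pos_iff using b by linarith
    then show ?thesis using flat_nonneg[of 0 "b - t"] flat_nonneg[of 0 "t - b / 2"] by linarith
  qed
  have h0: "h x = 0" if "x \<in> points M - K" for x
  proof (cases "x \<in> fst c")
    case True
    with that have "snd c x \<notin> B" by (auto simp: K_def)
    with zero[OF True] obtain i where i: "i < ?n" "\<bar>snd c x i - z0 i\<bar> > e / 2"
      by (auto simp: B_def not_le)
    have "b \<le> \<bar>snd c x i - z0 i\<bar> * \<bar>snd c x i - z0 i\<bar>"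
      unfolding b_def using i e(1) by (intro mult_mono) auto
    also have "\<dots> = (snd c x i - z0 i) * (snd c x i - z0 i)" by simp
    also have "\<dots> \<le> r x"
      unfolding r_def using i(1) by (intro member_le_sum) auto
    finally show ?thesis by (simp add: h_def flat_def)
  qed (simp add: h_def)
  have "smooth_fun M (points M) h"
  proof (rule smooth_fun_local)
    fix x assume x: "x \<in> points M"
    have "smooth_fun M (fst c) h"
    proof (subst smooth_fun_cong)
      show "h x = flat 0 (b - r x) * inverse (flat 0 (b - r x) + flat 0 (r x - b / 2))" if "x \<in> fst c" for x
        using that by (simp add: h_def)
      show "smooth_fun M (fst c) (\<lambda>x. flat 0 (b - r x) * inverse (flat 0 (b - r x) + flat 0 (r x - b / 2)))"
        using pos r c(1) chart_domain_open
        by (intro smooth_fun_mult smooth_fun_inverse smooth_fun_add smooth_fun_flat smooth_fun_diff smooth_fun_const) auto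
    qed
    moreover have "smooth_fun M (points M - K) h"
    proof (subst smooth_fun_cong[OF h0])
      show "smooth_fun M (points M - K) (\<lambda>x. 0)"
        using closedK by (intro smooth_fun_const) (auto simp: closedin_def)
    qed
    moreover have "x \<in> fst c \<or> x \<in> points M - K" using x by (auto simp: K_def)
    ultimately show "\<exists>W'. x \<in> W' \<and> smooth_fun M W' h" by blast
  qed auto
  moreover define V where "V = W \<inter> {x \<in> fst c. r x \<in> {..<b / 2}}"
  have "openin (man_top M) V"
    unfolding V_def by (intro openin_Int W openin_smooth_fun_preimage[OF r]) auto
  moreover have "h x = 1" if "x \<in> V" for x
    using that pos[of "r x"] by (auto simp: V_def h_def flat_def)
  moreover have "x0 \<in> V" using x0 c b by (simp add: V_def r_def z0_def)
  ultimately show ?thesis using that[of h V K] closedK KW h0 by (auto simp: V_def)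
qed

end

section \<open>Sections of vector bundles and bivector fields\<close>

lemma linear_between_add:
  "linear_between V W f \<Longrightarrow> u \<in> V \<Longrightarrow> v \<in> V \<Longrightarrow> f (u + v) = f u + f v"
  unfolding linear_between_def by (metis scaleR_one)

lemma linear_between_zero:
  "linear_between V W f \<Longrightarrow> v \<in> V \<Longrightarrow> f 0 = 0"
  unfolding linear_between_def by (metis add.right_neutral scaleR_zero_left)

lemma linear_between_scale:
  assumes "linear_between V W f" "v \<in> V" shows "f (a *\<^sub>R v) = a *\<^sub>R f v"
proof -
  have "f (a *\<^sub>R v + 0 *\<^sub>R v) = a *\<^sub>R f v + 0 *\<^sub>R f v"
    using assms unfolding linear_between_def by blast
  then show ?thesis by simp
qed

lemma linear_between_sum:
  assumes "linear_between V W f" "subspace V" "\<And>i. i \<in> I \<Longrightarrow> u i \<in> V"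
  shows "f (\<Sum>i\<in>I. a i *\<^sub>R u i) = (\<Sum>i\<in>I. a i *\<^sub>R f (u i))"
  using assms(3)
proof (induction I rule: infinite_finite_induct)
  case (insert i I)
  have "f (a i *\<^sub>R u i + (\<Sum>i\<in>I. a i *\<^sub>R u i)) = f (a i *\<^sub>R u i) + f (\<Sum>i\<in>I. a i *\<^sub>R u i)"
    using insert.prems assms(2) by (intro linear_between_add[OF assms(1)] subspace_scale subspace_sum) auto
  then show ?case using insert linear_between_scale[OF assms(1)] by simp
qed (use linear_between_zero[OF assms(1) subspace_0[OF assms(2)]] in auto)

lemma subspace_dual: "subspace (dual V)"
  unfolding subspace_def dual_def linear_between_def
  by (auto simp: zero_fun_def plus_fun_def scaleR_fun_def algebra_simps)

lemma dual_linear: "\<alpha> \<in> dual V \<Longrightarrow> linear_between V UNIV \<alpha>"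
  by (simp add: dual_def)

lemma dual_eqI:
  "\<alpha> \<in> dual V \<Longrightarrow> \<beta> \<in> dual V \<Longrightarrow> (\<And>v. v \<in> V \<Longrightarrow> \<alpha> v = \<beta> v) \<Longrightarrow> \<alpha> = \<beta>"
  unfolding dual_def by (intro ext) (metis (mono_tags, lifting) mem_Collect_eq)

text \<open>Choosing the coefficients once makes them functions of the vector, so that smoothness of
  a section can be stated without an existential quantifier. Below the rank the choice is forced by
  \<open>frame_coeff_unique\<close>; at larger indices the values are arbitrary.\<close>

definition frame_coeff ::
    "('x, 'v::real_vector, 'm) vbundle_scheme \<Rightarrow> (nat \<Rightarrow> 'x \<Rightarrow> 'v) \<Rightarrow> 'x \<Rightarrow> 'v \<Rightarrow> nat \<Rightarrow> real"
  where "frame_coeff B e x v = (SOME a. v = (\<Sum>i<bundle_rank B. a i *\<^sub>R e i x))"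

text \<open>The value 0 off the fibre follows the convention of \<open>dual\<close>.\<close>

definition dual_frame ::
    "('x, 'v::real_vector, 'm) vbundle_scheme \<Rightarrow> (nat \<Rightarrow> 'x \<Rightarrow> 'v) \<Rightarrow> nat \<Rightarrow> 'x \<Rightarrow> 'v \<Rightarrow> real"
  where "dual_frame B e i x v = (if v \<in> fibre B x then frame_coeff B e x v i else 0)"

lemma (in manifold_charts) smooth_fun_transfer:
  "smooth_fun M W f \<Longrightarrow> (\<And>x. x \<in> W \<Longrightarrow> f x = g x) \<Longrightarrow> smooth_fun M W g"
  using smooth_fun_cong[of W f g] by blast

section \<open>Local frames and sections\<close>

locale smooth_bundle = manifold_charts M
  for M :: "'x manifold" and B :: "('x, 'v::real_vector, 'm) vbundle_scheme" +
  assumes vector_bundle: "vector_bundle M B"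
begin

lemma frame_open: "(U, e) \<in> frames B \<Longrightarrow> openin (man_top M) U"
  using vector_bundle by (auto simp: vector_bundle_def)

lemma frame_at:
  assumes "x \<in> points M" obtains U e where "(U, e) \<in> frames B" "x \<in> U"
proof -
  have "x \<in> (\<Union>c\<in>frames B. fst c)" using assms vector_bundle by (simp add: vector_bundle_def)
  then show ?thesis using that by (auto simp: split_beta)
qed

lemma frame_basis:
  assumes "(U, e) \<in> frames B" "x \<in> U"
  shows "inj_on (\<lambda>i. e i x) {..<bundle_rank B}" "independent ((\<lambda>i. e i x) ` {..<bundle_rank B})"
    "span ((\<lambda>i. e i x) ` {..<bundle_rank B}) = fibre B x"
  using assms vector_bundle by (auto simp: vector_bundle_def)

lemma frame_section: "(U, e) \<in> frames B \<Longrightarrow> i < bundle_rank B \<Longrightarrow> e i \<in> sections M B U"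
  using vector_bundle by (auto simp: vector_bundle_def)

lemma frame_fibre: "(U, e) \<in> frames B \<Longrightarrow> x \<in> U \<Longrightarrow> i < bundle_rank B \<Longrightarrow> e i x \<in> fibre B x"
  by (subst frame_basis(3)[symmetric]) (auto intro: span_base)

lemma subspace_fibre: "x \<in> points M \<Longrightarrow> subspace (fibre B x)"
  using frame_at frame_basis(3) subspace_span by metis

lemma frame_coeff_sum:
  assumes "(U, e) \<in> frames B" "x \<in> U" "v \<in> fibre B x"
  shows "v = (\<Sum>i<bundle_rank B. frame_coeff B e x v i *\<^sub>R e i x)"
proof -
  have "\<exists>a. v = (\<Sum>i<bundle_rank B. a i *\<^sub>R e i x)"
    using assms(3) frame_basis(3)[OF assms(1,2)] span_indexed[of "\<lambda>i. e i x" "bundle_rank B"] by auto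
  then show ?thesis unfolding frame_coeff_def by (rule someI_ex)
qed

lemma frame_coeff_unique:
  assumes "(U, e) \<in> frames B" "x \<in> U" "v = (\<Sum>i<bundle_rank B. a i *\<^sub>R e i x)" "i < bundle_rank B"
  shows "frame_coeff B e x v i = a i"
proof -
  have "v \<in> fibre B x"
    unfolding assms(3) frame_basis(3)[OF assms(1,2), symmetric] by (intro span_sum span_scale span_base) auto
  from frame_coeff_sum[OF assms(1,2) this]
  have zero: "(\<Sum>i<bundle_rank B. (frame_coeff B e x v i - a i) *\<^sub>R e i x) = 0"
    using assms(3) by (simp add: scaleR_diff_left sum_subtractf)
  have "\<forall>a. (\<Sum>i<bundle_rank B. a i *\<^sub>R e i x) = 0 \<longrightarrow> (\<forall>i<bundle_rank B. a i = 0)"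
    using independent_indexed_iff[of "\<lambda>i. e i x" "bundle_rank B"] frame_basis(1,2)[OF assms(1,2)] by blast
  from this[rule_format, OF zero assms(4)] show ?thesis by simp
qed

lemma frame_coeff_linear:
  assumes "(U, e) \<in> frames B" "x \<in> U" "u \<in> fibre B x" "v \<in> fibre B x" "i < bundle_rank B"
  shows "frame_coeff B e x (a *\<^sub>R u + b *\<^sub>R v) i = a * frame_coeff B e x u i + b * frame_coeff B e x v i"
proof (rule frame_coeff_unique[OF assms(1,2) _ assms(5)])
  show "a *\<^sub>R u + b *\<^sub>R v =
      (\<Sum>i<bundle_rank B. (a * frame_coeff B e x u i + b * frame_coeff B e x v i) *\<^sub>R e i x)"
    by (subst frame_coeff_sum[OF assms(1-3)], subst frame_coeff_sum[OF assms(1,2,4)])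
      (simp add: scaleR_add_left sum.distrib scaleR_sum_right)
qed

text \<open>Coefficients with respect to a frame are unique, so the functions whose existence
  \<open>sections\<close> demands must be the canonical ones.\<close>

lemma sections_iff:
  "s \<in> sections M B W \<longleftrightarrow> openin (man_top M) W \<and> (\<forall>x\<in>W. s x \<in> fibre B x) \<and>
    (\<forall>(U, e)\<in>frames B. \<forall>i<bundle_rank B. smooth_fun M (U \<inter> W) (\<lambda>x. frame_coeff B e x (s x) i))"
proof safe
  fix U e i assume s: "s \<in> sections M B W" and U: "(U, e) \<in> frames B" and i: "i < bundle_rank B"
  obtain g where g: "\<And>i. i < bundle_rank B \<Longrightarrow> smooth_fun M (U \<inter> W) (g i)"
    "\<And>x. x \<in> U \<inter> W \<Longrightarrow> s x = (\<Sum>i<bundle_rank B. g i x *\<^sub>R e i x)"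
    using s U unfolding sections_def by blast
  have "frame_coeff B e x (s x) i = g i x" if "x \<in> U \<inter> W" for x
    using frame_coeff_unique[OF U _ g(2)[OF that] i] that by auto
  then show "smooth_fun M (U \<inter> W) (\<lambda>x. frame_coeff B e x (s x) i)"
    by (intro smooth_fun_transfer[OF g(1)[OF i]]) simp
next
  assume *: "openin (man_top M) W" "\<forall>x\<in>W. s x \<in> fibre B x"
    "\<forall>(U, e)\<in>frames B. \<forall>i<bundle_rank B. smooth_fun M (U \<inter> W) (\<lambda>x. frame_coeff B e x (s x) i)"
  have "\<exists>g. (\<forall>i<bundle_rank B. smooth_fun M (U \<inter> W) (g i)) \<and>
      (\<forall>x\<in>U \<inter> W. s x = (\<Sum>i<bundle_rank B. g i x *\<^sub>R e i x))" if U: "(U, e) \<in> frames B" for U e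
    using * U frame_coeff_sum[OF U] by (intro exI[of _ "\<lambda>i x. frame_coeff B e x (s x) i"]) auto
  then show "s \<in> sections M B W" using * by (auto simp: sections_def)
qed (auto simp: sections_def)

lemma sections_open: "s \<in> sections M B W \<Longrightarrow> openin (man_top M) W"
  by (simp add: sections_def)

lemma sections_fibre: "s \<in> sections M B W \<Longrightarrow> x \<in> W \<Longrightarrow> s x \<in> fibre B x"
  by (simp add: sections_def)

lemma sections_coeff:
  "s \<in> sections M B W \<Longrightarrow> (U, e) \<in> frames B \<Longrightarrow> i < bundle_rank B \<Longrightarrow>
    smooth_fun M (U \<inter> W) (\<lambda>x. frame_coeff B e x (s x) i)"
  by (auto simp: sections_iff)

lemma open_point: "openin (man_top M) W \<Longrightarrow> x \<in> W \<Longrightarrow> x \<in> points M"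
  using openin_subset by blast

lemma sectionsI:
  assumes "openin (man_top M) W" "\<And>x. x \<in> W \<Longrightarrow> s x \<in> fibre B x"
    and "\<And>U e i. (U, e) \<in> frames B \<Longrightarrow> i < bundle_rank B \<Longrightarrow> smooth_fun M (U \<inter> W) (\<lambda>x. frame_coeff B e x (s x) i)"
  shows "s \<in> sections M B W"
  using assms by (auto simp: sections_iff)

lemma sections_cong:
  assumes "s \<in> sections M B W" "\<And>x. x \<in> W \<Longrightarrow> s x = t x"
  shows "t \<in> sections M B W"
proof (rule sectionsI[OF sections_open[OF assms(1)]])
  show "t x \<in> fibre B x" if "x \<in> W" for x
    using sections_fibre[OF assms(1) that] assms(2)[OF that] by simp
  fix U e i assume "(U, e) \<in> frames B" "i < bundle_rank B"
  from sections_coeff[OF assms(1) this]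
  show "smooth_fun M (U \<inter> W) (\<lambda>x. frame_coeff B e x (t x) i)"
    by (rule smooth_fun_transfer) (simp add: assms(2))
qed

lemma sections_subset:
  assumes "s \<in> sections M B W" "W' \<subseteq> W" "openin (man_top M) W'"
  shows "s \<in> sections M B W'"
proof (rule sectionsI[OF assms(3)])
  fix U e i assume U: "(U, e) \<in> frames B" "i < bundle_rank B"
  have "openin (man_top M) (U \<inter> W')" using frame_open[OF U(1)] assms(3) by (rule openin_Int)
  then show "smooth_fun M (U \<inter> W') (\<lambda>x. frame_coeff B e x (s x) i)"
    using smooth_fun_subset[OF sections_coeff[OF assms(1) U]] assms(2) by blast
qed (use assms sections_fibre in blast)

lemma sections_local:
  assumes W: "openin (man_top M) W" and *: "\<And>x. x \<in> W \<Longrightarrow> \<exists>W'. x \<in> W' \<and> s \<in> sections M B W'"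
  shows "s \<in> sections M B W"
proof (rule sectionsI[OF W])
  show "s x \<in> fibre B x" if "x \<in> W" for x using *[OF that] sections_fibre by blast
  fix U e i assume U: "(U, e) \<in> frames B" "i < bundle_rank B"
  show "smooth_fun M (U \<inter> W) (\<lambda>x. frame_coeff B e x (s x) i)"
  proof (rule smooth_fun_local)
    show "openin (man_top M) (U \<inter> W)" using frame_open[OF U(1)] W by (rule openin_Int)
    fix x assume x: "x \<in> U \<inter> W"
    then obtain W' where "x \<in> W'" "s \<in> sections M B W'" using * by blast
    with sections_coeff[OF this(2) U] x
    show "\<exists>W'. x \<in> W' \<and> smooth_fun M W' (\<lambda>x. frame_coeff B e x (s x) i)" by blast
  qed
qed

lemma sections_lincomb:
  assumes f: "smooth_fun M W f" "smooth_fun M W g" and s: "s \<in> sections M B W" "t \<in> sections M B W"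
  shows "(\<lambda>x. f x *\<^sub>R s x + g x *\<^sub>R t x) \<in> sections M B W"
proof (rule sectionsI[OF sections_open[OF s(1)]])
  have pt: "x \<in> points M" if "x \<in> W" for x using open_point[OF sections_open[OF s(1)] that] .
  show "f x *\<^sub>R s x + g x *\<^sub>R t x \<in> fibre B x" if "x \<in> W" for x
    using subspace_fibre[OF pt[OF that]] s that by (intro subspace_add subspace_scale sections_fibre) auto
  fix U e i assume U: "(U, e) \<in> frames B" "i < bundle_rank B"
  have op: "openin (man_top M) (U \<inter> W)" using frame_open[OF U(1)] sections_open[OF s(1)] by (rule openin_Int)
  have "smooth_fun M (U \<inter> W) (\<lambda>x. f x * frame_coeff B e x (s x) i + g x * frame_coeff B e x (t x) i)"
    using f s U op by (intro smooth_fun_add smooth_fun_mult sections_coeff smooth_fun_subset[OF f(1)]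
      smooth_fun_subset[OF f(2)]) auto
  moreover have "frame_coeff B e x (f x *\<^sub>R s x + g x *\<^sub>R t x) i =
      f x * frame_coeff B e x (s x) i + g x * frame_coeff B e x (t x) i" if "x \<in> U \<inter> W" for x
    using that s U by (intro frame_coeff_linear sections_fibre) auto
  ultimately show "smooth_fun M (U \<inter> W) (\<lambda>x. frame_coeff B e x (f x *\<^sub>R s x + g x *\<^sub>R t x) i)"
    by (rule smooth_fun_transfer[OF _ sym])
qed

lemma sections_scale:
  "smooth_fun M W f \<Longrightarrow> s \<in> sections M B W \<Longrightarrow> (\<lambda>x. f x *\<^sub>R s x) \<in> sections M B W"
  using sections_lincomb[of W f "\<lambda>x. 0" s s] smooth_fun_const[of W 0] smooth_fun_open by auto

lemma sections_add:
  "s \<in> sections M B W \<Longrightarrow> t \<in> sections M B W \<Longrightarrow> (\<lambda>x. s x + t x) \<in> sections M B W"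
  using sections_lincomb[of W "\<lambda>x. 1" "\<lambda>x. 1" s t] smooth_fun_const[of W 1] sections_open by auto

lemma sections_diff:
  "s \<in> sections M B W \<Longrightarrow> t \<in> sections M B W \<Longrightarrow> (\<lambda>x. s x - t x) \<in> sections M B W"
  using sections_lincomb[of W "\<lambda>x. 1" "\<lambda>x. - 1" s t] smooth_fun_const[of W] sections_open by auto

lemma sections_zero: "openin (man_top M) W \<Longrightarrow> (\<lambda>x. 0) \<in> sections M B W"
proof (rule sections_local)
  fix x assume "openin (man_top M) W" "x \<in> W"
  then obtain U e where U: "(U, e) \<in> frames B" "x \<in> U" using frame_at open_point by metis
  have "(\<lambda>x. 0) \<in> sections M B U"
  proof (rule sectionsI[OF frame_open[OF U(1)]])
    show "0 \<in> fibre B y" if "y \<in> U" for y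
      using subspace_fibre[OF open_point[OF frame_open[OF U(1)] that]] by (rule subspace_0)
    fix U' e' i assume U': "(U', e') \<in> frames B" "i < bundle_rank B"
    have "frame_coeff B e' y 0 i = 0" if "y \<in> U' \<inter> U" for y
      using that U' by (intro frame_coeff_unique[OF U'(1)]) auto
    then show "smooth_fun M (U' \<inter> U) (\<lambda>y. frame_coeff B e' y 0 i)"
      by (intro smooth_fun_transfer[OF smooth_fun_const[OF openin_Int[OF frame_open[OF U'(1)] frame_open[OF U(1)]]]])
        simp
  qed
  then show "\<exists>W'. x \<in> W' \<and> (\<lambda>x. 0) \<in> sections M B W'" using U by blast
qed

lemma sections_sum:
  "openin (man_top M) W \<Longrightarrow> (\<And>j. j \<in> J \<Longrightarrow> s j \<in> sections M B W) \<Longrightarrow> (\<lambda>x. \<Sum>j\<in>J. s j x) \<in> sections M B W"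
  by (induction J rule: infinite_finite_induct) (auto intro!: sections_zero sections_add)

text \<open>\<open>W\<close> and the complement of \<open>K\<close> are open and cover
  \<open>M\<close>; on the first the section is a product with a smooth function, on the second it
  vanishes. This is how local frames become arguments of the algebroid bracket.\<close>

lemma sections_extend_by_zero:
  assumes s: "s \<in> sections M B W" and h: "smooth_fun M (points M) h"
    and K: "closedin (man_top M) K" "K \<subseteq> W" "\<And>x. x \<in> points M - K \<Longrightarrow> h x = 0"
  shows "(\<lambda>x. if x \<in> W then h x *\<^sub>R s x else 0) \<in> sections M B (points M)"
proof (rule sections_local)
  fix x assume x: "x \<in> points M"
  have "(\<lambda>x. h x *\<^sub>R s x) \<in> sections M B W"
    using s smooth_fun_subset[OF h openin_subset] sections_open by (intro sections_scale) auto
  then have "(\<lambda>x. if x \<in> W then h x *\<^sub>R s x else 0) \<in> sections M B W"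
    by (rule sections_cong) simp
  moreover have "(\<lambda>x. if x \<in> W then h x *\<^sub>R s x else 0) \<in> sections M B (points M - K)"
    by (rule sections_cong[OF sections_zero]) (use K in auto)
  ultimately show "\<exists>W'. x \<in> W' \<and> (\<lambda>x. if x \<in> W then h x *\<^sub>R s x else 0) \<in> sections M B W'"
    using x K(2) by blast
qed simp

section \<open>Dual frames\<close>

lemma dual_frame_dual:
  assumes "(U, e) \<in> frames B" "x \<in> U" "i < bundle_rank B"
  shows "dual_frame B e i x \<in> dual (fibre B x)"
proof -
  have "subspace (fibre B x)" using subspace_fibre open_point[OF frame_open] assms by metis
  then have "a *\<^sub>R u + b *\<^sub>R v \<in> fibre B x" if "u \<in> fibre B x" "v \<in> fibre B x" for a b u v
    using that by (intro subspace_add subspace_scale) auto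
  then show ?thesis
    using frame_coeff_linear[OF assms(1,2) _ _ assms(3)]
    by (auto simp: dual_def linear_between_def dual_frame_def)
qed

lemma dual_frame_section:
  assumes "(U, e) \<in> frames B" "i < bundle_rank B"
  shows "dual_frame B e i \<in> dual_sections M B U"
  unfolding dual_sections_def
proof (intro CollectI conjI ballI allI impI)
  fix W s assume *: "W \<subseteq> U \<and> s \<in> sections M B W"
  then have "smooth_fun M (U \<inter> W) (\<lambda>x. frame_coeff B e x (s x) i)" using sections_coeff assms by blast
  moreover have "U \<inter> W = W" using * by auto
  ultimately show "smooth_fun M W (\<lambda>x. dual_frame B e i x (s x))"
    using * sections_fibre[of s W] by (auto simp: dual_frame_def elim: smooth_fun_transfer)
qed (use assms frame_open dual_frame_dual in auto)

lemma dual_expand: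
  assumes U: "(U, e) \<in> frames B" "x \<in> U" and \<alpha>: "\<alpha> \<in> dual (fibre B x)"
  shows "\<alpha> = (\<Sum>i<bundle_rank B. \<alpha> (e i x) *\<^sub>R dual_frame B e i x)"
proof (rule dual_eqI[OF \<alpha>])
  show "(\<Sum>i<bundle_rank B. \<alpha> (e i x) *\<^sub>R dual_frame B e i x) \<in> dual (fibre B x)"
    using U by (intro subspace_sum[OF subspace_dual] subspace_scale[OF subspace_dual] dual_frame_dual) auto
  fix v assume v: "v \<in> fibre B x"
  have "subspace (fibre B x)" using subspace_fibre open_point[OF frame_open] U by metis
  then have "\<alpha> (\<Sum>i<bundle_rank B. frame_coeff B e x v i *\<^sub>R e i x) =
      (\<Sum>i<bundle_rank B. frame_coeff B e x v i *\<^sub>R \<alpha> (e i x))"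
    using U frame_fibre by (intro linear_between_sum[OF dual_linear[OF \<alpha>]]) auto
  then show "\<alpha> v = (\<Sum>i<bundle_rank B. \<alpha> (e i x) *\<^sub>R dual_frame B e i x) v"
    using frame_coeff_sum[OF U v] v by (simp add: sum_fun_apply scaleR_fun_def dual_frame_def mult.commute)
qed

lemma dual_separates:
  assumes "x \<in> points M" "u \<in> fibre B x" "v \<in> fibre B x" "\<And>\<alpha>. \<alpha> \<in> dual (fibre B x) \<Longrightarrow> \<alpha> u = \<alpha> v"
  shows "u = v"
proof -
  obtain U e where U: "(U, e) \<in> frames B" "x \<in> U" using frame_at assms(1) by metis
  have "frame_coeff B e x u i = frame_coeff B e x v i" if "i < bundle_rank B" for i
    using assms(4)[OF dual_frame_dual[OF U that]] assms(2,3) by (simp add: dual_frame_def)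
  then show ?thesis
    using frame_coeff_sum[OF U assms(2)] frame_coeff_sum[OF U assms(3)] by simp
qed

section \<open>Bivector fields and the sharp map\<close>

context
  fixes P :: "'x \<Rightarrow> 'v bivec"
  assumes P: "bivector_field M B P"
begin

lemma bivector_linear:
  assumes "x \<in> points M" "\<alpha> \<in> dual (fibre B x)"
  shows "linear_between (dual (fibre B x)) UNIV (\<lambda>\<beta>. P x \<alpha> \<beta>)"
    "linear_between (dual (fibre B x)) UNIV (\<lambda>\<beta>. P x \<beta> \<alpha>)" "P x \<alpha> \<alpha> = 0"
  using P assms by (auto simp: bivector_field_def)

text \<open>Polarization: the alternating condition is expanded at the sum of the two
  covectors.\<close>

lemma bivector_antisym:
  assumes "x \<in> points M" "\<alpha> \<in> dual (fibre B x)" "\<beta> \<in> dual (fibre B x)"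
  shows "P x \<alpha> \<beta> = - P x \<beta> \<alpha>"
proof -
  have ab: "\<alpha> + \<beta> \<in> dual (fibre B x)" using assms by (intro subspace_add[OF subspace_dual])
  have "P x (\<alpha> + \<beta>) (\<alpha> + \<beta>) = P x \<alpha> \<alpha> + P x \<alpha> \<beta> + (P x \<beta> \<alpha> + P x \<beta> \<beta>)"
    using linear_between_add[OF bivector_linear(2)[OF assms(1) ab] assms(2,3)]
      linear_between_add[OF bivector_linear(1)[OF assms(1,2)] assms(2,3)]
      linear_between_add[OF bivector_linear(1)[OF assms(1,3)] assms(2,3)] by simp
  then show ?thesis
    using bivector_linear(3)[OF assms(1)] assms ab by simp
qed

text \<open>The explicit vector supplies the existence behind the definite description in
  \<open>sharp\<close>; uniqueness is \<open>dual_separates\<close>.\<close>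

lemma sharp_frame:
  assumes U: "(U, e) \<in> frames B" "x \<in> U" and \<alpha>: "\<alpha> \<in> dual (fibre B x)"
  shows "sharp B P x \<alpha> = (\<Sum>i<bundle_rank B. P x \<alpha> (dual_frame B e i x) *\<^sub>R e i x)" (is "_ = ?v")
  unfolding sharp_def
proof (rule the_equality)
  have x: "x \<in> points M" using open_point frame_open U by metis
  have v: "?v \<in> fibre B x"
    using frame_fibre[OF U] by (intro subspace_sum subspace_scale subspace_fibre x) auto
  have \<beta>: "\<beta> ?v = P x \<alpha> \<beta>" if \<beta>: "\<beta> \<in> dual (fibre B x)" for \<beta>
  proof -
    have "P x \<alpha> \<beta> = (\<Sum>i<bundle_rank B. \<beta> (e i x) *\<^sub>R P x \<alpha> (dual_frame B e i x))"
      by (subst dual_expand[OF U \<beta>], rule linear_between_sum[OF bivector_linear(1)[OF x \<alpha>] subspace_dual])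
        (use dual_frame_dual[OF U] in auto)
    moreover have "\<beta> ?v = (\<Sum>i<bundle_rank B. P x \<alpha> (dual_frame B e i x) *\<^sub>R \<beta> (e i x))"
      using frame_fibre[OF U] by (intro linear_between_sum[OF dual_linear[OF \<beta>] subspace_fibre[OF x]]) auto
    ultimately show ?thesis by (simp add: mult.commute)
  qed
  show "?v \<in> fibre B x \<and> (\<forall>\<beta>\<in>dual (fibre B x). \<beta> ?v = P x \<alpha> \<beta>)" using v \<beta> by blast
  show "w = ?v" if "w \<in> fibre B x \<and> (\<forall>\<beta>\<in>dual (fibre B x). \<beta> w = P x \<alpha> \<beta>)" for w
    using that v \<beta> by (intro dual_separates[OF x]) auto
qed

lemma sharp_fibre: "x \<in> points M \<Longrightarrow> \<alpha> \<in> dual (fibre B x) \<Longrightarrow> sharp B P x \<alpha> \<in> fibre B x"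
proof -
  assume x: "x \<in> points M" and \<alpha>: "\<alpha> \<in> dual (fibre B x)"
  obtain U e where U: "(U, e) \<in> frames B" "x \<in> U" using frame_at x by metis
  show ?thesis
    unfolding sharp_frame[OF U \<alpha>]
    using frame_fibre[OF U] by (intro subspace_sum subspace_scale subspace_fibre x) auto
qed

lemma sharp_sum:
  assumes x: "x \<in> points M" and \<alpha>: "\<And>j. j \<in> J \<Longrightarrow> \<alpha> j \<in> dual (fibre B x)"
  shows "sharp B P x (\<Sum>j\<in>J. a j *\<^sub>R \<alpha> j) = (\<Sum>j\<in>J. a j *\<^sub>R sharp B P x (\<alpha> j))"
proof -
  obtain U e where U: "(U, e) \<in> frames B" "x \<in> U" using frame_at x by metis
  have sum: "(\<Sum>j\<in>J. a j *\<^sub>R \<alpha> j) \<in> dual (fibre B x)"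
    using \<alpha> by (intro subspace_sum[OF subspace_dual] subspace_scale[OF subspace_dual])
  have "P x (\<Sum>j\<in>J. a j *\<^sub>R \<alpha> j) (dual_frame B e i x) = (\<Sum>j\<in>J. a j *\<^sub>R P x (\<alpha> j) (dual_frame B e i x))"
    if "i < bundle_rank B" for i
    using \<alpha> by (intro linear_between_sum[OF bivector_linear(2)[OF x dual_frame_dual[OF U that]] subspace_dual])
  then have "sharp B P x (\<Sum>j\<in>J. a j *\<^sub>R \<alpha> j) =
      (\<Sum>i<bundle_rank B. \<Sum>j\<in>J. a j *\<^sub>R P x (\<alpha> j) (dual_frame B e i x) *\<^sub>R e i x)"
    unfolding sharp_frame[OF U sum] by (simp add: scaleR_sum_left)
  also have "\<dots> = (\<Sum>j\<in>J. a j *\<^sub>R (\<Sum>i<bundle_rank B. P x (\<alpha> j) (dual_frame B e i x) *\<^sub>R e i x))"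
    by (subst sum.swap) (simp add: scaleR_sum_right)
  also have "\<dots> = (\<Sum>j\<in>J. a j *\<^sub>R sharp B P x (\<alpha> j))"
    using sharp_frame[OF U \<alpha>] by simp
  finally show ?thesis .
qed

text \<open>
  With \<open>P = \<Sum>\<^sub>i\<^sub>j p\<^sub>i\<^sub>j e\<^sub>i \<otimes> e\<^sub>j\<close> in a local frame, the sections are \<open>s\<^sub>j = \<Sum>\<^sub>i p\<^sub>i\<^sub>j e\<^sub>i / 2\<close> and \<open>t\<^sub>j = e\<^sub>j\<close>,
  cut off so as to be defined globally.
\<close>

lemma sharp_decomposition:
  assumes x0: "x0 \<in> points M"
  obtains W s t where "openin (man_top M) W" "x0 \<in> W"
    "\<And>j. j < bundle_rank B \<Longrightarrow> s j \<in> sections M B (points M)"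
    "\<And>j. j < bundle_rank B \<Longrightarrow> t j \<in> sections M B (points M)"
    "\<And>x \<alpha>. x \<in> W \<Longrightarrow> \<alpha> \<in> dual (fibre B x) \<Longrightarrow>
      sharp B P x \<alpha> = (\<Sum>j<bundle_rank B. \<alpha> (s j x) *\<^sub>R t j x - \<alpha> (t j x) *\<^sub>R s j x)"
proof -
  let ?r = "bundle_rank B"
  obtain U e where U: "(U, e) \<in> frames B" "x0 \<in> U" using frame_at x0 by metis
  define p where "p i j x = P x (dual_frame B e i x) (dual_frame B e j x)" for i j x
  have p: "smooth_fun M U (p i j)" if "i < ?r" "j < ?r" for i j
    using P dual_frame_section[OF U(1)] that unfolding bivector_field_def p_def by blast
  define F where "F j x = (\<Sum>i<?r. (1 / 2 * p i j x) *\<^sub>R e i x)" for j x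
  have F: "F j \<in> sections M B U" if "j < ?r" for j
    unfolding F_def using p that frame_open[OF U(1)]
    by (intro sections_sum sections_scale smooth_fun_mult smooth_fun_const frame_section[OF U(1)]) auto
  have main: "sharp B P x \<alpha> = (\<Sum>j<?r. \<alpha> (F j x) *\<^sub>R e j x - \<alpha> (e j x) *\<^sub>R F j x)"
    if x: "x \<in> U" and \<alpha>: "\<alpha> \<in> dual (fibre B x)" for x \<alpha>
  proof -
    have pt: "x \<in> points M" using open_point frame_open U(1) x by metis
    have anti: "p i j x = - p j i x" if "i < ?r" "j < ?r" for i j
      unfolding p_def using that by (intro bivector_antisym pt dual_frame_dual[OF U(1) x]) auto
    have aF: "\<alpha> (F j x) = (\<Sum>i<?r. (1 / 2 * p i j x) *\<^sub>R \<alpha> (e i x))" for j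
      unfolding F_def using frame_fibre[OF U(1) x]
      by (intro linear_between_sum[OF dual_linear[OF \<alpha>] subspace_fibre[OF pt]]) auto
    have "P x \<alpha> (dual_frame B e j x) = (\<Sum>i<?r. \<alpha> (e i x) *\<^sub>R p i j x)" if "j < ?r" for j
      unfolding p_def
      by (subst dual_expand[OF U(1) x \<alpha>],
          rule linear_between_sum[OF bivector_linear(2)[OF pt dual_frame_dual[OF U(1) x that]] subspace_dual])
        (use dual_frame_dual[OF U(1) x] in auto)
    then have "P x \<alpha> (dual_frame B e j x) = 2 * \<alpha> (F j x)" if "j < ?r" for j
      using that by (simp add: aF sum_distrib_left mult.commute)
    then have sharp: "sharp B P x \<alpha> = (\<Sum>j<?r. (2 * \<alpha> (F j x)) *\<^sub>R e j x)"
      unfolding sharp_frame[OF U(1) x \<alpha>] by simp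
    have "(\<Sum>j<?r. \<alpha> (e j x) *\<^sub>R F j x) = (\<Sum>j<?r. \<Sum>i<?r. (1 / 2 * p i j x * \<alpha> (e j x)) *\<^sub>R e i x)"
      by (simp add: F_def scaleR_sum_right mult_ac)
    also have "\<dots> = (\<Sum>i<?r. \<Sum>j<?r. (1 / 2 * p i j x * \<alpha> (e j x)) *\<^sub>R e i x)"
      by (rule sum.swap)
    also have "\<dots> = (\<Sum>i<?r. - (\<alpha> (F i x) *\<^sub>R e i x))"
    proof (rule sum.cong[OF refl])
      fix i assume i: "i \<in> {..<?r}"
      have "(\<Sum>j<?r. (1 / 2 * p i j x * \<alpha> (e j x)) *\<^sub>R e i x) = (\<Sum>j<?r. 1 / 2 * p i j x * \<alpha> (e j x)) *\<^sub>R e i x"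
        by (simp add: scaleR_sum_left)
      also have "(\<Sum>j<?r. 1 / 2 * p i j x * \<alpha> (e j x)) = - \<alpha> (F i x)"
        using i unfolding aF by (simp add: anti[of i] flip: sum_negf)
      finally show "(\<Sum>j<?r. (1 / 2 * p i j x * \<alpha> (e j x)) *\<^sub>R e i x) = - (\<alpha> (F i x) *\<^sub>R e i x)" by simp
    qed
    \<comment> \<open>By antisymmetry of the coefficients the second half of the sum repeats the
      first, which compensates the factor 1/2 in \<open>F\<close>.\<close>
    finally have eF: "(\<Sum>j<?r. \<alpha> (e j x) *\<^sub>R F j x) = - (\<Sum>j<?r. \<alpha> (F j x) *\<^sub>R e j x)"
      by (simp add: sum_negf)
    have "(\<Sum>j<?r. \<alpha> (F j x) *\<^sub>R e j x - \<alpha> (e j x) *\<^sub>R F j x) =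
        (\<Sum>j<?r. \<alpha> (F j x) *\<^sub>R e j x) + (\<Sum>j<?r. \<alpha> (F j x) *\<^sub>R e j x)"
      unfolding sum_subtractf eF by simp
    also have "\<dots> = sharp B P x \<alpha>"
      unfolding sharp by (simp add: sum.distrib[symmetric] scaleR_2 flip: scaleR_scaleR)
    finally show ?thesis by simp
  qed
  obtain h V K where h: "smooth_fun M (points M) h" and V: "openin (man_top M) V" "x0 \<in> V" "\<And>x. x \<in> V \<Longrightarrow> h x = 1" "V \<subseteq> U"
    and K: "closedin (man_top M) K" "K \<subseteq> U" "\<And>x. x \<in> points M - K \<Longrightarrow> h x = 0"
    using bump_function[OF frame_open[OF U(1)] U(2)] by metis
  show ?thesis
  proof (rule that[OF V(1,2)])
    show "(\<lambda>x. if x \<in> U then h x *\<^sub>R F j x else 0) \<in> sections M B (points M)" if "j < ?r" for j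
      by (rule sections_extend_by_zero[OF F[OF that] h K])
    show "(\<lambda>x. if x \<in> U then h x *\<^sub>R e j x else 0) \<in> sections M B (points M)" if "j < ?r" for j
      by (rule sections_extend_by_zero[OF frame_section[OF U(1) that] h K])
    show "sharp B P x \<alpha> = (\<Sum>j<?r. \<alpha> (if x \<in> U then h x *\<^sub>R F j x else 0) *\<^sub>R (if x \<in> U then h x *\<^sub>R e j x else 0) -
        \<alpha> (if x \<in> U then h x *\<^sub>R e j x else 0) *\<^sub>R (if x \<in> U then h x *\<^sub>R F j x else 0))"
      if "x \<in> V" "\<alpha> \<in> dual (fibre B x)" for x \<alpha>
      using main[OF _ that(2)] V that(1) by auto
  qed
qed

end

end

section \<open>Vector fields and Lie derivatives of volume forms\<close>

lemma tangent_algebroid_simps [simp]: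
  "fibre (tangent_algebroid M) = tangent_space M"
  "bundle_rank (tangent_algebroid M) = man_dim M"
  "frames (tangent_algebroid M) = (\<lambda>c. (fst c, coord_vector M c)) ` atlas M"
  by (simp_all add: tangent_algebroid_def)

text \<open>The prefix keeps the bundle lemmas for the tangent bundle apart from those for
  \<open>A\<close>, which are used without a prefix.\<close>

sublocale manifold_charts \<subseteq> T: smooth_bundle M "tangent_algebroid M"
  by unfold_locales (rule vector_bundle_tangent)

context manifold_charts
begin

section \<open>Vector fields in coordinates and their bracket\<close>

lemma frame_coeff_coord:
  assumes "c \<in> atlas M" "x \<in> fst c" "v \<in> tangent_space M x" "i < man_dim M"
  shows "frame_coeff (tangent_algebroid M) (coord_vector M c) x v i = v (\<lambda>y. snd c y i)"
  using T.frame_coeff_unique[of "fst c" "coord_vector M c" x v "\<lambda>i. v (\<lambda>y. snd c y i)" i]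
    tangent_vector_expand[OF assms(3,1,2)] assms by auto

lemma vector_fields_tangent: "V \<in> vector_fields M W \<Longrightarrow> x \<in> W \<Longrightarrow> V x \<in> tangent_space M x"
  using T.sections_fibre by simp

lemma vector_field_coord_smooth:
  assumes "V \<in> vector_fields M W" "c \<in> atlas M" "i < man_dim M"
  shows "smooth_fun M (fst c \<inter> W) (\<lambda>x. V x (\<lambda>y. snd c y i))"
proof -
  have "smooth_fun M (fst c \<inter> W) (\<lambda>x. frame_coeff (tangent_algebroid M) (coord_vector M c) x (V x) i)"
    using assms by (intro T.sections_coeff) auto
  then show ?thesis
    using assms vector_fields_tangent[OF assms(1)]
    by (elim smooth_fun_transfer) (auto intro!: frame_coeff_coord)
qed

lemma vector_fieldsI:
  assumes "openin (man_top M) W" "\<And>x. x \<in> W \<Longrightarrow> V x \<in> tangent_space M x"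
    and "\<And>c i. c \<in> atlas M \<Longrightarrow> i < man_dim M \<Longrightarrow> smooth_fun M (fst c \<inter> W) (\<lambda>x. V x (\<lambda>y. snd c y i))"
  shows "V \<in> vector_fields M W"
proof (rule T.sectionsI[OF assms(1)])
  fix U e i assume "(U, e) \<in> frames (tangent_algebroid M)" "i < bundle_rank (tangent_algebroid M)"
  then obtain c where c: "c \<in> atlas M" "U = fst c" "e = coord_vector M c" and i: "i < man_dim M" by auto
  show "smooth_fun M (U \<inter> W) (\<lambda>x. frame_coeff (tangent_algebroid M) e x (V x) i)"
    unfolding c(2,3) using assms(2) c(1) i
    by (intro smooth_fun_transfer[OF assms(3)[OF c(1) i]]) (auto simp: frame_coeff_coord)
qed (use assms in auto)

lemma tangent_vector_partials:
  assumes "v \<in> tangent_space M x" "c \<in> atlas M" "x \<in> fst c" "smooth_near M x f"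
  shows "v f = (\<Sum>i<man_dim M. v (\<lambda>y. snd c y i) * chart_partial c i f x)"
  by (subst tangent_vector_expand[OF assms(1-3)])
     (simp add: sum_fun_apply scaleR_fun_def coord_vector_near[OF assms(4)])

lemma vector_field_apply_smooth:
  assumes V: "V \<in> vector_fields M W" and f: "smooth_fun M W f"
  shows "smooth_fun M W (\<lambda>x. V x f)"
proof (rule smooth_fun_local[OF smooth_fun_open[OF f]])
  fix x assume x: "x \<in> W"
  then obtain c where c: "c \<in> atlas M" "x \<in> fst c"
    using chart_at T.open_point[OF smooth_fun_open[OF f]] by metis
  have op: "openin (man_top M) (fst c \<inter> W)" using c(1) smooth_fun_open[OF f] by blast
  have "smooth_fun M (fst c \<inter> W) (\<lambda>x. \<Sum>i<man_dim M. V x (\<lambda>y. snd c y i) * chart_partial c i f x)"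
    using c(1) V f by (intro smooth_fun_sum[OF op] smooth_fun_mult vector_field_coord_smooth
      smooth_fun_chart_partial) auto
  then have "smooth_fun M (fst c \<inter> W) (\<lambda>x. V x f)"
  proof (rule smooth_fun_transfer)
    fix y assume y: "y \<in> fst c \<inter> W"
    then show "(\<Sum>i<man_dim M. V y (\<lambda>y. snd c y i) * chart_partial c i f y) = V y f"
      using tangent_vector_partials[OF vector_fields_tangent[OF V] c(1) _ smooth_nearI[OF f]] by auto
  qed
  then show "\<exists>W'. x \<in> W' \<and> smooth_fun M W' (\<lambda>x. V x f)" using x c by blast
qed

text \<open>All second-order terms are collected in one double sum. Mixed partial derivatives
  commute, so this sum does not change when the two vector fields exchange their roles, and it
  cancels in the bracket.\<close>

lemma vector_field_second_derivative:
  assumes v: "v \<in> tangent_space M x" and Y: "Y \<in> vector_fields M W" and x: "x \<in> W" "x \<in> fst c"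
    and c: "c \<in> atlas M" and f: "smooth_fun M W f"
  shows "v (\<lambda>y. Y y f) =
    (\<Sum>k<man_dim M. v (\<lambda>y. Y y (\<lambda>y. snd c y k)) * chart_partial c k f x) +
    (\<Sum>k<man_dim M. \<Sum>j<man_dim M. Y x (\<lambda>y. snd c y k) * v (\<lambda>y. snd c y j) * chart_partial c j (chart_partial c k f) x)"
proof -
  let ?b = "\<lambda>k y. Y y (\<lambda>y. snd c y k)"
  have op: "openin (man_top M) (fst c \<inter> W)" using c smooth_fun_open[OF f] by blast
  have b: "smooth_near M x (?b k)" if "k < man_dim M" for k
    using smooth_nearI[OF vector_field_coord_smooth[OF Y c that]] x by auto
  have pf: "smooth_near M x (chart_partial c k f)" if "k < man_dim M" for k
    using smooth_nearI[OF smooth_fun_chart_partial[OF c f that]] x by auto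
  have "v (\<lambda>y. Y y f) = v (\<lambda>y. \<Sum>k<man_dim M. ?b k y * chart_partial c k f y)"
    using x tangent_vector_partials[OF vector_fields_tangent[OF Y] c _ smooth_nearI[OF f]]
    by (intro tangent_vector_cong[OF v op]) auto
  also have "\<dots> = (\<Sum>k<man_dim M. v (\<lambda>y. ?b k y * chart_partial c k f y))"
    using b pf by (intro tangent_vector_sum[OF v] smooth_near_ops) auto
  also have "\<dots> = (\<Sum>k<man_dim M. v (?b k) * chart_partial c k f x + ?b k x * v (chart_partial c k f))"
    using b pf by (intro sum.cong refl tangent_vector_mult[OF v]) auto
  also have "\<dots> = (\<Sum>k<man_dim M. v (?b k) * chart_partial c k f x) +
      (\<Sum>k<man_dim M. ?b k x * (\<Sum>j<man_dim M. v (\<lambda>y. snd c y j) * chart_partial c j (chart_partial c k f) x))"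
    using tangent_vector_partials[OF v c x(2) pf] by (simp add: sum.distrib)
  finally show ?thesis by (simp add: sum_distrib_left mult.assoc)
qed

text \<open>The second-order terms of X(Y f) and Y(X f) cancel. What remains is a first-order
  operator, which is why the bracket takes values in tangent vectors.\<close>

lemma vf_bracket_coord:
  assumes X: "X \<in> vector_fields M W" and Y: "Y \<in> vector_fields M W" and x: "x \<in> W" "x \<in> fst c"
    and c: "c \<in> atlas M"
  shows "vf_bracket M X Y x = (\<Sum>k<man_dim M.
    (X x (\<lambda>y. Y y (\<lambda>y. snd c y k)) - Y x (\<lambda>y. X y (\<lambda>y. snd c y k))) *\<^sub>R coord_vector M c k x)"
proof
  fix f
  show "vf_bracket M X Y x f = (\<Sum>k<man_dim M.
    (X x (\<lambda>y. Y y (\<lambda>y. snd c y k)) - Y x (\<lambda>y. X y (\<lambda>y. snd c y k))) *\<^sub>R coord_vector M c k x) f"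
  proof (cases "smooth_near M x f")
    case True
    then obtain W' where W': "x \<in> W'" "smooth_fun M W' f" by (auto simp: smooth_near_def)
    define N where "N = W \<inter> W'"
    have N: "openin (man_top M) N" "N \<subseteq> W" "N \<subseteq> W'" "x \<in> N"
      using x W' smooth_fun_open[OF W'(2)] T.sections_open[OF X] by (auto simp: N_def)
    note f = smooth_fun_subset[OF W'(2) N(3,1)]
    note X' = T.sections_subset[OF X N(2,1)] and Y' = T.sections_subset[OF Y N(2,1)]
    note vX = vector_fields_tangent[OF X x(1)] and vY = vector_fields_tangent[OF Y x(1)]
    have "(\<Sum>k<man_dim M. \<Sum>j<man_dim M. Y x (\<lambda>y. snd c y k) * X x (\<lambda>y. snd c y j) * chart_partial c j (chart_partial c k f) x) =
        (\<Sum>j<man_dim M. \<Sum>k<man_dim M. Y x (\<lambda>y. snd c y k) * X x (\<lambda>y. snd c y j) * chart_partial c j (chart_partial c k f) x)"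
      by (rule sum.swap)
    also have "\<dots> = (\<Sum>j<man_dim M. \<Sum>k<man_dim M. X x (\<lambda>y. snd c y j) * Y x (\<lambda>y. snd c y k) * chart_partial c k (chart_partial c j f) x)"
      using chart_partial_commute[OF c f x(2) N(4)] by (intro sum.cong refl) auto
    finally show ?thesis
      using True vector_field_second_derivative[OF vX Y' N(4) x(2) c f]
        vector_field_second_derivative[OF vY X' N(4) x(2) c f]
      by (simp add: vf_bracket_def sum_fun_apply scaleR_fun_def coord_vector_near left_diff_distrib sum_subtractf)
  next
    case False
    then show ?thesis by (simp add: vf_bracket_def sum_fun_apply scaleR_fun_def coord_vector_apply)
  qed
qed

lemma vf_bracket_vector_field:
  assumes X: "X \<in> vector_fields M W" and Y: "Y \<in> vector_fields M W"
  shows "vf_bracket M X Y \<in> vector_fields M W"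
proof (rule vector_fieldsI[OF T.sections_open[OF X]])
  fix x assume x: "x \<in> W"
  then have pt: "x \<in> points M" using T.open_point[OF T.sections_open[OF X]] by blast
  then obtain c where c: "c \<in> atlas M" "x \<in> fst c" using chart_at by metis
  show "vf_bracket M X Y x \<in> tangent_space M x"
    unfolding vf_bracket_coord[OF X Y x c(2,1)] using c
    by (intro subspace_sum subspace_scale subspace_tangent_space pt coord_vector_tangent) auto
next
  fix c i assume c: "c \<in> atlas M" and i: "i < man_dim M"
  have op: "openin (man_top M) (fst c \<inter> W)" using c T.sections_open[OF X] by blast
  note X' = T.sections_subset[OF X Int_lower2 op] and Y' = T.sections_subset[OF Y Int_lower2 op]
  have "smooth_fun M (fst c \<inter> W) (\<lambda>x. X x (\<lambda>y. Y y (\<lambda>y. snd c y i)) - Y x (\<lambda>y. X y (\<lambda>y. snd c y i)))"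
    by (intro smooth_fun_diff vector_field_apply_smooth[OF X'] vector_field_apply_smooth[OF Y']
      vector_field_coord_smooth[OF X c i] vector_field_coord_smooth[OF Y c i])
  then show "smooth_fun M (fst c \<inter> W) (\<lambda>x. vf_bracket M X Y x (\<lambda>y. snd c y i))"
    by (rule smooth_fun_transfer) (use smooth_nearI[OF smooth_fun_coord[OF c i]] in \<open>auto simp: vf_bracket_def\<close>)
qed

lemma vector_field_apply_near:
  assumes "V \<in> vector_fields M W" "x \<in> W" "smooth_near M x f"
  shows "smooth_near M x (\<lambda>y. V y f)"
proof -
  obtain W' where W': "x \<in> W'" "smooth_fun M W' f" using assms(3) by (auto simp: smooth_near_def)
  have op: "openin (man_top M) (W \<inter> W')"
    using T.sections_open[OF assms(1)] smooth_fun_open[OF W'(2)] by (rule openin_Int)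
  have "smooth_fun M (W \<inter> W') (\<lambda>y. V y f)"
    by (rule vector_field_apply_smooth[OF T.sections_subset[OF assms(1) Int_lower1 op]
      smooth_fun_subset[OF W'(2) Int_lower2 op]])
  then show ?thesis using assms(2) W'(1) by (auto intro: smooth_nearI)
qed

lemma vf_bracket_scale:
  assumes Z: "Z \<in> vector_fields M W" and Y: "Y \<in> vector_fields M W" and g: "smooth_fun M W g" and x: "x \<in> W"
  shows "vf_bracket M (\<lambda>y. g y *\<^sub>R Z y) Y x = g x *\<^sub>R vf_bracket M Z Y x - Y x g *\<^sub>R Z x"
proof
  fix f
  show "vf_bracket M (\<lambda>y. g y *\<^sub>R Z y) Y x f = (g x *\<^sub>R vf_bracket M Z Y x - Y x g *\<^sub>R Z x) f"
  proof (cases "smooth_near M x f")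
    case True
    then have "Y x (\<lambda>y. g y * Z y f) = Y x g * Z x f + g x * Y x (\<lambda>y. Z y f)"
      using vector_field_apply_near[OF Z x True]
      by (intro tangent_vector_mult[OF vector_fields_tangent[OF Y x]] smooth_nearI[OF g x])
    with True show ?thesis by (simp add: vf_bracket_def scaleR_fun_def algebra_simps)
  next
    case False
    then show ?thesis
      using tangent_vector_not_smooth[OF vector_fields_tangent[OF Z x]] by (simp add: vf_bracket_def scaleR_fun_def)
  qed
qed

lemma vf_bracket_add:
  assumes Z: "Z \<in> vector_fields M W" and Z': "Z' \<in> vector_fields M W" and Y: "Y \<in> vector_fields M W" and x: "x \<in> W"
  shows "vf_bracket M (\<lambda>y. Z y + Z' y) Y x = vf_bracket M Z Y x + vf_bracket M Z' Y x"
proof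
  fix f
  show "vf_bracket M (\<lambda>y. Z y + Z' y) Y x f = (vf_bracket M Z Y x + vf_bracket M Z' Y x) f"
  proof (cases "smooth_near M x f")
    case True
    then have "Y x (\<lambda>y. Z y f + Z' y f) = Y x (\<lambda>y. Z y f) + Y x (\<lambda>y. Z' y f)"
      by (intro tangent_vector_add[OF vector_fields_tangent[OF Y x]] vector_field_apply_near[OF Z x]
        vector_field_apply_near[OF Z' x])
    with True show ?thesis by (simp add: vf_bracket_def)
  qed (simp add: vf_bracket_def)
qed

text \<open>\<open>Y x\<close> is applied to functions that agree only on \<open>W\<close>; being a
  tangent vector, it does not see the difference.\<close>

lemma vf_bracket_cong:
  assumes "openin (man_top M) W" "x \<in> W" "\<And>y. y \<in> W \<Longrightarrow> Z y = Z' y" "Y x \<in> tangent_space M x"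
  shows "vf_bracket M Z Y x = vf_bracket M Z' Y x"
proof
  fix f
  have "Y x (\<lambda>y. Z y f) = Y x (\<lambda>y. Z' y f)"
    by (rule tangent_vector_cong[OF assms(4,1,2)]) (simp add: assms(3))
  then show "vf_bracket M Z Y x f = vf_bracket M Z' Y x f"
    using assms(2,3) by (simp add: vf_bracket_def)
qed

section \<open>Volume forms and their Lie derivatives\<close>

lemma volume_form_smooth:
  assumes "volume_form M U \<mu>" "openin (man_top M) W" "W \<subseteq> U" "length Ys = man_dim M" "set Ys \<subseteq> vector_fields M W"
  shows "smooth_fun M W (\<lambda>y. \<mu> y (map (\<lambda>Y. Y y) Ys))"
proof -
  have "\<forall>W Ys. W \<subseteq> U \<and> openin (man_top M) W \<and> length Ys = man_dim M \<and> set Ys \<subseteq> vector_fields M W \<longrightarrow>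
      smooth_fun M W (\<lambda>x. \<mu> x (map (\<lambda>Y. Y x) Ys))"
    using assms(1) by (simp add: volume_form_def)
  then show ?thesis using assms by simp
qed

context
  fixes U \<mu> W and Ys :: "('x \<Rightarrow> 'x tvec) list"
  assumes \<mu>: "volume_form M U \<mu>" and W: "openin (man_top M) W" "W \<subseteq> U"
    and Ys: "length Ys = man_dim M" "set Ys \<subseteq> vector_fields M W"
begin

abbreviation "values x \<equiv> map (\<lambda>Y. Y x) Ys"

lemma Ys_field: "i < man_dim M \<Longrightarrow> Ys ! i \<in> vector_fields M W"
  using Ys by (metis nth_mem subsetD)

lemma values_update:
  assumes "x \<in> W" "i < man_dim M" "v \<in> tangent_space M x"
  shows "length ((values x)[i := v]) = man_dim M \<and> set ((values x)[i := v]) \<subseteq> tangent_space M x"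
proof -
  have "set (values x) \<subseteq> tangent_space M x"
    using Ys assms(1) vector_fields_tangent by auto
  then have "set ((values x)[i := v]) \<subseteq> tangent_space M x"
    using assms(3) set_update_subset_insert[of "values x" i v] by blast
  then show ?thesis using Ys(1) by simp
qed

lemma volume_linear:
  assumes "x \<in> W" "i < man_dim M"
  shows "linear_between (tangent_space M x) UNIV (\<lambda>v. \<mu> x ((values x)[i := v]))"
proof -
  have "length (values x) = man_dim M \<and> set (values x) \<subseteq> tangent_space M x"
    using Ys assms(1) vector_fields_tangent by auto
  then show ?thesis using \<mu> assms W(2) unfolding volume_form_def by blast
qed

lemma volume_alternating:
  assumes "x \<in> W" "i < man_dim M" "j < man_dim M" "i \<noteq> j"
  shows "\<mu> x ((values x)[i := values x ! j]) = 0"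
proof -
  have *: "\<mu> x vs = 0" if "length vs = man_dim M \<and> set vs \<subseteq> tangent_space M x" "vs ! i = vs ! j" for vs
    using \<mu> that assms W(2) unfolding volume_form_def by blast
  have "values x ! j \<in> tangent_space M x"
    using Ys assms(1,3) vector_fields_tangent[OF Ys_field] by auto
  then show ?thesis
    using assms Ys(1) by (intro * values_update) auto
qed

text \<open>Cramer's rule: every term with \<open>k \<noteq> i\<close> repeats one of the other
  vectors and is killed by the alternating form.\<close>

lemma volume_update_lincomb:
  assumes x: "x \<in> W" and i: "i < man_dim M"
  shows "\<mu> x ((values x)[i := (\<Sum>k<man_dim M. a k *\<^sub>R (Ys ! k) x)]) = a i * \<mu> x (values x)"
proof -
  have pt: "x \<in> points M" using T.open_point W(1) x by blast
  have "\<mu> x ((values x)[i := (\<Sum>k<man_dim M. a k *\<^sub>R (Ys ! k) x)]) =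
      (\<Sum>k<man_dim M. a k *\<^sub>R \<mu> x ((values x)[i := (Ys ! k) x]))"
    by (rule linear_between_sum[OF volume_linear[OF x i] subspace_tangent_space[OF pt]])
      (use vector_fields_tangent[OF Ys_field x] in auto)
  also have "\<dots> = (\<Sum>k<man_dim M. if k = i then a i * \<mu> x (values x) else 0)"
  proof (rule sum.cong[OF refl])
    fix k assume k: "k \<in> {..<man_dim M}"
    then show "a k *\<^sub>R \<mu> x ((values x)[i := (Ys ! k) x]) = (if k = i then a i * \<mu> x (values x) else 0)"
      using volume_alternating[OF x i, of k] Ys(1) i list_update_id[of "values x" i]
      by (cases "k = i") auto
  qed
  finally show ?thesis using i by simp
qed

text \<open>By Cramer's rule, vectors of nonzero volume are independent; there are
  \<open>man_dim M\<close> of them, and the tangent space is spanned by as many coordinate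
  vectors.\<close>

lemma volume_basis:
  assumes x: "x \<in> W" and nz: "\<mu> x (values x) \<noteq> 0" and v: "v \<in> tangent_space M x"
  obtains a where "v = (\<Sum>k<man_dim M. a k *\<^sub>R (Ys ! k) x)"
proof -
  let ?n = "man_dim M" and ?e = "\<lambda>k. (Ys ! k) x"
  have pt: "x \<in> points M" using T.open_point W(1) x by blast
  obtain c where c: "c \<in> atlas M" "x \<in> fst c" using chart_at pt by metis
  have "a i = 0" if "(\<Sum>k<?n. a k *\<^sub>R ?e k) = 0" "i < ?n" for a i
  proof -
    have "a i * \<mu> x (values x) = \<mu> x ((values x)[i := 0])"
      using volume_update_lincomb[OF x that(2), of a] that(1) by simp
    also have "\<dots> = 0"
      using linear_between_zero[OF volume_linear[OF x that(2)] v] by simp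
    finally show ?thesis using nz by simp
  qed
  then have ind: "inj_on ?e {..<?n}" "independent (?e ` {..<?n})"
    using independent_indexed_iff[of ?e ?n] by auto
  have "v \<in> span (?e ` {..<?n})"
  proof (rule ccontr)
    assume v': "v \<notin> span (?e ` {..<?n})"
    then have "independent (insert v (?e ` {..<?n}))"
      using ind(2) by (simp add: independent_insert span_base)
    moreover have "insert v (?e ` {..<?n}) \<subseteq> span ((\<lambda>i. coord_vector M c i x) ` {..<?n})"
      unfolding tangent_space_span[OF c, symmetric] using v vector_fields_tangent[OF Ys_field x] by auto
    ultimately have "card (insert v (?e ` {..<?n})) \<le> card ((\<lambda>i. coord_vector M c i x) ` {..<?n})"
      using independent_span_bound[of "(\<lambda>i. coord_vector M c i x) ` {..<?n}"] by blast
    also have "\<dots> \<le> ?n" using card_image_le[of "{..<?n}"] by simp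
    moreover have "v \<notin> ?e ` {..<?n}" using v' span_base[of v "?e ` {..<?n}"] by argo
    ultimately show False using card_image[OF ind(1)] by simp
  qed
  then show ?thesis using that unfolding span_indexed by auto
qed

lemma lie_derivative_field:
  assumes "x \<in> W"
  shows "lie_derivative_form M Z \<mu> Ys x = Z x (\<lambda>y. \<mu> y (values y)) -
    (\<Sum>i<man_dim M. \<mu> x ((values x)[i := vf_bracket M Z (Ys ! i) x]))"
  by (simp add: lie_derivative_form_def Ys(1))

lemma lie_derivative_smooth:
  assumes Z: "Z \<in> vector_fields M W"
  shows "smooth_fun M W (lie_derivative_form M Z \<mu> Ys)"
proof -
  have "smooth_fun M W (\<lambda>x. \<mu> x ((values x)[i := vf_bracket M Z (Ys ! i) x]))" if "i < man_dim M" for i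
  proof -
    \<comment> \<open>Replacing one field of the frame by a bracket gives another list of vector
      fields, to which the smoothness clause of \<open>volume_form\<close> applies.\<close>
    have "set (Ys[i := vf_bracket M Z (Ys ! i)]) \<subseteq> vector_fields M W"
      using Ys(2) vf_bracket_vector_field[OF Z Ys_field[OF that]] set_update_subset_insert by fastforce
    then have "smooth_fun M W (\<lambda>x. \<mu> x (map (\<lambda>Y. Y x) (Ys[i := vf_bracket M Z (Ys ! i)])))"
      using volume_form_smooth[OF \<mu> W, of "Ys[i := vf_bracket M Z (Ys ! i)]"] Ys(1) by simp
    then show ?thesis by (simp add: map_update)
  qed
  then have "smooth_fun M W (\<lambda>x. Z x (\<lambda>y. \<mu> y (values y)) -
      (\<Sum>i<man_dim M. \<mu> x ((values x)[i := vf_bracket M Z (Ys ! i) x])))"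
    by (intro smooth_fun_diff smooth_fun_sum vector_field_apply_smooth[OF Z]
      volume_form_smooth[OF \<mu> W Ys] W(1)) auto
  then show ?thesis by (rule smooth_fun_transfer) (simp add: lie_derivative_field)
qed

lemma lie_derivative_cong:
  assumes x: "x \<in> W" and eq: "\<And>y. y \<in> W \<Longrightarrow> Z y = Z' y"
  shows "lie_derivative_form M Z \<mu> Ys x = lie_derivative_form M Z' \<mu> Ys x"
proof -
  have "vf_bracket M Z (Ys ! i) x = vf_bracket M Z' (Ys ! i) x" if "i < man_dim M" for i
    by (rule vf_bracket_cong[OF W(1) x], erule eq, rule vector_fields_tangent[OF Ys_field[OF that] x])
  then show ?thesis using eq[OF x] by (simp add: lie_derivative_field[OF x])
qed

lemma lie_derivative_add:
  assumes x: "x \<in> W" and Z: "Z \<in> vector_fields M W" "Z' \<in> vector_fields M W"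
  shows "lie_derivative_form M (\<lambda>y. Z y + Z' y) \<mu> Ys x =
    lie_derivative_form M Z \<mu> Ys x + lie_derivative_form M Z' \<mu> Ys x"
proof -
  have "\<mu> x ((values x)[i := vf_bracket M (\<lambda>y. Z y + Z' y) (Ys ! i) x]) =
      \<mu> x ((values x)[i := vf_bracket M Z (Ys ! i) x]) + \<mu> x ((values x)[i := vf_bracket M Z' (Ys ! i) x])"
    if i: "i < man_dim M" for i
    unfolding vf_bracket_add[OF Z Ys_field[OF i] x]
    by (intro linear_between_add[OF volume_linear[OF x i]] vector_fields_tangent[OF _ x]
      vf_bracket_vector_field Z Ys_field i)
  then show ?thesis by (simp add: lie_derivative_field[OF x] sum.distrib)
qed

text \<open>Multiplied by the volume, this is div(gZ) = g div Z + Z g. The bracket of gZ with the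
  \<open>i\<close>-th frame field Y_i contains - (Y_i g) Z; by Cramer's rule the form picks the
  coefficient a_i of Z from it, and the sum of the terms a_i (Y_i g) is Z g. The coefficients exist
  because the frame has nonzero volume.\<close>

lemma lie_derivative_scale:
  assumes x: "x \<in> W" and Z: "Z \<in> vector_fields M W" and g: "smooth_fun M W g" and nz: "\<mu> x (values x) \<noteq> 0"
  shows "lie_derivative_form M (\<lambda>y. g y *\<^sub>R Z y) \<mu> Ys x =
    g x * lie_derivative_form M Z \<mu> Ys x + Z x g * \<mu> x (values x)"
proof -
  obtain a where a: "Z x = (\<Sum>k<man_dim M. a k *\<^sub>R (Ys ! k) x)"
    using volume_basis[OF x nz vector_fields_tangent[OF Z x]] by metis
  have "\<mu> x ((values x)[i := vf_bracket M (\<lambda>y. g y *\<^sub>R Z y) (Ys ! i) x]) =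
      g x * \<mu> x ((values x)[i := vf_bracket M Z (Ys ! i) x]) - (Ys ! i) x g * (a i * \<mu> x (values x))"
    if i: "i < man_dim M" for i
  proof -
    have eq: "vf_bracket M (\<lambda>y. g y *\<^sub>R Z y) (Ys ! i) x = g x *\<^sub>R vf_bracket M Z (Ys ! i) x + (- (Ys ! i) x g) *\<^sub>R Z x"
      using vf_bracket_scale[OF Z Ys_field[OF i] g x] by simp
    have mem: "vf_bracket M Z (Ys ! i) x \<in> tangent_space M x" "Z x \<in> tangent_space M x"
      using vector_fields_tangent[OF vf_bracket_vector_field[OF Z Ys_field[OF i]] x]
        vector_fields_tangent[OF Z x] by auto
    have "\<mu> x ((values x)[i := vf_bracket M (\<lambda>y. g y *\<^sub>R Z y) (Ys ! i) x]) =
        g x *\<^sub>R \<mu> x ((values x)[i := vf_bracket M Z (Ys ! i) x]) + (- (Ys ! i) x g) *\<^sub>R \<mu> x ((values x)[i := Z x])"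
      unfolding eq using volume_linear[OF x i] mem unfolding linear_between_def by blast
    then show ?thesis using volume_update_lincomb[OF x i, of a] a by simp
  qed
  moreover have "(\<Sum>i<man_dim M. (Ys ! i) x g * (a i * \<mu> x (values x))) = Z x g * \<mu> x (values x)"
    unfolding a sum_fun_apply scaleR_fun_def sum_distrib_right by (rule sum.cong) auto
  ultimately show ?thesis
    by (simp add: lie_derivative_field[OF x] sum_subtractf right_diff_distrib sum_distrib_left scaleR_fun_def)
qed

lemma lie_derivative_lincomb:
  assumes x: "x \<in> W" and nz: "\<mu> x (values x) \<noteq> 0"
    and Z: "\<And>j. j \<in> J \<Longrightarrow> Z j \<in> vector_fields M W" and g: "\<And>j. j \<in> J \<Longrightarrow> smooth_fun M W (g j)"
  shows "lie_derivative_form M (\<lambda>y. \<Sum>j\<in>J. g j y *\<^sub>R Z j y) \<mu> Ys x =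
    (\<Sum>j\<in>J. g j x * lie_derivative_form M (Z j) \<mu> Ys x + Z j x (g j) * \<mu> x (values x))"
  using Z g
proof (induction J rule: infinite_finite_induct)
  case (insert j J)
  have "(\<lambda>y. g j y *\<^sub>R Z j y) \<in> vector_fields M W" "(\<lambda>y. \<Sum>j\<in>J. g j y *\<^sub>R Z j y) \<in> vector_fields M W"
    using insert.prems by (auto intro!: T.sections_scale T.sections_sum W(1))
  from lie_derivative_add[OF x this]
  have "lie_derivative_form M (\<lambda>y. \<Sum>j\<in>insert j J. g j y *\<^sub>R Z j y) \<mu> Ys x =
      lie_derivative_form M (\<lambda>y. g j y *\<^sub>R Z j y) \<mu> Ys x + lie_derivative_form M (\<lambda>y. \<Sum>j\<in>J. g j y *\<^sub>R Z j y) \<mu> Ys x"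
    using insert.hyps by simp
  also have "lie_derivative_form M (\<lambda>y. g j y *\<^sub>R Z j y) \<mu> Ys x =
      g j x * lie_derivative_form M (Z j) \<mu> Ys x + Z j x (g j) * \<mu> x (values x)"
    using insert.prems by (intro lie_derivative_scale[OF x _ _ nz]) auto
  also have "lie_derivative_form M (\<lambda>y. \<Sum>j\<in>J. g j y *\<^sub>R Z j y) \<mu> Ys x =
      (\<Sum>j\<in>J. g j x * lie_derivative_form M (Z j) \<mu> Ys x + Z j x (g j) * \<mu> x (values x))"
    using insert.prems by (intro insert.IH) auto
  finally show ?case using insert.hyps by simp
next
  case empty
  \<comment> \<open>The empty sum is written as \<open>0 *\<^sub>R 0\<close>, so that the scaling
    rule with a vanishing coefficient applies.\<close>
  have "lie_derivative_form M (\<lambda>y. 0 *\<^sub>R 0) \<mu> Ys x = 0"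
    using lie_derivative_scale[OF x T.sections_zero[OF W(1)] smooth_fun_const[OF W(1), of 0] nz] by simp
  then show ?case by (simp add: zero_fun_def)
next
  case (infinite J)
  have "lie_derivative_form M (\<lambda>y. 0 *\<^sub>R 0) \<mu> Ys x = 0"
    using lie_derivative_scale[OF x T.sections_zero[OF W(1)] smooth_fun_const[OF W(1), of 0] nz] by simp
  with infinite show ?case by (simp add: zero_fun_def)
qed

end

text \<open>The form is nonzero on some vectors at \<open>x0\<close>; once these are extended to
  fields, its value on them is a smooth function and stays nonzero nearby.\<close>

lemma volume_frame:
  assumes \<mu>: "volume_form M U \<mu>" and x0: "x0 \<in> U"
  obtains W Ys where "openin (man_top M) W" "x0 \<in> W" "W \<subseteq> U" "length Ys = man_dim M" "set Ys \<subseteq> vector_fields M W"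
    "\<And>x. x \<in> W \<Longrightarrow> \<mu> x (map (\<lambda>Y. Y x) Ys) \<noteq> 0"
proof -
  have U: "openin (man_top M) U" using \<mu> by (simp add: volume_form_def)
  obtain c where c: "c \<in> atlas M" "x0 \<in> fst c" using chart_at T.open_point[OF U x0] by metis
  obtain vs where vs: "length vs = man_dim M" "set vs \<subseteq> tangent_space M x0" "\<mu> x0 vs \<noteq> 0"
    using \<mu> x0 unfolding volume_form_def by blast
  \<comment> \<open>Keeping the coefficients in the chart constant extends each tangent vector at
    \<open>x0\<close> to a field on the chart domain.\<close>
  define Ys where "Ys = map (\<lambda>v y. \<Sum>i<man_dim M. v (\<lambda>y. snd c y i) *\<^sub>R coord_vector M c i y) vs"
  define N where "N = fst c \<inter> U"
  have N: "openin (man_top M) N" "x0 \<in> N" "N \<subseteq> U" using c U x0 by (auto simp: N_def)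
  have coord: "coord_vector M c i \<in> vector_fields M N" if "i < man_dim M" for i
    using T.frame_section[of "fst c" "coord_vector M c" i] c(1) that N(1)
    by (auto intro!: T.sections_subset[of _ "fst c"] simp: N_def)
  have Ys: "set Ys \<subseteq> vector_fields M N"
    using coord N(1) by (auto simp: Ys_def intro!: T.sections_sum T.sections_scale smooth_fun_const)
  have len: "length Ys = man_dim M" by (simp add: Ys_def vs(1))
  have "map (\<lambda>Y. Y x0) Ys = map (\<lambda>v. v) vs"
    unfolding Ys_def map_map
    by (rule map_cong[OF refl]) (use vs(2) tangent_vector_expand[OF _ c] in auto)
  then have nz: "\<mu> x0 (map (\<lambda>Y. Y x0) Ys) \<noteq> 0" using vs(3) by simp
  define W where "W = {x \<in> N. \<mu> x (map (\<lambda>Y. Y x) Ys) \<in> - {0}}"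
  have W: "openin (man_top M) W"
    unfolding W_def by (rule openin_smooth_fun_preimage[OF volume_form_smooth[OF \<mu> N(1,3) len Ys]]) auto
  have "W \<subseteq> N" by (auto simp: W_def)
  then have "set Ys \<subseteq> vector_fields M W"
    using Ys T.sections_subset[OF _ _ W] by blast
  then show ?thesis
    using that[OF W, of Ys] len N nz unfolding W_def by blast
qed

section \<open>Global test functions\<close>

lemma global_coordinate:
  assumes c: "c \<in> atlas M" and x: "x \<in> fst c" and i: "i < man_dim M"
  obtains f N where "smooth_fun M (points M) f" "openin (man_top M) N" "x \<in> N" "\<And>y. y \<in> N \<Longrightarrow> f y = snd c y i"
proof -
  obtain h V K where h: "smooth_fun M (points M) h" and V: "openin (man_top M) V" "x \<in> V" "\<And>x. x \<in> V \<Longrightarrow> h x = 1" "V \<subseteq> fst c"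
    and K: "closedin (man_top M) K" "K \<subseteq> fst c" "\<And>x. x \<in> points M - K \<Longrightarrow> h x = 0"
    using bump_function[OF chart_domain_open[OF c] x] by metis
  define f where "f y = (if y \<in> fst c then h y * snd c y i else 0)" for y
  have "smooth_fun M (points M) f"
  proof (rule smooth_fun_local)
    fix y assume y: "y \<in> points M"
    have "smooth_fun M (fst c) (\<lambda>y. h y * snd c y i)"
      using chart_domain_open[OF c] openin_subset
      by (intro smooth_fun_mult smooth_fun_coord c i smooth_fun_subset[OF h]) auto
    then have "smooth_fun M (fst c) f" by (rule smooth_fun_transfer) (simp add: f_def)
    moreover have "smooth_fun M (points M - K) f"
      by (rule smooth_fun_transfer[OF smooth_fun_const[of _ 0]]) (use K in \<open>auto simp: f_def\<close>)
    ultimately show "\<exists>W'. y \<in> W' \<and> smooth_fun M W' f" using y K(2) by blast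
  qed simp
  moreover have "f y = snd c y i" if "y \<in> V" for y
    using V that by (auto simp: f_def)
  ultimately show ?thesis using that[of f V] V by blast
qed

text \<open>Coordinate functions live on a chart domain only, whereas the identity that defines the
  modular field over \<open>U\<close> is tested on functions smooth on all of \<open>U\<close>. Near
  the point, cut-off coordinates are as good as coordinates.\<close>

lemma tangent_vector_eq_on_global:
  assumes u: "u \<in> tangent_space M x" and v: "v \<in> tangent_space M x"
    and eq: "\<And>f. smooth_fun M (points M) f \<Longrightarrow> u f = v f"
  shows "u = v"
proof -
  obtain c where c: "c \<in> atlas M" "x \<in> fst c" using chart_at tangent_vector_points[OF u] by metis
  show ?thesis
  proof (rule tangent_vector_eqI[OF u v c])
    fix i assume i: "i < man_dim M"
    obtain f N where f: "smooth_fun M (points M) f" "openin (man_top M) N" "x \<in> N" "\<And>y. y \<in> N \<Longrightarrow> f y = snd c y i"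
      using global_coordinate[OF c i] by metis
    show "u (\<lambda>y. snd c y i) = v (\<lambda>y. snd c y i)"
      using tangent_vector_cong[OF u f(2,3,4)] tangent_vector_cong[OF v f(2,3,4)] eq[OF f(1)] by simp
  qed
qed

end

section \<open>The anchor image and the modular foliation\<close>

locale algebroid_charts = manifold_charts M
  for M :: "'x manifold" +
  fixes A :: "('x, 'v::real_vector) algebroid"
  assumes lie_algebroid: "lie_algebroid M A"

sublocale algebroid_charts \<subseteq> smooth_bundle M A
  using lie_algebroid by unfold_locales (simp add: lie_algebroid_def)

context algebroid_charts
begin

section \<open>Algebraic properties of the anchor\<close>

lemma anchor_linear: "x \<in> points M \<Longrightarrow> linear_between (fibre A x) (tangent_space M x) (anchor A x)"
  using lie_algebroid by (simp add: lie_algebroid_def)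

lemma anchor_tangent: "x \<in> points M \<Longrightarrow> a \<in> fibre A x \<Longrightarrow> anchor A x a \<in> tangent_space M x"
  using anchor_linear by (auto simp: linear_between_def)

lemma anchor_sum:
  "x \<in> points M \<Longrightarrow> (\<And>i. i \<in> I \<Longrightarrow> u i \<in> fibre A x) \<Longrightarrow>
    anchor A x (\<Sum>i\<in>I. a i *\<^sub>R u i) = (\<Sum>i\<in>I. a i *\<^sub>R anchor A x (u i))"
  using linear_between_sum[OF anchor_linear subspace_fibre] by blast

lemma anchor_diff:
  assumes "x \<in> points M" "u \<in> fibre A x" "v \<in> fibre A x"
  shows "anchor A x (a *\<^sub>R u - b *\<^sub>R v) = a *\<^sub>R anchor A x u - b *\<^sub>R anchor A x v"
proof -
  have "anchor A x (a *\<^sub>R u + (- b) *\<^sub>R v) = a *\<^sub>R anchor A x u + (- b) *\<^sub>R anchor A x v"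
    using anchor_linear[OF assms(1)] assms(2,3) unfolding linear_between_def by blast
  then show ?thesis by simp
qed

lemma anchor_field: "s \<in> sections M A W \<Longrightarrow> (\<lambda>x. anchor A x (s x)) \<in> vector_fields M W"
  using lie_algebroid by (simp add: lie_algebroid_def)

lemma bracket_section:
  "s \<in> sections M A (points M) \<Longrightarrow> t \<in> sections M A (points M) \<Longrightarrow> bracket A s t \<in> sections M A (points M)"
  using lie_algebroid by (simp add: lie_algebroid_def)

lemma anchor_bracket:
  assumes "s \<in> sections M A (points M)" "t \<in> sections M A (points M)" "x \<in> points M"
  shows "anchor A x (bracket A s t x) = vf_bracket M (\<lambda>y. anchor A y (s y)) (\<lambda>y. anchor A y (t y)) x"
  using lie_algebroid assms unfolding lie_algebroid_def by blast

lemma anchor_dual_dual: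
  assumes "x \<in> points M" "\<alpha> \<in> dual (tangent_space M x)"
  shows "anchor_dual A x \<alpha> \<in> dual (fibre A x)"
proof -
  have mem: "a *\<^sub>R u + b *\<^sub>R v \<in> fibre A x" if "u \<in> fibre A x" "v \<in> fibre A x" for a b u v
    using that by (intro subspace_add subspace_scale subspace_fibre assms(1))
  have "\<alpha> (anchor A x (a *\<^sub>R u + b *\<^sub>R v)) = a *\<^sub>R \<alpha> (anchor A x u) + b *\<^sub>R \<alpha> (anchor A x v)"
    if "u \<in> fibre A x" "v \<in> fibre A x" for a b u v
  proof -
    have "anchor A x (a *\<^sub>R u + b *\<^sub>R v) = a *\<^sub>R anchor A x u + b *\<^sub>R anchor A x v"
      using anchor_linear[OF assms(1)] that unfolding linear_between_def by blast
    then show ?thesis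
      using dual_linear[OF assms(2)] anchor_tangent[OF assms(1)] that unfolding linear_between_def by simp
  qed
  with mem show ?thesis by (auto simp: dual_def linear_between_def anchor_dual_def)
qed

lemma differential_dual:
  assumes "x \<in> points M" shows "differential M f x \<in> dual (tangent_space M x)"
proof -
  have "a *\<^sub>R u + b *\<^sub>R v \<in> tangent_space M x" if "u \<in> tangent_space M x" "v \<in> tangent_space M x" for a b u v
    using that by (intro subspace_add subspace_scale subspace_tangent_space assms)
  then show ?thesis by (auto simp: dual_def linear_between_def differential_def scaleR_fun_def)
qed

text \<open>Total weight in the gluing below; it equals 1 as soon as one \<open>h i\<close> is
  1.\<close>

lemma sum_prod_telescope:
  fixes h :: "nat \<Rightarrow> real"
  shows "(\<Sum>j<m. (\<Prod>i<j. 1 - h i) * h j) = 1 - (\<Prod>i<m. 1 - h i)"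
  by (induction m) (simp_all add: algebra_simps)

text \<open>
  The local sections are glued with the weights \<open>h\<^sub>j * \<Prod>\<^sub>i\<^sub><\<^sub>j (1 - h\<^sub>i)\<close>, where \<open>h\<^sub>j = 1\<close> on the member
  \<open>N\<^sub>j\<close> of a countable cover: all weights beyond \<open>k\<close> vanish on \<open>N\<^sub>k\<close>, so that no local finiteness
  of the cover is needed.
\<close>

lemma anchor_image_localI:
  assumes U: "openin (man_top M) U"
    and loc: "\<And>x. x \<in> U \<Longrightarrow> \<exists>W s. x \<in> W \<and> W \<subseteq> U \<and> s \<in> sections M A W \<and> (\<forall>y\<in>W. V y = anchor A y (s y))"
  shows "V \<in> anchor_image M A U"
proof (cases "U = {}")
  case True
  then show ?thesis using sections_zero[OF U] by (auto simp: anchor_image_def)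
next
  case False
  \<comment> \<open>\<open>S\<close> is a global section that lifts the cut-off field on all of
    \<open>U\<close>, also where the local preimage is undefined, because the cutoff vanishes
    there.\<close>
  define good where "good x h N S \<longleftrightarrow> smooth_fun M (points M) h \<and> openin (man_top M) N \<and> x \<in> N \<and> N \<subseteq> U \<and>
      (\<forall>y\<in>N. h y = 1) \<and> S \<in> sections M A (points M) \<and> (\<forall>y\<in>U. anchor A y (S y) = h y *\<^sub>R V y)" for x h N S
  have "\<forall>x\<in>U. \<exists>h N S. good x h N S"
  proof
    fix x assume x: "x \<in> U"
    obtain W s where W: "x \<in> W" "W \<subseteq> U" and s: "s \<in> sections M A W" and V: "\<forall>y\<in>W. V y = anchor A y (s y)"
      using loc[OF x] by blast
    obtain h N K where h: "smooth_fun M (points M) h" and N: "openin (man_top M) N" "x \<in> N" "\<And>y. y \<in> N \<Longrightarrow> h y = 1" "N \<subseteq> W"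
      and K: "closedin (man_top M) K" "K \<subseteq> W" "\<And>y. y \<in> points M - K \<Longrightarrow> h y = 0"
      using bump_function[OF sections_open[OF s] W(1)] by metis
    let ?S = "\<lambda>y. if y \<in> W then h y *\<^sub>R s y else 0"
    have "anchor A y (?S y) = h y *\<^sub>R V y" if y: "y \<in> U" for y
    proof (cases "y \<in> W")
      case True
      have pt: "y \<in> points M" using open_point[OF U y] .
      show ?thesis
        using linear_between_scale[OF anchor_linear[OF pt] sections_fibre[OF s True], of "h y"] True V by simp
    next
      case False
      have pt: "y \<in> points M" using open_point[OF U y] .
      have "h y = 0" using False K(2,3) pt by blast
      then show ?thesis
        using False linear_between_zero[OF anchor_linear[OF pt] subspace_0[OF subspace_fibre[OF pt]]] by simp
    qed
    then show "\<exists>h N S. good x h N S"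
      using h N W(2) sections_extend_by_zero[OF s h K] unfolding good_def
      by (intro exI[of _ h] exI[of _ N] exI[of _ ?S] conjI) auto
  qed
  from bchoice[OF this] obtain h where "\<forall>x\<in>U. \<exists>N S. good x (h x) N S" by blast
  from bchoice[OF this] obtain N where "\<forall>x\<in>U. \<exists>S. good x (h x) (N x) S" by blast
  from bchoice[OF this] obtain S where good: "\<forall>x\<in>U. good x (h x) (N x) (S x)" by blast
  have
    h: "\<And>x. x \<in> U \<Longrightarrow> smooth_fun M (points M) (h x)" and
    N: "\<And>x. x \<in> U \<Longrightarrow> openin (man_top M) (N x)" "\<And>x. x \<in> U \<Longrightarrow> x \<in> N x" "\<And>x. x \<in> U \<Longrightarrow> N x \<subseteq> U"
      "\<And>x y. x \<in> U \<Longrightarrow> y \<in> N x \<Longrightarrow> h x y = 1" and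
    S: "\<And>x. x \<in> U \<Longrightarrow> S x \<in> sections M A (points M)"
      "\<And>x y. x \<in> U \<Longrightarrow> y \<in> U \<Longrightarrow> anchor A y (S x y) = h x y *\<^sub>R V y"
    using good by (auto simp: good_def)
  have top: "topspace (subtopology (man_top M) U) = U" using openin_subset[OF U] by auto
  \<comment> \<open>Second countability of \<open>M\<close> is used here: it reduces the
    neighbourhoods to a countable cover, which the successive weights can follow.\<close>
  have "Lindelof_space (subtopology (man_top M) U)"
    using smooth_manifold unfolding smooth_manifold_def
    by (intro second_countable_imp_Lindelof_space second_countable_subtopology) auto
  moreover have "openin (subtopology (man_top M) U) W" if "W \<in> N ` U" for W
    using that N(1,3) U by (auto simp: openin_open_subtopology)
  moreover have "\<Union> (N ` U) = topspace (subtopology (man_top M) U)"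
    unfolding top using N(2,3) by blast
  ultimately obtain \<V> where \<V>: "countable \<V>" "\<V> \<subseteq> N ` U" "\<Union>\<V> = U"
    using Lindelof_spaceD[of "subtopology (man_top M) U" "N ` U"] top by auto
  then obtain C where C: "countable C" "C \<subseteq> U" "\<V> = N ` C"
    by (metis countable_subset_image)
  have "C \<noteq> {}" using \<V>(3) C(3) False by auto
  \<comment> \<open>The enumeration may repeat elements, so a finite \<open>C\<close> is covered
    too; a nonempty \<open>C\<close> is required, which explains the separate treatment of an empty
    \<open>U\<close>.\<close>
  define p where "p = from_nat_into C"
  have p: "p k \<in> U" for k using from_nat_into[OF \<open>C \<noteq> {}\<close>] C(2) by (auto simp: p_def)
  have cover: "\<exists>k. y \<in> N (p k)" if "y \<in> U" for y
  proof -
    obtain x where "x \<in> C" "y \<in> N x" using \<V>(3) C(3) \<open>y \<in> U\<close> by blast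
    then show ?thesis using from_nat_into_surj[OF C(1)] unfolding p_def by metis
  qed
  define d where "d j y = (\<Prod>i<j. 1 - h (p i) y)" for j y
  define T where "T m y = (\<Sum>j<m. d j y *\<^sub>R S (p j) y)" for m y
  \<comment> \<open>Any \<open>k\<close> with \<open>y\<close> in \<open>N (p k)\<close> gives the
    same value, by \<open>T_stable\<close>; the least one is merely a definite choice. Near a point,
    \<open>s\<close> is thus one fixed finite sum of smooth sections.\<close>
  define s where "s y = T (Suc (LEAST k. y \<in> N (p k))) y" for y
  have d0: "d j y = 0" if "y \<in> N (p k)" "k < j" for j k y
    using N(4)[OF p that(1)] that(2) by (auto simp: d_def)
  have T_stable: "T m y = T (Suc k) y" if "y \<in> N (p k)" "k < m" for m k y
    unfolding T_def using d0[OF that(1)] that(2) by (intro sum.mono_neutral_right) auto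
  have s: "s y = T (Suc k) y" if "y \<in> N (p k)" for y k
  proof -
    have "y \<in> N (p (LEAST k. y \<in> N (p k)))" "(LEAST k. y \<in> N (p k)) \<le> k"
      using that by (auto intro: LeastI Least_le)
    then show ?thesis unfolding s_def by (intro T_stable[symmetric]) auto
  qed
  have "smooth_fun M (points M) (d j)" for j
    unfolding d_def using h p
    by (intro smooth_fun_prod smooth_fun_diff smooth_fun_const) auto
  then have T: "T m \<in> sections M A (points M)" for m
    unfolding T_def using S(1) p by (intro sections_sum sections_scale) auto
  have "s \<in> sections M A U"
  proof (rule sections_local[OF U])
    fix y assume "y \<in> U"
    then obtain k where k: "y \<in> N (p k)" using cover by blast
    have "T (Suc k) \<in> sections M A (N (p k))"
      by (rule sections_subset[OF T openin_subset[OF N(1)[OF p]] N(1)[OF p]])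
    then have "s \<in> sections M A (N (p k))"
      by (rule sections_cong) (simp add: s)
    then show "\<exists>W'. y \<in> W' \<and> s \<in> sections M A W'" using k by blast
  qed
  moreover have "V y = anchor A y (s y)" if y: "y \<in> U" for y
  proof -
    obtain k where k: "y \<in> N (p k)" using cover y by blast
    have pt: "y \<in> points M" using open_point[OF U y] .
    have "anchor A y (s y) = (\<Sum>j<Suc k. d j y *\<^sub>R anchor A y (S (p j) y))"
      unfolding s[OF k] T_def using sections_fibre[OF S(1)[OF p] pt] by (intro anchor_sum pt) auto
    also have "\<dots> = (\<Sum>j<Suc k. (\<Prod>i<j. 1 - h (p i) y) * h (p j) y) *\<^sub>R V y"
      unfolding scaleR_sum_left using S(2)[OF p y] by (intro sum.cong) (auto simp: d_def)
    also have "\<dots> = (1 - d (Suc k) y) *\<^sub>R V y"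
      unfolding sum_prod_telescope d_def ..
    \<comment> \<open>The remaining defect \<open>d (Suc k) y\<close> contains the factor
      \<open>1 - h (p k) y\<close>, which is 0.\<close>
    finally show ?thesis using d0[OF k, of "Suc k"] by simp
  qed
  ultimately show ?thesis unfolding anchor_image_def by blast
qed

lemma anchor_image_vector_fields:
  assumes "openin (man_top M) U" shows "anchor_image M A U \<subseteq> vector_fields M U"
proof
  fix V assume "V \<in> anchor_image M A U"
  then obtain s where s: "s \<in> sections M A U" "\<forall>x\<in>U. V x = anchor A x (s x)" by (auto simp: anchor_image_def)
  show "V \<in> vector_fields M U"
    by (rule T.sections_cong[OF anchor_field[OF s(1)]]) (use s(2) in simp)
qed

section \<open>Lifting Hamiltonian and modular vector fields through the anchor\<close>

context
  fixes \<pi> :: "'x \<Rightarrow> 'x tvec bivec" and P :: "'x \<Rightarrow> 'v bivec"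
  assumes P: "bivector_field M A P"
    and \<pi>: "\<And>x \<alpha>. x \<in> points M \<Longrightarrow> \<alpha> \<in> dual (tangent_space M x) \<Longrightarrow>
      sharp (tangent_algebroid M) \<pi> x \<alpha> = anchor A x (sharp A P x (anchor_dual A x \<alpha>))"
begin

lemma sharp_anchor_image:
  assumes "x \<in> points M"
  shows "sharp (tangent_algebroid M) \<pi> x ` dual (tangent_space M x) \<subseteq> anchor A x ` fibre A x"
  using \<pi>[OF assms] sharp_fibre[OF P assms anchor_dual_dual[OF assms]] by auto

lemma hamiltonian_decomposition:
  assumes x0: "x0 \<in> points M"
  obtains W s t where "openin (man_top M) W" "x0 \<in> W"
    "\<And>j. j < bundle_rank A \<Longrightarrow> s j \<in> sections M A (points M)"
    "\<And>j. j < bundle_rank A \<Longrightarrow> t j \<in> sections M A (points M)"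
    "\<And>x f. x \<in> W \<Longrightarrow> hamiltonian M \<pi> f x = anchor A x
      (\<Sum>j<bundle_rank A. anchor A x (s j x) f *\<^sub>R t j x - anchor A x (t j x) f *\<^sub>R s j x)"
proof -
  obtain W s t where W: "openin (man_top M) W" "x0 \<in> W" and
    s: "\<And>j. j < bundle_rank A \<Longrightarrow> s j \<in> sections M A (points M)" and
    t: "\<And>j. j < bundle_rank A \<Longrightarrow> t j \<in> sections M A (points M)" and
    sh: "\<And>x \<alpha>. x \<in> W \<Longrightarrow> \<alpha> \<in> dual (fibre A x) \<Longrightarrow>
      sharp A P x \<alpha> = (\<Sum>j<bundle_rank A. \<alpha> (s j x) *\<^sub>R t j x - \<alpha> (t j x) *\<^sub>R s j x)"
    apply (rule sharp_decomposition[OF P x0])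
    subgoal for W s t by (rule that[of W s t]) simp_all
    done
  have ham: "hamiltonian M \<pi> f x = anchor A x
      (\<Sum>j<bundle_rank A. anchor A x (s j x) f *\<^sub>R t j x - anchor A x (t j x) f *\<^sub>R s j x)" if x: "x \<in> W" for x f
  proof -
    have pt: "x \<in> points M" using open_point[OF W(1) x] .
    \<comment> \<open>For the pulled-back differential, the coefficients
      \<open>\<alpha> (s j x)\<close> and \<open>\<alpha> (t j x)\<close> of the decomposition
      become derivatives of \<open>f\<close> along the anchored sections.\<close>
    have "anchor_dual A x (differential M f x) a = anchor A x a f" if "a \<in> fibre A x" for a
      using that anchor_tangent[OF pt] by (simp add: anchor_dual_def differential_def)
    then show ?thesis
      unfolding hamiltonian_def \<pi>[OF pt differential_dual[OF pt]] sh[OF x anchor_dual_dual[OF pt differential_dual[OF pt]]]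
      using sections_fibre[OF s pt] sections_fibre[OF t pt] by simp
  qed
  show ?thesis by (rule that[OF W s t ham])
qed

lemma hamiltonian_local:
  assumes f: "smooth_fun M U f" and x0: "x0 \<in> U"
  shows "\<exists>W a. x0 \<in> W \<and> W \<subseteq> U \<and> a \<in> sections M A W \<and> (\<forall>y\<in>W. hamiltonian M \<pi> f y = anchor A y (a y))"
proof -
  have U: "openin (man_top M) U" using f by (rule smooth_fun_open)
  obtain N s t where N: "openin (man_top M) N" "x0 \<in> N" and
    s: "\<And>j. j < bundle_rank A \<Longrightarrow> s j \<in> sections M A (points M)" and
    t: "\<And>j. j < bundle_rank A \<Longrightarrow> t j \<in> sections M A (points M)" and
    ham: "\<And>x f. x \<in> N \<Longrightarrow> hamiltonian M \<pi> f x = anchor A x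
      (\<Sum>j<bundle_rank A. anchor A x (s j x) f *\<^sub>R t j x - anchor A x (t j x) f *\<^sub>R s j x)"
    apply (rule hamiltonian_decomposition[OF open_point[OF U x0]])
    subgoal for W s t by (rule that[of W s t]) simp_all
    done
  define W where "W = N \<inter> U"
  have W: "openin (man_top M) W" "W \<subseteq> U" "W \<subseteq> N" using N U by (auto simp: W_def)
  note s' = sections_subset[OF s openin_subset[OF W(1)] W(1)]
  note t' = sections_subset[OF t openin_subset[OF W(1)] W(1)]
  have "(\<lambda>x. \<Sum>j<bundle_rank A. anchor A x (s j x) f *\<^sub>R t j x - anchor A x (t j x) f *\<^sub>R s j x) \<in> sections M A W"
    by (intro sections_sum sections_diff sections_scale s' t' W(1)
      vector_field_apply_smooth[OF anchor_field[OF s'] smooth_fun_subset[OF f W(2,1)]]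
      vector_field_apply_smooth[OF anchor_field[OF t'] smooth_fun_subset[OF f W(2,1)]]) auto
  then show ?thesis
    using ham N(2) x0 W(2,3) by (intro exI[of _ W] exI conjI) (auto simp: W_def)
qed

lemma modular_field_local:
  assumes \<mu>: "volume_form M U \<mu>" and V: "modular_field M \<pi> U \<mu> V" and x0: "x0 \<in> U"
  shows "\<exists>W a. x0 \<in> W \<and> W \<subseteq> U \<and> a \<in> sections M A W \<and> (\<forall>y\<in>W. V y = anchor A y (a y))"
proof -
  let ?r = "bundle_rank A"
  have U: "openin (man_top M) U" using \<mu> by (simp add: volume_form_def)
  obtain N s t where N: "openin (man_top M) N" "x0 \<in> N" and
    s: "\<And>j. j < ?r \<Longrightarrow> s j \<in> sections M A (points M)" and
    t: "\<And>j. j < ?r \<Longrightarrow> t j \<in> sections M A (points M)" and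
    ham: "\<And>x f. x \<in> N \<Longrightarrow> hamiltonian M \<pi> f x = anchor A x
      (\<Sum>j<?r. anchor A x (s j x) f *\<^sub>R t j x - anchor A x (t j x) f *\<^sub>R s j x)"
    apply (rule hamiltonian_decomposition[OF open_point[OF U x0]])
    subgoal for W s t by (rule that[of W s t]) simp_all
    done
  obtain N' Ys where N': "openin (man_top M) N'" "x0 \<in> N'" "N' \<subseteq> U" and len: "length Ys = man_dim M"
    and Ys': "set Ys \<subseteq> vector_fields M N'" and nz': "\<And>x. x \<in> N' \<Longrightarrow> \<mu> x (map (\<lambda>Y. Y x) Ys) \<noteq> 0"
    using volume_frame[OF \<mu> x0] by metis
  define W where "W = N \<inter> N'"
  have W: "openin (man_top M) W" "W \<subseteq> U" "W \<subseteq> N" "x0 \<in> W" using N N' by (auto simp: W_def)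
  have Ys: "set Ys \<subseteq> vector_fields M W"
    using Ys' T.sections_subset[OF _ _ W(1)] by (auto simp: W_def)
  note vol = \<mu> W(1,2) len Ys
  define m where "m x = \<mu> x (map (\<lambda>Y. Y x) Ys)" for x
  have nz: "m x \<noteq> 0" if "x \<in> W" for x using nz' that by (simp add: W_def m_def)
  note s' = sections_subset[OF s openin_subset[OF W(1)] W(1)]
  note t' = sections_subset[OF t openin_subset[OF W(1)] W(1)]
  define X where "X j y = anchor A y (s j y)" for j y
  define Y where "Y j y = anchor A y (t j y)" for j y
  have X: "X j \<in> vector_fields M W" if "j < ?r" for j unfolding X_def by (rule anchor_field[OF s'[OF that]])
  have Y: "Y j \<in> vector_fields M W" if "j < ?r" for j unfolding Y_def by (rule anchor_field[OF t'[OF that]])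
  let ?L = "\<lambda>Z. lie_derivative_form M Z \<mu> Ys"
  \<comment> \<open>This is the section named in the overview: \<open>m\<close> is the volume of the
    frame, and \<open>?L Z x * inverse (m x)\<close> is the divergence of \<open>Z\<close> at
    \<open>x\<close>.\<close>
  define a where "a x = (\<Sum>j<?r. (?L (Y j) x * inverse (m x)) *\<^sub>R s j x - (?L (X j) x * inverse (m x)) *\<^sub>R t j x -
      bracket A (s j) (t j) x)" for x
  have "smooth_fun M W m" unfolding m_def by (rule volume_form_smooth[OF vol])
  then have a: "a \<in> sections M A W"
    unfolding a_def
    using nz by (intro sections_sum sections_diff sections_scale smooth_fun_mult smooth_fun_inverse
      lie_derivative_smooth[OF vol] X Y s' t' W(1) sections_subset[OF bracket_section[OF s t] openin_subset[OF W(1)] W(1)]) auto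
  have "V x = anchor A x (a x)" if x: "x \<in> W" for x
  \<comment> \<open>A global test function is smooth on \<open>U\<close>, as the identity defining
    the modular field requires, and also on \<open>W\<close>, where the decomposition is
    available.\<close>
  proof (rule tangent_vector_eq_on_global)
    have pt: "x \<in> points M" using open_point[OF W(1) x] .
    show "V x \<in> tangent_space M x"
      using V vector_fields_tangent x W(2) unfolding modular_field_def by blast
    show "anchor A x (a x) \<in> tangent_space M x"
      using anchor_tangent[OF pt sections_fibre[OF a x]] .
    fix f assume f: "smooth_fun M (points M) f"
    have fU: "smooth_fun M U f" and fW: "smooth_fun M W f"
      using smooth_fun_subset[OF f openin_subset] U W(1) by auto
    have sx: "s j x \<in> fibre A x" "t j x \<in> fibre A x" "bracket A (s j) (t j) x \<in> fibre A x" if "j < ?r" for j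
      using sections_fibre[OF s pt] sections_fibre[OF t pt] sections_fibre[OF bracket_section[OF s t] pt] that by auto
    \<comment> \<open>The minus sign is moved into the coefficients, so that both sums have the form
      treated by \<open>lie_derivative_lincomb\<close>.\<close>
    have hamW: "hamiltonian M \<pi> f y = (\<Sum>j<?r. X j y f *\<^sub>R Y j y) + (\<Sum>j<?r. (- 1 * Y j y f) *\<^sub>R X j y)" if y: "y \<in> W" for y
    proof -
      have pt: "y \<in> points M" using open_point[OF W(1) y] .
      \<comment> \<open>The scalar 1 brings the sum into the shape of
        \<open>anchor_sum\<close>.\<close>
      have "anchor A y (\<Sum>j<?r. 1 *\<^sub>R (X j y f *\<^sub>R t j y - Y j y f *\<^sub>R s j y)) =
          (\<Sum>j<?r. 1 *\<^sub>R anchor A y (X j y f *\<^sub>R t j y - Y j y f *\<^sub>R s j y))"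
        using sections_fibre[OF s pt] sections_fibre[OF t pt] subspace_fibre[OF pt]
        by (intro anchor_sum pt subspace_diff subspace_scale) auto
      also have "\<dots> = (\<Sum>j<?r. X j y f *\<^sub>R Y j y - Y j y f *\<^sub>R X j y)"
        using anchor_diff[OF pt sections_fibre[OF t pt] sections_fibre[OF s pt]]
        by (intro sum.cong) (auto simp: X_def Y_def)
      finally show ?thesis
        using ham[of y f] y W(3) by (simp add: X_def[symmetric] Y_def[symmetric] subset_iff sum_subtractf sum_negf)
    qed
    have YX: "smooth_fun M W (\<lambda>y. X j y f)" "smooth_fun M W (\<lambda>y. - 1 * Y j y f)" "smooth_fun M W (\<lambda>y. Y j y f)"
      if "j < ?r" for j
      by (intro vector_field_apply_smooth[OF X[OF that] fW] vector_field_apply_smooth[OF Y[OF that] fW]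
        smooth_fun_mult smooth_fun_const W(1))+
    have brk: "anchor A x (bracket A (s j) (t j) x) f = X j x (\<lambda>y. Y j y f) - Y j x (\<lambda>y. X j y f)" if "j < ?r" for j
      using anchor_bracket[OF s[OF that] t[OF that] pt] smooth_nearI[OF fW x]
      by (simp add: vf_bracket_def X_def Y_def)
    have neg: "X j x (\<lambda>y. - 1 * Y j y f) = - X j x (\<lambda>y. Y j y f)" if "j < ?r" for j
      using tangent_vector_cmult[OF vector_fields_tangent[OF X[OF that] x] smooth_nearI[OF YX(3)[OF that] x], of "- 1"]
      by simp
    have "V x f * m x = ?L (hamiltonian M \<pi> f) x"
      using V fU W(1,2) len Ys x unfolding modular_field_def m_def by metis
    also have "\<dots> = ?L (\<lambda>y. (\<Sum>j<?r. X j y f *\<^sub>R Y j y) + (\<Sum>j<?r. (- 1 * Y j y f) *\<^sub>R X j y)) x"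
      by (rule lie_derivative_cong[OF vol x hamW])
    also have "\<dots> = ?L (\<lambda>y. \<Sum>j<?r. X j y f *\<^sub>R Y j y) x + ?L (\<lambda>y. \<Sum>j<?r. (- 1 * Y j y f) *\<^sub>R X j y) x"
      using X Y YX by (intro lie_derivative_add[OF vol x] T.sections_sum T.sections_scale W(1)) auto
    also have "?L (\<lambda>y. \<Sum>j<?r. X j y f *\<^sub>R Y j y) x = (\<Sum>j<?r. X j x f * ?L (Y j) x + Y j x (\<lambda>y. X j y f) * m x)"
      using X Y YX nz[OF x] unfolding m_def by (intro lie_derivative_lincomb[OF vol x]) auto
    also have "?L (\<lambda>y. \<Sum>j<?r. (- 1 * Y j y f) *\<^sub>R X j y) x =
        (\<Sum>j<?r. (- 1 * Y j x f) * ?L (X j) x + X j x (\<lambda>y. - 1 * Y j y f) * m x)"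
      using X Y YX nz[OF x] unfolding m_def by (intro lie_derivative_lincomb[OF vol x]) auto
    \<comment> \<open>Second derivatives of \<open>f\<close> occur only as Y_j (X_j f) - X_j (Y_j
      f); by \<open>brk\<close> this is minus the anchored bracket applied to
      \<open>f\<close>.\<close>
    also have "(\<Sum>j<?r. X j x f * ?L (Y j) x + Y j x (\<lambda>y. X j y f) * m x) +
        (\<Sum>j<?r. (- 1 * Y j x f) * ?L (X j) x + X j x (\<lambda>y. - 1 * Y j y f) * m x) =
        (\<Sum>j<?r. (?L (Y j) x * inverse (m x)) * X j x f - (?L (X j) x * inverse (m x)) * Y j x f -
          anchor A x (bracket A (s j) (t j) x) f) * m x"
      unfolding sum.distrib[symmetric] sum_distrib_right
    proof (rule sum.cong[OF refl])
      fix j assume "j \<in> {..<?r}"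
      then have j: "j < ?r" by simp
      show "X j x f * ?L (Y j) x + Y j x (\<lambda>y. X j y f) * m x +
          ((- 1 * Y j x f) * ?L (X j) x + X j x (\<lambda>y. - 1 * Y j y f) * m x) =
          ((?L (Y j) x * inverse (m x)) * X j x f - (?L (X j) x * inverse (m x)) * Y j x f -
            anchor A x (bracket A (s j) (t j) x) f) * m x"
        unfolding brk[OF j] neg[OF j] using nz[OF x] by (simp add: field_simps)
    qed
    finally have "V x f = (\<Sum>j<?r. (?L (Y j) x * inverse (m x)) * X j x f - (?L (X j) x * inverse (m x)) * Y j x f -
          anchor A x (bracket A (s j) (t j) x) f)"
      using nz[OF x] by simp
    moreover have "anchor A x (a x) = (\<Sum>j<?r. (?L (Y j) x * inverse (m x)) *\<^sub>R X j x -
        (?L (X j) x * inverse (m x)) *\<^sub>R Y j x - anchor A x (bracket A (s j) (t j) x))"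
    proof -
      have "anchor A x (a x) = anchor A x (\<Sum>j<?r. 1 *\<^sub>R ((?L (Y j) x * inverse (m x)) *\<^sub>R s j x -
          (?L (X j) x * inverse (m x)) *\<^sub>R t j x - bracket A (s j) (t j) x))"
        by (simp add: a_def)
      also have "\<dots> = (\<Sum>j<?r. 1 *\<^sub>R anchor A x ((?L (Y j) x * inverse (m x)) *\<^sub>R s j x -
          (?L (X j) x * inverse (m x)) *\<^sub>R t j x - bracket A (s j) (t j) x))"
        using sx subspace_fibre[OF pt] by (intro anchor_sum pt subspace_diff subspace_scale) auto
      also have "\<dots> = (\<Sum>j<?r. (?L (Y j) x * inverse (m x)) *\<^sub>R X j x -
          (?L (X j) x * inverse (m x)) *\<^sub>R Y j x - anchor A x (bracket A (s j) (t j) x))"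
      proof (rule sum.cong[OF refl])
        fix j assume "j \<in> {..<?r}"
        then have j: "j < ?r" by simp
        let ?u = "(?L (Y j) x * inverse (m x)) *\<^sub>R s j x - (?L (X j) x * inverse (m x)) *\<^sub>R t j x"
        have u: "?u \<in> fibre A x"
          using sx[OF j] subspace_fibre[OF pt] by (intro subspace_diff subspace_scale)
        show "1 *\<^sub>R anchor A x (?u - bracket A (s j) (t j) x) =
            (?L (Y j) x * inverse (m x)) *\<^sub>R X j x - (?L (X j) x * inverse (m x)) *\<^sub>R Y j x -
            anchor A x (bracket A (s j) (t j) x)"
          using anchor_diff[OF pt u sx(3)[OF j], of 1 1] anchor_diff[OF pt sx(1,2)[OF j]]
          by (simp add: X_def Y_def)
      qed
      finally show ?thesis .
    qed
    ultimately show "V x f = anchor A x (a x) f"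
      by (simp add: sum_fun_apply scaleR_fun_def)
  qed
  then show ?thesis using a W by blast
qed

lemma modular_foliation_anchor_image:
  assumes U: "openin (man_top M) U"
  shows "modular_foliation M \<pi> U \<subseteq> anchor_image M A U"
proof
  fix V assume V: "V \<in> modular_foliation M \<pi> U"
  show "V \<in> anchor_image M A U"
  proof (rule anchor_image_localI[OF U])
    fix x assume x: "x \<in> U"
    from V[unfolded modular_foliation_def spanned_sheaf_def mem_Collect_eq, rule_format, OF x]
    obtain W and n :: nat and g Z where W: "x \<in> W" "W \<subseteq> U" "openin (man_top M) W" and
      gZ: "\<forall>k<n. smooth_fun M W (g k) \<and> Z k \<in> {hamiltonian M \<pi> f | f. smooth_fun M W f} \<union>
        {V. \<exists>\<mu>. volume_form M W \<mu> \<and> modular_field M \<pi> W \<mu> V}" and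
      VW: "\<forall>y\<in>W. V y = (\<Sum>k<n. g k y *\<^sub>R Z k y)"
      by (elim exE conjE) (rule that)
    have g: "smooth_fun M W (g k)" if "k < n" for k using gZ that by blast
    have "\<exists>W' a. x \<in> W' \<and> W' \<subseteq> W \<and> a \<in> sections M A W' \<and> (\<forall>y\<in>W'. Z k y = anchor A y (a y))" if k: "k < n" for k
    proof -
      consider f where "Z k = hamiltonian M \<pi> f" "smooth_fun M W f"
        | \<mu> where "volume_form M W \<mu>" "modular_field M \<pi> W \<mu> (Z k)"
        using gZ k by auto
      then show ?thesis
      proof cases
        case 1
        then show ?thesis using hamiltonian_local[OF 1(2) W(1)] by simp
      next
        case 2
        then show ?thesis by (rule modular_field_local[OF _ _ W(1)])
      qed
    qed
    then obtain W' a where W': "\<And>k. k < n \<Longrightarrow> x \<in> W' k" "\<And>k. k < n \<Longrightarrow> W' k \<subseteq> W"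
      and a: "\<And>k. k < n \<Longrightarrow> a k \<in> sections M A (W' k)"
      and Za: "\<And>k y. k < n \<Longrightarrow> y \<in> W' k \<Longrightarrow> Z k y = anchor A y (a k y)"
      by metis
    \<comment> \<open>Intersecting with \<open>points M\<close> makes this set open for
      \<open>n = 0\<close> as well, where the empty intersection is the whole type.\<close>
    define N where "N = W \<inter> ((\<Inter>k\<in>{..<n}. W' k) \<inter> points M)"
    have N: "openin (man_top M) N"
      unfolding N_def using sections_open[OF a] by (intro openin_Int W(3) openin_INT) auto
    have NW: "N \<subseteq> W" "\<And>k. k < n \<Longrightarrow> N \<subseteq> W' k" by (auto simp: N_def)
    have aN: "a k \<in> sections M A N" if "k < n" for k
      by (rule sections_subset[OF a[OF that] NW(2)[OF that] N])
    have "(\<lambda>y. \<Sum>k<n. g k y *\<^sub>R a k y) \<in> sections M A N"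
      using smooth_fun_subset[OF g NW(1) N] aN by (intro sections_sum sections_scale N) auto
    moreover have "V y = anchor A y (\<Sum>k<n. g k y *\<^sub>R a k y)" if y: "y \<in> N" for y
    proof -
      have "anchor A y (\<Sum>k<n. g k y *\<^sub>R a k y) = (\<Sum>k<n. g k y *\<^sub>R anchor A y (a k y))"
        using sections_fibre[OF aN y] by (intro anchor_sum open_point[OF N y]) auto
      moreover have "y \<in> W" "\<And>k. k < n \<Longrightarrow> y \<in> W' k" using NW y by auto
      ultimately show ?thesis using VW Za by simp
    qed
    moreover have "x \<in> N" using W(1,2) W'(1) open_point[OF U x] by (auto simp: N_def)
    ultimately show "\<exists>W s. x \<in> W \<and> W \<subseteq> U \<and> s \<in> sections M A W \<and> (\<forall>y\<in>W. V y = anchor A y (s y))"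
      using NW(1) W(2) by blast
  qed
qed

end

text \<open>In a chart a one-form is a combination of the differentials of the coordinates, so its
  image under sharp is a combination of their Hamiltonian fields. Coordinates exist only locally,
  which the local form of \<open>spanned_sheaf\<close> permits.\<close>

lemma hamiltonian_sheaf_modular_foliation:
  assumes \<pi>: "bivector_field M (tangent_algebroid M) \<pi>" and U: "openin (man_top M) U"
  shows "hamiltonian_sheaf M \<pi> U \<subseteq> modular_foliation M \<pi> U"
proof
  fix V assume "V \<in> hamiltonian_sheaf M \<pi> U"
  then obtain \<alpha> where \<alpha>: "\<alpha> \<in> one_forms M U" and V: "\<And>x. x \<in> U \<Longrightarrow> V x = sharp (tangent_algebroid M) \<pi> x (\<alpha> x)"
    unfolding hamiltonian_sheaf_def by blast
  have "\<exists>W. x \<in> W \<and> W \<subseteq> U \<and> openin (man_top M) W \<and> (\<exists>(n::nat) g Z. (\<forall>k<n. smooth_fun M W (g k) \<and>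
      Z k \<in> {hamiltonian M \<pi> f | f. smooth_fun M W f} \<union> {V. \<exists>\<mu>. volume_form M W \<mu> \<and> modular_field M \<pi> W \<mu> V}) \<and>
      (\<forall>y\<in>W. V y = (\<Sum>k<n. g k y *\<^sub>R Z k y)))" if x: "x \<in> U" for x
  proof -
    obtain c where c: "c \<in> atlas M" "x \<in> fst c" using chart_at open_point[OF U x] by metis
    define W where "W = fst c \<inter> U"
    have W: "openin (man_top M) W" "W \<subseteq> U" "W \<subseteq> fst c" "x \<in> W" using c U x by (auto simp: W_def)
    have frame: "(fst c, coord_vector M c) \<in> frames (tangent_algebroid M)" using c(1) by auto
    have coord: "smooth_fun M W (\<lambda>y. snd c y k)" if "k < man_dim M" for k
      by (rule smooth_fun_subset[OF smooth_fun_coord[OF c(1) that] W(3,1)])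
    have "smooth_fun M W (\<lambda>y. \<alpha> y (coord_vector M c k y))" if "k < man_dim M" for k
    proof -
      have "coord_vector M c k \<in> vector_fields M W"
        using T.sections_subset[OF T.frame_section[OF frame] W(3,1)] that by simp
      then show ?thesis using \<alpha> W(2) unfolding dual_sections_def by blast
    qed
    moreover have "V y = (\<Sum>k<man_dim M. \<alpha> y (coord_vector M c k y) *\<^sub>R hamiltonian M \<pi> (\<lambda>y. snd c y k) y)"
      if y: "y \<in> W" for y
    proof -
      have pt: "y \<in> points M" using open_point[OF W(1) y] .
      have \<alpha>y: "\<alpha> y \<in> dual (tangent_space M y)" using \<alpha> y W(2) by (auto simp: dual_sections_def)
      \<comment> \<open>The frame dual to the coordinate vectors consists of the differentials of
        the coordinates, which brings Hamiltonian fields into play.\<close>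
      have "dual_frame (tangent_algebroid M) (coord_vector M c) k y = differential M (\<lambda>y. snd c y k) y"
        if "k < man_dim M" for k
        using frame_coeff_coord[OF c(1) _ _ that] y W(3) by (auto simp: dual_frame_def differential_def fun_eq_iff)
      then have "\<alpha> y = (\<Sum>k<man_dim M. \<alpha> y (coord_vector M c k y) *\<^sub>R differential M (\<lambda>y. snd c y k) y)"
        using T.dual_expand[OF frame, of y "\<alpha> y"] \<alpha>y y W(3) by auto
      then have "V y = sharp (tangent_algebroid M) \<pi> y
          (\<Sum>k<man_dim M. \<alpha> y (coord_vector M c k y) *\<^sub>R differential M (\<lambda>y. snd c y k) y)"
        using V y W(2) by auto
      also have "\<dots> = (\<Sum>k<man_dim M. \<alpha> y (coord_vector M c k y) *\<^sub>R hamiltonian M \<pi> (\<lambda>y. snd c y k) y)"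
        unfolding hamiltonian_def by (rule T.sharp_sum[OF \<pi> pt]) (simp add: differential_dual[OF pt])
      finally show ?thesis .
    qed
    moreover have "hamiltonian M \<pi> (\<lambda>y. snd c y k) \<in> {hamiltonian M \<pi> f | f. smooth_fun M W f} \<union>
        {V. \<exists>\<mu>. volume_form M W \<mu> \<and> modular_field M \<pi> W \<mu> V}" if "k < man_dim M" for k
      by (rule UnI1) (use coord[OF that] in blast)
    ultimately show ?thesis
      using W(1,2,4) by (intro exI[of _ W] conjI exI[of _ "man_dim M"] exI[of _ "\<lambda>k y. \<alpha> y (coord_vector M c k y)"]
        exI[of _ "\<lambda>k. hamiltonian M \<pi> (\<lambda>y. snd c y k)"] allI impI ballI)
  qed
  then show "V \<in> modular_foliation M \<pi> U"
    unfolding modular_foliation_def spanned_sheaf_def by blast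
qed

text \<open>The image of sharp lies in the image of the anchor by \<open>sharp_anchor_image\<close>,
  and along an orbit the latter is the tangent space.\<close>

lemma orbit_poisson_submanifold:
  assumes P: "bivector_field M A P"
    and \<pi>: "\<And>x \<alpha>. x \<in> points M \<Longrightarrow> \<alpha> \<in> dual (tangent_space M x) \<Longrightarrow>
      sharp (tangent_algebroid M) \<pi> x \<alpha> = anchor A x (sharp A P x (anchor_dual A x \<alpha>))"
    and N: "orbit M A N"
  shows "poisson_submanifold M \<pi> N"
proof -
  have N: "immersed_submanifold M N" "\<And>x. x \<in> points N \<Longrightarrow> sub_tangent_space M N x = anchor A x ` fibre A x"
    using N by (auto simp: orbit_def integral_manifold_def)
  have "points N \<subseteq> points M"
    using N(1) continuous_map_image_subset_topspace[of "man_top N" "man_top M" "\<lambda>y. y"]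
    by (simp add: immersed_submanifold_def smooth_map_def)
  then show ?thesis
    using N sharp_anchor_image[OF P \<pi>] by (simp add: poisson_submanifold_def subset_iff)
qed

end

theorem theorem3:
  fixes X :: "'x manifold"
    and A :: "('x, 'v::real_vector) algebroid"
    and \<pi> :: "'x \<Rightarrow> 'x tvec bivec"
  assumes "smooth_manifold X"
    and "lie_algebroid X A"
    and "poisson_structure X \<pi>"
    and "of_algebroid_type X A \<pi>"
  shows "(\<forall>U. openin (man_top X) U \<longrightarrow>
            hamiltonian_sheaf X \<pi> U \<subseteq> modular_foliation X \<pi> U \<and>
            modular_foliation X \<pi> U \<subseteq> anchor_image X A U \<and>
            anchor_image X A U \<subseteq> vector_fields X U) \<and>
         (\<forall>N. orbit X A N \<longrightarrow> poisson_submanifold X \<pi> N)"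
proof -
  interpret algebroid_charts X A
    using assms(1,2) by unfold_locales
  have \<pi>: "bivector_field X (tangent_algebroid X) \<pi>"
    using assms(3) by (simp add: poisson_structure_def algebroid_poisson_def)
  obtain P where P: "bivector_field X A P" and sharp: "\<And>x \<alpha>. x \<in> points X \<Longrightarrow> \<alpha> \<in> dual (tangent_space X x) \<Longrightarrow>
      sharp (tangent_algebroid X) \<pi> x \<alpha> = anchor A x (sharp A P x (anchor_dual A x \<alpha>))"
    using assms(4) by (auto simp: of_algebroid_type_def algebroid_poisson_def)
  show ?thesis
    by (intro conjI allI impI hamiltonian_sheaf_modular_foliation[OF \<pi>] anchor_image_vector_fields
      modular_foliation_anchor_image[OF P] orbit_poisson_submanifold[OF P] sharp)
qed

end
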